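(* Let $n\ge 1$ be an integer, let $\Omega\subset\mathbb{R}^n$ be a domain (nonempty connected open set) with finite Lebesgue measure, and let $f:[0,\infty)\to[0,\infty)$ be Borel measurable with $\lim_{t\to\infty}f(t)=\infty$. Then for every $\tau>0$ and every $p\in(1,\infty)$, $$\sup_{u\in \tilde{H}^{\frac np,p}(\mathbb{R}^n),\ \|(\tau I-\Delta)^{\frac{n}{2p}}u\|_{L^p(\mathbb{R}^n)}\leq 1}\ \int_{\Omega}f(|u|)\,e^{\alpha_{n,p}|u|^{p'}}\,dx=\infty,$$ and $$\sup_{u\in \tilde{H}^{\frac np,p}(\mathbb{R}^n),\ \|(\tau I-\Delta)^{\frac{n}{2p}}u\|_{L^p(\mathbb{R}^n)}\leq 1}\ \int_{\mathbb{R}^n}f(|u|)\,\Phi(\alpha_{n,p}|u|^{p'})\,dx=\infty.$$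
   Context: Here $p'=\frac{p}{p-1}$, $$\alpha_{n,p}=\frac{n}{|S^{n-1}|}\left(\frac{\Gamma\left(\frac{n}{2p}\right)2^{\frac np}\pi^{\frac n2}}{\Gamma\left(\frac{np-n}{2p}\right)}\right)^{p'},$$ with $|S^{n-1}|$ the surface measure of the unit sphere in $\mathbb{R}^n$ (so $|S^0|=2$), and $$\Phi(t)=e^t-\sum_{j=0}^{j_p-2}\frac{t^j}{j!},\qquad j_p=\min\{j\in\mathbb{N}:j\ge p\}.$$ Let $\mathcal{S}(\mathbb{R}^n)$ be the Schwartz space and $\mathcal{F}$ (also $\hat{\ }$) the normalized (unitary) Fourier transform $\hat\varphi(\xi)=(2\pi)^{-n/2}\int_{\mathbb{R}^n} e^{-ix\cdot\xi}\varphi(x)\,dx$. For $s>0$ and $\varphi\in\mathcal{S}(\mathbb{R}^n)$, $(-\Delta)^s\varphi=\mathcal{F}^{-1}(|\xi|^{2s}\hat\varphi)$. For $u$ in $L_s(\mathbb{R}^n)=\{u\in L^1_{loc}(\mathbb{R}^n):\int_{\mathbb{R}^n}\frac{|u(x)|}{1+|x|^{n+2s}}dx<\infty\}$, $(-\Delta)^su$ is defined by duality: $\langle(-\Delta)^su,\varphi\rangle=\int_{\mathbb{R}^n}u\,(-\Delta)^s\varphi\,dx$ for $\varphi\in\mathcal{S}(\mathbb{R}^n)$. The operator $(\tau I-\Delta)^s$ is the Fourier multiplier $\mathcal{F}((\tau I-\Delta)^su)=(\tau+|\xi|^2)^s\hat u$ (on tempered distributions). $\tilde{H}^{s,p}(\mathbb{R}^n)=\{u\in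 L^p(\mathbb{R}^n): (-\Delta)^{\frac s2}u\in L^p(\mathbb{R}^n)\}$ for $s>0$, $1\le p\le\infty$. *)

theory Defs
  imports "HOL-Analysis.Analysis"
begin

section \<open>Lebesgue spaces\<close>

text \<open>
  Elements of Lebesgue spaces are Borel representatives; all notions below depend only on the
  class of a function modulo null sets.  Only finite exponents are needed.
\<close>

definition Lp_space :: "real \<Rightarrow> ('a::euclidean_space \<Rightarrow> real) set" where
  "Lp_space p = {u \<in> borel_measurable lborel. integrable lborel (\<lambda>x. \<bar>u x\<bar> powr p)}"

definition Lp_norm :: "real \<Rightarrow> ('a::euclidean_space \<Rightarrow> real) \<Rightarrow> real" where
  "Lp_norm p u = (LINT x|lborel. \<bar>u x\<bar> powr p) powr (1 / p)"

definition L1_loc :: "('a::euclidean_space \<Rightarrow> real) set" where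
  "L1_loc = {u \<in> borel_measurable lborel. \<forall>K. compact K \<longrightarrow> set_integrable lborel K u}"

definition L_weighted :: "real \<Rightarrow> ('a::euclidean_space \<Rightarrow> real) set" where
  "L_weighted s = {u \<in> L1_loc.
     integrable lborel (\<lambda>x. \<bar>u x\<bar> / (1 + norm x powr (real DIM('a) + 2 * s)))}"

section \<open>Schwartz functions and the Fourier transform\<close>

fun iter_partial ::
  "'a list \<Rightarrow> ('a::euclidean_space \<Rightarrow> complex) \<Rightarrow> 'a \<Rightarrow> complex" where
  "iter_partial [] \<phi> = \<phi>"
| "iter_partial (b # bs) \<phi> = (\<lambda>x. frechet_derivative (iter_partial bs \<phi>) (at x) b)"

text \<open>
  Differentiability of all iterated partial derivatives amounts to smoothness; the second condition
  is the finiteness of all Schwartz seminorms.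
\<close>

definition schwartz :: "('a::euclidean_space \<Rightarrow> complex) set" where
  "schwartz = {\<phi>. \<forall>bs \<in> lists Basis.
     (\<forall>x. iter_partial bs \<phi> differentiable (at x)) \<and>
     (\<forall>k::nat. bounded (range (\<lambda>x. norm x ^ k *\<^sub>R iter_partial bs \<phi> x)))}"

definition fourier :: "('a::euclidean_space \<Rightarrow> complex) \<Rightarrow> 'a \<Rightarrow> complex" where
  "fourier \<phi> \<xi> = (2 * pi) powr (- real DIM('a) / 2) *\<^sub>R
     (LINT x|lborel. exp (- \<i> * of_real (x \<bullet> \<xi>)) * \<phi> x)"

definition inv_fourier :: "('a::euclidean_space \<Rightarrow> complex) \<Rightarrow> 'a \<Rightarrow> complex" where
  "inv_fourier \<psi> x = (2 * pi) powr (- real DIM('a) / 2) *\<^sub>R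
     (LINT \<xi>|lborel. exp (\<i> * of_real (x \<bullet> \<xi>)) * \<psi> \<xi>)"

section \<open>Distributions\<close>

text \<open>
  Distributions are functionals whose values are relevant on Schwartz functions only; the pairing
  is bilinear (no complex conjugation).
\<close>

type_synonym 'a functional = "('a \<Rightarrow> complex) \<Rightarrow> complex"

definition regular_dist :: "('a::euclidean_space \<Rightarrow> real) \<Rightarrow> 'a functional" where
  "regular_dist u \<phi> = (LINT x|lborel. of_real (u x) * \<phi> x)"

definition represents :: "('a::euclidean_space \<Rightarrow> real) \<Rightarrow> 'a functional \<Rightarrow> bool" where
  "represents g T \<longleftrightarrow> (\<forall>\<phi> \<in> schwartz. T \<phi> = regular_dist g \<phi>)"

text \<open>
  A function in $L^p$ representing a distribution is unique up to null sets, so the infimum is over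
  at most one value; it is infinite if the distribution is not in $L^p$.
\<close>

definition dist_Lp_norm :: "real \<Rightarrow> ('a::euclidean_space) functional \<Rightarrow> ennreal" where
  "dist_Lp_norm p T = (INF g \<in> {g \<in> Lp_space p. represents g T}. ennreal (Lp_norm p g))"

definition dist_fourier :: "('a::euclidean_space) functional \<Rightarrow> 'a functional" where
  "dist_fourier T \<phi> = T (fourier \<phi>)"

definition dist_inv_fourier :: "('a::euclidean_space) functional \<Rightarrow> 'a functional" where
  "dist_inv_fourier T \<phi> = T (inv_fourier \<phi>)"

definition dist_mult :: "('a::euclidean_space \<Rightarrow> real) \<Rightarrow> 'a functional \<Rightarrow> 'a functional" where
  "dist_mult m T \<phi> = T (\<lambda>\<xi>. of_real (m \<xi>) * \<phi> \<xi>)"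

section \<open>The fractional operators\<close>

definition frac_laplacian_schwartz ::
  "real \<Rightarrow> ('a::euclidean_space \<Rightarrow> complex) \<Rightarrow> 'a \<Rightarrow> complex" where
  "frac_laplacian_schwartz s \<phi> =
     inv_fourier (\<lambda>\<xi>. of_real (norm \<xi> powr (2 * s)) * fourier \<phi> \<xi>)"

text \<open>Meaningful for \<open>u \<in> L_weighted s\<close>, where the pairing is absolutely convergent.\<close>

definition frac_laplacian :: "real \<Rightarrow> ('a::euclidean_space \<Rightarrow> real) \<Rightarrow> 'a functional" where
  "frac_laplacian s u \<phi> = regular_dist u (frac_laplacian_schwartz s \<phi>)"

definition bessel_op :: "real \<Rightarrow> real \<Rightarrow> ('a::euclidean_space) functional \<Rightarrow> 'a functional" where
  "bessel_op \<tau> s T =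
     dist_inv_fourier (dist_mult (\<lambda>\<xi>. (\<tau> + norm \<xi> ^ 2) powr s) (dist_fourier T))"

definition H_tilde :: "real \<Rightarrow> real \<Rightarrow> ('a::euclidean_space \<Rightarrow> real) set" where
  "H_tilde s p = {u \<in> Lp_space p. u \<in> L_weighted (s / 2) \<and>
     (\<exists>g \<in> Lp_space p. represents g (frac_laplacian (s / 2) u))}"

section \<open>The sharp constant and the truncated exponential\<close>

text \<open>
  The surface measure on the unit sphere that occurs in polar coordinates: $n$ times the Lebesgue
  measure of the cone over a subset of the sphere.
\<close>

definition sphere_measure :: "('a::euclidean_space) set \<Rightarrow> real" where
  "sphere_measure E =
     real DIM('a) * measure lborel {r *\<^sub>R x | r x. 0 < r \<and> r \<le> 1 \<and> x \<in> E}"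

lemma sphere_measure_unit_sphere:
  "sphere_measure (sphere (0::'a::euclidean_space) 1) =
     2 * pi powr (real DIM('a) / 2) / Gamma (real DIM('a) / 2)"
proof -
  have cone: "{r *\<^sub>R x | r x. 0 < r \<and> r \<le> 1 \<and> x \<in> sphere (0::'a) 1} = cball 0 1 - {0}"
    (is "?L = ?R")
  proof (intro equalityI subsetI)
    fix y :: 'a assume "y \<in> ?R"
    then have "y = norm y *\<^sub>R (y /\<^sub>R norm y) \<and> 0 < norm y \<and> norm y \<le> 1 \<and> y /\<^sub>R norm y \<in> sphere 0 1"
      by auto
    then show "y \<in> ?L" by blast
  qed auto
  have "measure lborel (cball (0::'a) 1 - {0}) = measure lborel (cball (0::'a) 1)"
    by (rule measure_Diff_null_set) auto
  also have "\<dots> = unit_ball_vol (real DIM('a))"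
    using content_cball[of 1 "0::'a"] by simp
  finally have "sphere_measure (sphere (0::'a) 1) = real DIM('a) * unit_ball_vol (real DIM('a))"
    unfolding sphere_measure_def cone by simp
  moreover have "Gamma (real DIM('a) / 2 + 1) = real DIM('a) / 2 * Gamma (real DIM('a) / 2)"
    by (rule Gamma_plus1) (auto dest: nonpos_Ints_nonpos)
  ultimately show ?thesis
    by (simp add: unit_ball_vol_def)
qed

definition conj_exp :: "real \<Rightarrow> real" where
  "conj_exp p = p / (p - 1)"

definition alpha :: "'a::euclidean_space itself \<Rightarrow> real \<Rightarrow> real" where
  "alpha _ p = (let n = real DIM('a) in
     n / sphere_measure (sphere (0::'a) 1) *
     (Gamma (n / (2 * p)) * 2 powr (n / p) * pi powr (n / 2) / Gamma ((n * p - n) / (2 * p)))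
       powr conj_exp p)"

text \<open>For \<open>p > 1\<close> the truncated subtraction below is harmless, as then \<open>j\<^sub>p \<ge> 2\<close>.\<close>

definition trunc_exp :: "real \<Rightarrow> real \<Rightarrow> real" where
  "trunc_exp p t = exp t - (\<Sum>j = 0..(LEAST j::nat. real j \<ge> p) - 2. t ^ j / fact j)"

end

theory Submission
  imports Defs "HOL-Probability.Characteristic_Functions"
begin

text \<open>
  The suprema are infinite because the constant \<open>\<alpha> = alpha TYPE('a) p\<close> is so large that functions
  concentrating at one point exhaust it up to a bounded factor, and the unbounded factor \<open>f\<close> beats
  every bounded one.  Put \<open>n = DIM('a)\<close>, \<open>s = n / p\<close>, \<open>a = s / 2\<close>, let \<open>\<omega>\<close> be the area of the unit
  sphere and \<open>q = conj_exp p\<close>.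

  The competitors are the Bessel potentials \<open>u = (\<tau> - \<Delta>)\<^sup>-\<^sup>a g\<close> of the functions of Adams,
  \<open>g(x) = c |x - x\<^sub>0|\<^sup>-\<^sup>s\<close> on the annulus \<open>\<epsilon> < |x - x\<^sub>0| < 1\<close>.  Since \<open>s p = n\<close>, the choice
  \<open>c = (\<omega> ln (1/\<epsilon>))\<close> to the power \<open>- 1 / p\<close> gives \<open>g\<close> the norm \<open>1\<close> in \<open>L\<^sup>p\<close>.  Near the origin the kernel
  of the Bessel potential is the Riesz kernel \<open>\<gamma> |x|\<close> to the power \<open>s - n\<close>, up to an error that is
  smaller by a power of \<open>|x|\<close> (\<open>bessel_kernel_lower_bound\<close>), and \<open>\<alpha>\<close> is \<open>n / \<omega>\<close> times \<open>\<gamma>\<close> to the power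
  \<open>- q\<close>.  For \<open>|x - x\<^sub>0| \<le> \<epsilon> / 2\<close> the convolution therefore integrates
  \<open>c \<gamma> |y|\<^sup>-\<^sup>n\<close> over the annulus and loses only a bounded amount:
  \<open>u(x) \<ge> c \<gamma> (\<omega> ln (1/\<epsilon>) - D)\<close> with \<open>D\<close> independent of \<open>\<epsilon>\<close>
  (\<open>bessel_potential_adams_lower_bound\<close>).  Bernoulli's inequality turns this into
  \<open>\<alpha> u\<^sup>q \<ge> n ln (1/\<epsilon>) - D'\<close> (\<open>adams_exponent_bound\<close>), so that \<open>exp (\<alpha> u\<^sup>q)\<close> is at least a constant
  times \<open>\<epsilon>\<^sup>-\<^sup>n\<close> on a ball whose volume is a constant times \<open>\<epsilon>\<^sup>n\<close>.  The integral of the exponential over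
  that ball stays bounded below while \<open>u\<close>, and with it \<open>f \<circ> u\<close>, tends to infinity there.  The
  truncated exponential is at least half the exponential for large arguments.

  It remains to see that \<open>u\<close> is admissible.  Both \<open>u\<close> and \<open>(-\<Delta>)\<^sup>a u\<close> are obtained from \<open>g\<close> by convolution
  with integrable superpositions \<open>\<integral> w(t) H\<^sub>t dt\<close> of heat kernels, whose Fourier multiplier is the
  Laplace transform of \<open>w\<close> at \<open>|\<xi>|\<^sup>2\<close>: for \<open>u\<close> this is a Gamma integral, and for \<open>(-\<Delta>)\<^sup>a u - g\<close> it is
  the binomial series of \<open>(1 - \<tau> / (\<tau> + |\<xi>|\<^sup>2))\<close> to the power \<open>a\<close>, which converges absolutely because
  \<open>a > 0\<close>.  Fourier inversion for Schwartz functions then identifies the distributions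
  \<open>(\<tau> - \<Delta>)\<^sup>a u\<close> and \<open>(-\<Delta>)\<^sup>a u\<close> with functions that are integrable and bounded, hence in \<open>L\<^sup>p\<close>
  (\<open>bessel_op_bessel_potential\<close>, \<open>frac_laplacian_bessel_potential\<close>).
\<close>

section \<open>Change of variables and radial integration\<close>

lemma lborel_integral_affine:
  fixes f :: "'a::euclidean_space \<Rightarrow> 'b::{banach,second_countable_topology}"
  assumes [measurable]: "f \<in> borel_measurable borel" and c: "c \<noteq> 0"
  shows "(LINT x|lborel. f x) = \<bar>c\<bar> ^ DIM('a) *\<^sub>R (LINT x|lborel. f (t + c *\<^sub>R x))"
  by (subst lborel_affine[OF c, of t]) (simp add: integral_density integral_distr)

lemma lborel_integrable_affine:
  fixes f :: "'a::euclidean_space \<Rightarrow> 'b::{banach,second_countable_topology}"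
  assumes f: "integrable lborel f" and c: "c \<noteq> 0"
  shows "integrable lborel (\<lambda>x. f (t + c *\<^sub>R x))"
proof -
  have [measurable]: "f \<in> borel_measurable borel" using f by auto
  have "integrable (density (distr lborel borel (\<lambda>x. t + c *\<^sub>R x)) (\<lambda>_. ennreal (\<bar>c\<bar> ^ DIM('a)))) f"
    using f lborel_affine[OF c, of t] by (simp add: ennreal_power)
  then have "integrable (distr lborel borel (\<lambda>x. t + c *\<^sub>R x)) (\<lambda>x. \<bar>c\<bar> ^ DIM('a) *\<^sub>R f x)"
    by (subst (asm) integrable_density) auto
  then have "integrable lborel (\<lambda>x. \<bar>c\<bar> ^ DIM('a) *\<^sub>R f (t + c *\<^sub>R x))"
    by (subst (asm) integrable_distr_eq) auto
  from integrable_scaleR_right[OF this, of "inverse (\<bar>c\<bar> ^ DIM('a))"] show ?thesis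
    using c by simp
qed

lemma integral_reflect:
  fixes f :: "'a::euclidean_space \<Rightarrow> 'b::{banach,second_countable_topology}"
  assumes "f \<in> borel_measurable borel"
  shows "(LINT y|lborel. f (x - y)) = (LINT y|lborel. f y)"
  using lborel_integral_affine[OF assms, of "-1" x] by simp

lemma integrable_reflect:
  fixes f :: "'a::euclidean_space \<Rightarrow> 'b::{banach,second_countable_topology}"
  assumes "integrable lborel f"
  shows "integrable lborel (\<lambda>y. f (x - y))"
  using lborel_integrable_affine[OF assms, of "-1" x] by simp

lemma integral_translate:
  fixes f :: "'a::euclidean_space \<Rightarrow> 'b::{banach,second_countable_topology}"
  assumes "f \<in> borel_measurable borel"
  shows "(LINT y|lborel. f (y + x)) = (LINT y|lborel. f y)"
  using lborel_integral_affine[OF assms, of "1" x] by (simp add: add.commute)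

lemma integrable_translate:
  fixes f :: "'a::euclidean_space \<Rightarrow> 'b::{banach,second_countable_topology}"
  assumes "integrable lborel f"
  shows "integrable lborel (\<lambda>y. f (y + x))"
  using lborel_integrable_affine[OF assms, of "1" x] by (simp add: add.commute)

abbreviation sphere_area :: "'a::euclidean_space itself \<Rightarrow> real" where
  "sphere_area _ \<equiv> sphere_measure (sphere (0::'a) 1)"

lemma sphere_area_eq: "sphere_area TYPE('a::euclidean_space) = real DIM('a) * unit_ball_vol (real DIM('a))"
proof -
  have "Gamma (real DIM('a) / 2 + 1) = real DIM('a) / 2 * Gamma (real DIM('a) / 2)"
    by (rule Gamma_plus1) (auto dest: nonpos_Ints_nonpos)
  moreover have "0 < Gamma (real DIM('a) / 2)"
    by (rule Gamma_real_pos) simp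
  ultimately show ?thesis
    unfolding sphere_measure_unit_sphere unit_ball_vol_def by (simp only:) (simp add: field_simps)
qed

lemma sphere_area_pos: "0 < sphere_area TYPE('a::euclidean_space)"
  by (simp add: sphere_area_eq)

text \<open>
  Polar coordinates for radial functions. The sign makes the half-lines \<open>{r<..}\<close>
  pull back to balls, which have finite measure, so that measures agreeing on these half-lines
  are equal; on them the identity says that the volume of the ball has the area of the sphere as
  its derivative.
\<close>

lemma distr_uminus_norm_lborel:
  "distr (lborel :: 'a::euclidean_space measure) borel (\<lambda>x. - norm x) =
     density lborel (\<lambda>r. ennreal (sphere_area TYPE('a) * (- r) ^ (DIM('a) - 1)) * indicator {..0} r)"
  (is "?M = ?N")
proof (rule measure_eqI_lessThan)
  let ?V = "unit_ball_vol (real DIM('a))"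
  have M: "emeasure ?M {r<..} = (if r < 0 then ennreal (?V * (- r) ^ DIM('a)) else 0)" for r
  proof -
    have "emeasure ?M {r<..} = emeasure lborel (ball (0::'a) (- r))"
      by (subst emeasure_distr) (auto intro!: arg_cong2[where f=emeasure] simp: ball_def)
    also have "\<dots> = (if r < 0 then ennreal (?V * (- r) ^ DIM('a)) else 0)"
      by (auto simp: emeasure_ball not_less ball_empty)
    finally show ?thesis .
  qed
  show "emeasure ?M {r<..} < \<infinity>" for r by (simp add: M)
  have N: "emeasure ?N {r<..} = ennreal (?V * (- r) ^ DIM('a))" if "r < 0" for r
  proof -
    have "emeasure ?N {r<..} = (\<integral>\<^sup>+x. ennreal (sphere_area TYPE('a) * (- x) ^ (DIM('a) - 1)) * indicator {r..0} x \<partial>lborel)"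
      using AE_lborel_singleton[of r]
      by (subst emeasure_density) (auto intro!: nn_integral_cong_AE elim!: eventually_mono split: split_indicator)
    also have "\<dots> = ennreal ((- ?V * (- 0) ^ DIM('a)) - (- ?V * (- r) ^ DIM('a)))"
    proof (rule nn_integral_FTC_Icc)
      show "((\<lambda>r. - ?V * (- r) ^ DIM('a)) has_real_derivative sphere_area TYPE('a) * (- x) ^ (DIM('a) - 1)) (at x)" for x
        by (auto intro!: derivative_eq_intros simp: sphere_area_eq)
    qed (use \<open>r < 0\<close> sphere_area_pos[where 'a='a] in \<open>auto simp: less_imp_le\<close>)
    also have "\<dots> = ennreal (?V * (- r) ^ DIM('a))" by (simp add: power_0_left)
    finally show ?thesis .
  qed
  have N0: "emeasure ?N {r<..} = 0" if "\<not> r < 0" for r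
    using that by (subst emeasure_density) (auto intro!: nn_integral_zero' simp: indicator_def)
  show "emeasure ?M {r<..} = emeasure ?N {r<..}" for r
    using N[of r] N0[of r] by (simp add: M)
qed auto

lemma nn_integral_radial:
  fixes h :: "real \<Rightarrow> ennreal"
  assumes [measurable]: "h \<in> borel_measurable borel"
  shows "(\<integral>\<^sup>+(x::'a::euclidean_space). h (norm x) \<partial>lborel) =
    (\<integral>\<^sup>+r. ennreal (sphere_area TYPE('a) * r ^ (DIM('a) - 1)) * h r * indicator {0..} r \<partial>lborel)"
proof -
  let ?w = "\<lambda>r. ennreal (sphere_area TYPE('a) * r ^ (DIM('a) - 1))"
  have "(\<integral>\<^sup>+(x::'a). h (norm x) \<partial>lborel) = (\<integral>\<^sup>+r. h (- r) \<partial>distr (lborel :: 'a measure) borel (\<lambda>x. - norm x))"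
    by (subst nn_integral_distr) auto
  also have "\<dots> = (\<integral>\<^sup>+r. ?w (- r) * h (- r) * indicator {0..} (- r) \<partial>lborel)"
    unfolding distr_uminus_norm_lborel
    by (subst nn_integral_density) (auto intro!: nn_integral_cong split: split_indicator)
  also have "\<dots> = (\<integral>\<^sup>+r. ?w r * h r * indicator {0..} r \<partial>lborel)"
    by (subst (2) nn_integral_real_affine[where c="-1" and t=0]) auto
  finally show ?thesis .
qed

text \<open>
  An arbitrary antiderivative \<open>F\<close> covers the logarithmic case \<open>q = 0\<close>
  together with the powers.
\<close>

lemma nn_integral_annulus:
  assumes "0 < \<epsilon>" "\<epsilon> \<le> R"
    and F: "\<And>r. 0 < r \<Longrightarrow> (F has_real_derivative r powr (q - 1)) (at r)"
  shows "(\<integral>\<^sup>+(x::'a::euclidean_space). ennreal (norm x powr (q - real DIM('a)) * indicator {\<epsilon><..<R} (norm x)) \<partial>lborel)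
     = ennreal (sphere_area TYPE('a) * (F R - F \<epsilon>))"
proof -
  let ?n = "DIM('a)" and ?w = "sphere_area TYPE('a)"
  have "(\<integral>\<^sup>+(x::'a). ennreal (norm x powr (q - ?n) * indicator {\<epsilon><..<R} (norm x)) \<partial>lborel)
     = (\<integral>\<^sup>+r. ennreal (?w * r ^ (?n - 1)) * ennreal (r powr (q - ?n) * indicator {\<epsilon><..<R} r) * indicator {0..} r \<partial>lborel)"
    by (rule nn_integral_radial) measurable
  also have "\<dots> = (\<integral>\<^sup>+r. ennreal (?w * r powr (q - 1)) * indicator {\<epsilon>..R} r \<partial>lborel)"
  proof (rule nn_integral_cong_AE)
    have "r ^ (?n - 1) * r powr (q - ?n) = r powr (q - 1)" if "0 < r" for r
      using that by (simp add: powr_realpow[symmetric] powr_add[symmetric] of_nat_diff Suc_leI)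
    then have eq: "ennreal (?w * r ^ (?n - 1)) * ennreal (r powr (q - ?n)) = ennreal (?w * r powr (q - 1))" if "0 < r" for r
      using that sphere_area_pos[where 'a='a]
      by (subst ennreal_mult[symmetric]) (auto simp: mult.assoc less_imp_le)
    show "AE r in lborel. ennreal (?w * r ^ (?n - 1)) * ennreal (r powr (q - ?n) * indicator {\<epsilon><..<R} r) * indicator {0..} r
      = ennreal (?w * r powr (q - 1)) * indicator {\<epsilon>..R} r"
      using AE_lborel_singleton[of \<epsilon>] AE_lborel_singleton[of R]
      by eventually_elim (use \<open>0 < \<epsilon>\<close> eq in \<open>auto split: split_indicator\<close>)
  qed
  also have "\<dots> = ennreal (?w * F R - ?w * F \<epsilon>)"
  proof (rule nn_integral_FTC_Icc[where F="\<lambda>r. ?w * F r"])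
    show "((\<lambda>r. ?w * F r) has_real_derivative ?w * x powr (q - 1)) (at x)" if "x \<in> {\<epsilon>..R}" for x
      using that \<open>0 < \<epsilon>\<close> by (intro DERIV_cmult F) auto
  qed (use assms sphere_area_pos[where 'a='a] in \<open>auto simp: less_imp_le\<close>)
  finally show ?thesis by (simp add: right_diff_distrib)
qed

lemma has_bochner_integral_annulus:
  assumes "0 < \<epsilon>" "\<epsilon> \<le> R"
    and F: "\<And>r. 0 < r \<Longrightarrow> (F has_real_derivative r powr (q - 1)) (at r)"
  shows "has_bochner_integral lborel
     (\<lambda>x::'a::euclidean_space. norm x powr (q - real DIM('a)) * indicator {\<epsilon><..<R} (norm x))
     (sphere_area TYPE('a) * (F R - F \<epsilon>))"
proof (rule has_bochner_integral_nn_integral)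
  have "F \<epsilon> \<le> F R"
    using \<open>\<epsilon> \<le> R\<close> by (rule DERIV_nonneg_imp_nondecreasing) (use assms in \<open>auto intro!: exI[of _ "_ powr _"] F\<close>)
  then show "0 \<le> sphere_area TYPE('a) * (F R - F \<epsilon>)"
    using sphere_area_pos[where 'a='a] by (simp add: less_imp_le)
qed (use nn_integral_annulus[OF assms] in auto)

text \<open>
  The dominating function behind all integrability statements for rapidly decreasing functions.
\<close>

lemma integrable_inverse_power_norm:
  "integrable lborel (\<lambda>x::'a::euclidean_space. 1 / (1 + norm x ^ (DIM('a) + 1)))"
proof (rule integrableI_bounded)
  let ?n = "DIM('a)" and ?w = "sphere_area TYPE('a)"
  have w: "0 \<le> ?w" using sphere_area_pos[where 'a='a] by simp
  have "(\<integral>\<^sup>+(x::'a). ennreal (norm (1 / (1 + norm x ^ (?n + 1)))) \<partial>lborel)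
     = (\<integral>\<^sup>+r. ennreal (?w * r ^ (?n - 1)) * ennreal \<bar>1 / (1 + r ^ (?n + 1))\<bar> * indicator {0..} r \<partial>lborel)"
    unfolding real_norm_def by (rule nn_integral_radial) measurable
  also have "\<dots> \<le> (\<integral>\<^sup>+r. ennreal ?w * indicator {0..1} r + ennreal (?w * r powr (-2)) * indicator {1..} r \<partial>lborel)"
  proof (rule nn_integral_mono)
    fix r :: real
    have r1: "r ^ (?n - 1) / (1 + r ^ (?n + 1)) \<le> 1" if "0 \<le> r" "r \<le> 1"
    proof -
      have "r ^ (?n - 1) \<le> 1" using that by (rule power_le_one)
      moreover have "0 \<le> r ^ (?n + 1)" using that by simp
      ultimately show ?thesis by (simp add: divide_le_eq)
    qed
    have r2: "r ^ (?n - 1) / (1 + r ^ (?n + 1)) \<le> r powr (-2)" if "1 < r"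
    proof -
      have "r ^ (?n + 1) = r ^ (?n - 1) * r\<^sup>2"
        by (metis DIM_positive One_nat_def Suc_eq_plus1 Suc_pred add_2_eq_Suc' power_add)
      moreover have "0 < 1 + r ^ (?n + 1)" using that by (simp add: add_pos_nonneg)
      ultimately show ?thesis
        using that by (simp add: powr_minus powr_numeral divide_simps)
    qed
    consider "r < 0" | "0 \<le> r" "r \<le> 1" | "1 < r" by linarith
    then show "ennreal (?w * r ^ (?n - 1)) * ennreal \<bar>1 / (1 + r ^ (?n + 1))\<bar> * indicator {0..} r
      \<le> ennreal ?w * indicator {0..1} r + ennreal (?w * r powr (-2)) * indicator {1..} r"
    proof cases
      case 2
      have "?w * r ^ (?n - 1) * \<bar>1 / (1 + r ^ (?n + 1))\<bar> \<le> ?w"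
        using mult_left_mono[OF r1[OF 2] w] 2 by simp
      then show ?thesis using 2 w
        by (auto simp: ennreal_mult'[symmetric] ennreal_leI intro!: order_trans[OF _ add_increasing2[OF _ order_refl]])
    next
      case 3
      have "?w * r ^ (?n - 1) * \<bar>1 / (1 + r ^ (?n + 1))\<bar> \<le> ?w * r powr (-2)"
        using mult_left_mono[OF r2[OF 3] w] 3 by simp
      then show ?thesis using 3 w
        by (auto simp: ennreal_mult'[symmetric] ennreal_leI)
    qed auto
  qed
  also have "\<dots> = ennreal ?w * emeasure lborel {0..1::real} + (\<integral>\<^sup>+r. ennreal (?w * r powr (-2)) * indicator {1..} r \<partial>lborel)"
    by (subst nn_integral_add) (auto simp: nn_integral_cmult_indicator)
  also have "(\<integral>\<^sup>+r. ennreal (?w * r powr (-2)) * indicator {1..} r \<partial>lborel) = ennreal (0 - (- ?w * 1 powr (-1)))"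
  proof (rule nn_integral_FTC_atLeast[where F="\<lambda>r. - ?w * r powr (-1)"])
    show "((\<lambda>r. - ?w * r powr (-1)) has_real_derivative ?w * x powr (-2)) (at x)" if "1 \<le> x" for x
      using DERIV_cmult[OF has_real_derivative_powr[of x "-1"], of "- ?w"] that by simp
    show "((\<lambda>r. - ?w * r powr (-1)) \<longlongrightarrow> 0) at_top"
      by (intro tendsto_mult_right_zero tendsto_neg_powr filterlim_ident) auto
  qed (use w in auto)
  finally show "(\<integral>\<^sup>+(x::'a). ennreal (norm (1 / (1 + norm x ^ (?n + 1)))) \<partial>lborel) < \<infinity>"
    by (auto simp: ennreal_mult_less_top intro: le_less_trans)
qed measurable

section \<open>The heat kernel and its Fourier transform\<close>

lemma
  fixes f :: "'a::euclidean_space \<Rightarrow> real \<Rightarrow> 'b::{real_normed_field,banach,second_countable_topology}"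
  assumes f: "\<And>b. b \<in> Basis \<Longrightarrow> integrable lborel (f b)"
  shows integrable_lborel_prod: "integrable lborel (\<lambda>x::'a. \<Prod>b\<in>Basis. f b (x \<bullet> b))"
    and integral_lborel_prod: "(LINT x|lborel. (\<Prod>b\<in>Basis. f b (x \<bullet> b))) = (\<Prod>b\<in>Basis. LINT y|lborel. f b y)"
proof -
  interpret product_sigma_finite "\<lambda>_::'a. lborel :: real measure" by standard
  let ?T = "\<lambda>g::'a \<Rightarrow> real. \<Sum>b\<in>Basis. g b *\<^sub>R b"
  let ?P = "Pi\<^sub>M (Basis :: 'a set) (\<lambda>_. lborel :: real measure)"
  have [measurable]: "f b \<in> borel_measurable borel" if "b \<in> Basis" for b using f[OF that] by auto
  have T[measurable]: "?T \<in> measurable ?P borel" by measurable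
  have m: "(\<lambda>x::'a. \<Prod>b\<in>Basis. f b (x \<bullet> b)) \<in> borel_measurable borel" by measurable
  have eq: "(\<Prod>b\<in>Basis. f b (?T g \<bullet> b)) = (\<Prod>b\<in>Basis. f b (g b))" for g
    by (intro prod.cong) auto
  show "integrable lborel (\<lambda>x::'a. \<Prod>b\<in>Basis. f b (x \<bullet> b))"
    unfolding lborel_eq[where 'a='a] integrable_distr_eq[OF T m] eq
    by (rule product_integrable_prod) (auto intro: f)
  show "(LINT x|lborel. (\<Prod>b\<in>Basis. f b (x \<bullet> b))) = (\<Prod>b\<in>Basis. LINT y|lborel. f b y)"
    unfolding lborel_eq[where 'a='a] integral_distr[OF T m] eq
    by (rule product_integral_prod) (auto intro: f)
qed

lemma measurable_cis [measurable]: "cis \<in> borel_measurable borel"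
  by (intro borel_measurable_continuous_onI continuous_intros)

lemma norm_square_eq_sum: "(norm (x::'a::euclidean_space))\<^sup>2 = (\<Sum>b\<in>Basis. (x \<bullet> b)\<^sup>2)"
  unfolding power2_norm_eq_inner by (subst euclidean_inner) (simp add: power2_eq_square)

text \<open>
  Normalised so that convolution with the kernel at time \<open>t > 0\<close> has the Fourier
  multiplier \<open>exp (- t |\<xi>|\<^sup>2)\<close>.
\<close>

definition heat :: "real \<Rightarrow> 'a::euclidean_space \<Rightarrow> real" where
  "heat t x = (4 * pi * t) powr (- real DIM('a) / 2) * exp (- (norm x)\<^sup>2 / (4 * t))"

lemma heat_nonneg [simp]: "0 \<le> heat t x"
  by (simp add: heat_def)

lemma measurable_heat [measurable (raw)]:
  assumes [measurable]: "f \<in> borel_measurable M" "g \<in> borel_measurable M"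
  shows "(\<lambda>x. heat (f x) (g x :: 'a::euclidean_space)) \<in> borel_measurable M"
  unfolding heat_def by measurable

text \<open>
  The factorisation reduces Gaussian integrals to the characteristic function of the normal
  distribution.
\<close>

lemma heat_eq_prod:
  assumes "0 < t"
  shows "heat t (x::'a::euclidean_space) = (\<Prod>b\<in>Basis. normal_density 0 (sqrt (2 * t)) (x \<bullet> b))"
proof -
  have "(\<Prod>b\<in>Basis. normal_density 0 (sqrt (2 * t)) (x \<bullet> b))
      = (\<Prod>b\<in>(Basis::'a set). 1 / sqrt (4 * pi * t)) * (\<Prod>b\<in>Basis. exp (- (x \<bullet> b)\<^sup>2 / (4 * t)))"
    unfolding prod.distrib[symmetric] using assms
    by (intro prod.cong) (simp_all add: normal_density_def)
  also have "(\<Prod>b\<in>Basis. exp (- (x \<bullet> b)\<^sup>2 / (4 * t))) = exp (- (norm x)\<^sup>2 / (4 * t))"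
    by (simp add: exp_sum[symmetric] sum_divide_distrib[symmetric] sum_negf
        norm_square_eq_sum[of x])
  also have "(\<Prod>b\<in>(Basis::'a set). 1 / sqrt (4 * pi * t)) = (4 * pi * t) powr (- real DIM('a) / 2)"
  proof -
    have "1 / sqrt (4 * pi * t) = (4 * pi * t) powr (- (1 / 2))"
      using assms by (simp add: powr_minus_divide powr_half_sqrt)
    then show ?thesis using assms
      by (simp add: powr_powr powr_realpow[symmetric])
  qed
  finally show ?thesis by (simp add: heat_def)
qed

lemma fourier_std_normal_density:
  "(LINT y|lborel. cis (\<eta> * y) * complex_of_real (std_normal_density y)) = of_real (exp (- \<eta>\<^sup>2 / 2))"
proof -
  have "(LINT y|lborel. cis (\<eta> * y) * complex_of_real (std_normal_density y)) = char std_normal_distribution \<eta>"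
    unfolding char_def
    by (subst integral_density) (auto simp: cis_conv_exp scaleR_conv_of_real mult.commute)
  then show ?thesis by (simp add: char_std_normal_distribution)
qed

lemma fourier_normal_density:
  assumes "0 < \<sigma>"
  shows "(LINT y|lborel. cis (\<eta> * y) * complex_of_real (normal_density 0 \<sigma> y)) = of_real (exp (- \<sigma>\<^sup>2 * \<eta>\<^sup>2 / 2))"
proof -
  have nd: "\<sigma> * normal_density 0 \<sigma> (\<sigma> * y) = std_normal_density y" for y
    using assms by (simp add: normal_density_def real_sqrt_mult power_mult_distrib)
  have "(LINT y|lborel. cis (\<eta> * y) * complex_of_real (normal_density 0 \<sigma> y))
    = \<sigma> *\<^sub>R (LINT y|lborel. cis (\<eta> * (\<sigma> * y)) * complex_of_real (normal_density 0 \<sigma> (\<sigma> * y)))"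
    using assms by (subst lborel_integral_real_affine[of \<sigma> _ 0]) auto
  also have "\<dots> = (LINT y|lborel. cis ((\<eta> * \<sigma>) * y) * complex_of_real (std_normal_density y))"
    unfolding integral_scaleR_right[symmetric]
    by (intro Bochner_Integration.integral_cong) (simp_all add: nd[symmetric] scaleR_conv_of_real mult_ac)
  also have "\<dots> = of_real (exp (- (\<eta> * \<sigma>)\<^sup>2 / 2))"
    by (rule fourier_std_normal_density)
  finally show ?thesis
    by (simp add: power_mult_distrib mult.commute)
qed

lemma cis_sum: "finite A \<Longrightarrow> cis (sum f A) = (\<Prod>a\<in>A. cis (f a))"
  by (induction rule: finite_induct) (auto simp: cis_mult[symmetric])

lemma
  fixes \<xi> :: "'a::euclidean_space"
  assumes "0 < t"
  shows integrable_cis_heat: "integrable lborel (\<lambda>x. cis (x \<bullet> \<xi>) * complex_of_real (heat t x))"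
    and fourier_heat: "(LINT x|lborel. cis (x \<bullet> \<xi>) * complex_of_real (heat t x)) = of_real (exp (- t * (norm \<xi>)\<^sup>2))"
proof -
  define \<sigma> where "\<sigma> = sqrt (2 * t)"
  have \<sigma>: "0 < \<sigma>" "\<sigma>\<^sup>2 = 2 * t" using assms by (auto simp: \<sigma>_def)
  define f where "f b y = cis ((\<xi> \<bullet> b) * y) * complex_of_real (normal_density 0 \<sigma> y)" for b y
  have eq: "cis (x \<bullet> \<xi>) * complex_of_real (heat t x) = (\<Prod>b\<in>Basis. f b (x \<bullet> b))" for x
    by (simp add: f_def prod.distrib heat_eq_prod[OF assms] \<sigma>_def euclidean_inner[of x \<xi>] cis_sum mult.commute)
  have int: "integrable lborel (f b)" for b
    unfolding f_def by (rule Bochner_Integration.integrable_bound[OF integrable_normal_density[of \<sigma> 0]])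
      (use \<sigma> in \<open>auto simp: norm_mult\<close>)
  show "integrable lborel (\<lambda>x. cis (x \<bullet> \<xi>) * complex_of_real (heat t x))"
    unfolding eq by (intro integrable_lborel_prod int)
  have "(LINT x|lborel. cis (x \<bullet> \<xi>) * complex_of_real (heat t x)) = (\<Prod>b\<in>Basis. of_real (exp (- \<sigma>\<^sup>2 * (\<xi> \<bullet> b)\<^sup>2 / 2)))"
    unfolding eq integral_lborel_prod[OF int]
    unfolding f_def fourier_normal_density[OF \<sigma>(1)] ..
  also have "\<dots> = of_real (exp (- t * (norm \<xi>)\<^sup>2))"
    by (simp add: \<sigma>(2) of_real_prod[symmetric] exp_sum[symmetric] sum_negf sum_distrib_left
        norm_square_eq_sum[of \<xi>])
  finally show "(LINT x|lborel. cis (x \<bullet> \<xi>) * complex_of_real (heat t x)) = of_real (exp (- t * (norm \<xi>)\<^sup>2))" .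
qed

lemma
  assumes "0 < t"
  shows integrable_heat: "integrable lborel (heat t :: 'a::euclidean_space \<Rightarrow> real)"
    and integral_heat: "(LINT x|lborel. heat t (x::'a)) = 1"
proof -
  show i: "integrable lborel (heat t :: 'a \<Rightarrow> real)"
    using integrable_Re[OF integrable_cis_heat[OF assms, of 0]] by simp
  have "complex_of_real (LINT x|lborel. heat t (x::'a)) = 1"
    using fourier_heat[OF assms, of 0] i by simp
  then show "(LINT x|lborel. heat t (x::'a)) = 1" by (simp only: of_real_eq_1_iff)
qed

section \<open>Fourier transforms of integrable and of Schwartz functions\<close>

lemma fourier_cis: "fourier \<phi> \<xi> = (2 * pi) powr (- real DIM('a) / 2) *\<^sub>R
    (LINT x|lborel. cis (- ((x::'a::euclidean_space) \<bullet> \<xi>)) * \<phi> x)"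
  by (simp add: fourier_def cis_conv_exp)

lemma inv_fourier_eq_fourier: "inv_fourier \<phi> \<xi> = fourier \<phi> (- \<xi>)"
  by (simp add: fourier_def inv_fourier_def inner_commute)

lemma integrable_cis_mult:
  assumes "integrable M \<phi>" and [measurable]: "f \<in> borel_measurable M"
  shows "integrable M (\<lambda>x. cis (f x) * \<phi> x)"
proof (rule Bochner_Integration.integrable_bound[OF assms(1)])
  have [measurable]: "\<phi> \<in> borel_measurable M" using assms(1) by auto
  show "(\<lambda>x. cis (f x) * \<phi> x) \<in> borel_measurable M" by measurable
qed (simp add: norm_mult)

lemma norm_fourier_le:
  "norm (fourier \<phi> (\<xi>::'a::euclidean_space)) \<le> (2 * pi) powr (- real DIM('a) / 2) * (LINT x|lborel. norm (\<phi> x))"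
proof -
  have "norm (LINT x|lborel. cis (- (x \<bullet> \<xi>)) * \<phi> x) \<le> (LINT x|lborel. norm (cis (- (x \<bullet> \<xi>)) * \<phi> x))"
    by (rule integral_norm_bound)
  then show ?thesis by (simp add: fourier_cis norm_mult mult_left_mono)
qed

lemma measurable_fourier [measurable]:
  assumes [measurable]: "\<phi> \<in> borel_measurable borel"
  shows "fourier \<phi> \<in> borel_measurable (borel :: 'a::euclidean_space measure)"
  unfolding fourier_cis[abs_def] by measurable

lemma measurable_inv_fourier [measurable]:
  assumes [measurable]: "\<phi> \<in> borel_measurable borel"
  shows "inv_fourier \<phi> \<in> borel_measurable (borel :: 'a::euclidean_space measure)"
  unfolding inv_fourier_eq_fourier[abs_def] by measurable

lemma integrable_pair_mult:
  fixes f :: "'a::euclidean_space \<Rightarrow> 'c::{real_normed_field,banach,second_countable_topology}"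
    and g :: "'b::euclidean_space \<Rightarrow> 'c"
  assumes f: "integrable lborel f" and g: "integrable lborel g"
  shows "integrable (lborel \<Otimes>\<^sub>M lborel) (\<lambda>(x, y). f x * g y)"
proof -
  have [measurable]: "f \<in> borel_measurable borel" "g \<in> borel_measurable borel" using f g by auto
  show ?thesis
    by (rule lborel_pair.Fubini_integrable) (use f g in \<open>auto simp: norm_mult\<close>)
qed

text \<open>
  The multiplication formula. The operators on distributions are defined by duality, so this is
  how the multipliers get from the test function to the function that represents the
  distribution.
\<close>

lemma integral_mult_fourier_swap:
  fixes f \<psi> :: "'a::euclidean_space \<Rightarrow> complex"
  assumes f: "integrable lborel f" and \<psi>: "integrable lborel \<psi>"
  shows "(LINT x|lborel. f x * fourier \<psi> x) = (LINT x|lborel. fourier f x * \<psi> x)"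
proof -
  have [measurable]: "f \<in> borel_measurable borel" "\<psi> \<in> borel_measurable borel" using f \<psi> by auto
  let ?c = "(2 * pi) powr (- real DIM('a) / 2)"
  define F where "F x y = cis (- (x \<bullet> y)) * (f x * \<psi> y)" for x y
  have "integrable (lborel \<Otimes>\<^sub>M lborel) (\<lambda>z. cis (- (fst z \<bullet> snd z)) * (case z of (x, y) \<Rightarrow> f x * \<psi> y))"
    by (rule integrable_cis_mult[OF integrable_pair_mult[OF f \<psi>]]) measurable
  then have int: "integrable (lborel \<Otimes>\<^sub>M lborel) (case_prod F)"
    by (simp add: F_def case_prod_beta')
  have "(LINT x|lborel. f x * fourier \<psi> x) = ?c *\<^sub>R (LINT x|lborel. LINT y|lborel. F x y)"
    unfolding fourier_cis F_def integral_scaleR_right[symmetric]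
    by (intro Bochner_Integration.integral_cong refl)
       (simp add: mult_ac inner_commute flip: integral_mult_right_zero)
  also have "\<dots> = ?c *\<^sub>R (LINT y|lborel. LINT x|lborel. F x y)"
    by (subst lborel_pair.Fubini_integral[OF int]) simp
  also have "\<dots> = (LINT x|lborel. fourier f x * \<psi> x)"
    unfolding fourier_cis F_def integral_scaleR_right[symmetric]
    by (intro Bochner_Integration.integral_cong refl)
       (simp add: mult_ac flip: integral_mult_left_zero)
  finally show ?thesis .
qed

text \<open>
  The decay of Schwartz functions without their smoothness. This is what survives multiplication
  by the symbol \<open>|\<xi>|\<close> to the power \<open>2 a\<close>, which is not smooth at
  the origin.
\<close>

definition rapidly_decreasing :: "('a::euclidean_space \<Rightarrow> complex) \<Rightarrow> bool" where
  "rapidly_decreasing \<phi> \<longleftrightarrow> \<phi> \<in> borel_measurable borel \<and> (\<forall>k. bounded (range (\<lambda>x. norm x ^ k *\<^sub>R \<phi> x)))"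

lemma bounded_range_weightedE:
  assumes "bounded (range (\<lambda>x::'a::euclidean_space. norm x ^ k *\<^sub>R (\<phi> x :: complex)))"
  obtains C where "0 \<le> C" "\<And>x. norm x ^ k * norm (\<phi> x) \<le> C"
proof -
  from assms obtain B where "\<And>x. norm (norm x ^ k *\<^sub>R \<phi> x) \<le> B" unfolding bounded_iff by auto
  then have "norm x ^ k * norm (\<phi> x) \<le> \<bar>B\<bar>" for x by (smt (verit) norm_scaleR abs_of_nonneg norm_ge_zero zero_le_power)
  then show ?thesis using that[of "\<bar>B\<bar>"] by auto
qed

lemma rapidly_decreasing_bound:
  fixes \<phi> :: "'a::euclidean_space \<Rightarrow> complex"
  assumes "\<And>k. bounded (range (\<lambda>x. norm x ^ k *\<^sub>R \<phi> x))"
  obtains C where "0 \<le> C" "\<And>x. norm (\<phi> x) \<le> C / (1 + norm x ^ k)"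
proof -
  obtain C0 where C0: "0 \<le> C0" "\<And>x. norm x ^ 0 * norm (\<phi> x) \<le> C0"
    using bounded_range_weightedE[OF assms[of 0]] by metis
  obtain Ck where Ck: "0 \<le> Ck" "\<And>x. norm x ^ k * norm (\<phi> x) \<le> Ck"
    using bounded_range_weightedE[OF assms[of k]] by metis
  have "norm (\<phi> x) \<le> (C0 + Ck) / (1 + norm x ^ k)" for x
  proof -
    have "0 < 1 + norm x ^ k" by (simp add: add_pos_nonneg)
    moreover have "norm (\<phi> x) * (1 + norm x ^ k) \<le> C0 + Ck"
      using C0(2)[of x] Ck(2)[of x] by (simp add: algebra_simps)
    ultimately show ?thesis by (simp add: pos_le_divide_eq)
  qed
  then show ?thesis using that[of "C0 + Ck"] C0 Ck by auto
qed

lemma rapidly_decreasing_integrable: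
  assumes "rapidly_decreasing \<phi>"
  shows "integrable lborel \<phi>"
proof -
  from assms have [measurable]: "\<phi> \<in> borel_measurable borel" by (auto simp: rapidly_decreasing_def)
  obtain C where C: "0 \<le> C" "\<And>x. norm (\<phi> x) \<le> C / (1 + norm x ^ (DIM('a) + 1))"
    using rapidly_decreasing_bound[of \<phi> "DIM('a) + 1"] assms unfolding rapidly_decreasing_def by metis
  show ?thesis
  proof (rule Bochner_Integration.integrable_bound)
    show "integrable lborel (\<lambda>x::'a. C * (1 / (1 + norm x ^ (DIM('a) + 1))))"
      by (intro integrable_mult_right integrable_inverse_power_norm)
    show "AE x in lborel. norm (\<phi> x) \<le> norm (C * (1 / (1 + norm x ^ (DIM('a) + 1))))"
      using C by (auto simp: abs_of_nonneg add_nonneg_nonneg intro!: always_eventually order_trans[OF C(2)])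
  qed simp
qed

lemma rapidly_decreasing_mult:
  fixes m :: "'a::euclidean_space \<Rightarrow> complex"
  assumes \<phi>: "rapidly_decreasing \<phi>" and m[measurable]: "m \<in> borel_measurable borel"
    and bound: "\<And>x. norm (m x) \<le> C * (1 + norm x ^ N)"
  shows "rapidly_decreasing (\<lambda>x. m x * \<phi> x)"
  unfolding rapidly_decreasing_def
proof (intro conjI allI)
  from \<phi> have [measurable]: "\<phi> \<in> borel_measurable borel" by (auto simp: rapidly_decreasing_def)
  show "(\<lambda>x. m x * \<phi> x) \<in> borel_measurable borel" by measurable
  fix k
  have b: "bounded (range (\<lambda>x. norm x ^ k *\<^sub>R \<phi> x))" for k using \<phi> by (auto simp: rapidly_decreasing_def)
  obtain C0 where C0: "0 \<le> C0" "\<And>x. norm x ^ k * norm (\<phi> x) \<le> C0"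
    using bounded_range_weightedE[OF b[of k]] by metis
  obtain C1 where C1: "0 \<le> C1" "\<And>x. norm x ^ (N + k) * norm (\<phi> x) \<le> C1"
    using bounded_range_weightedE[OF b[of "N + k"]] by metis
  have C: "0 \<le> C"
    using order_trans[OF norm_ge_zero bound[of 0]] by (auto simp: zero_le_mult_iff power_0_left split: if_splits)
  show "bounded (range (\<lambda>x. norm x ^ k *\<^sub>R (m x * \<phi> x)))"
    unfolding bounded_iff
  proof (intro exI ballI)
    fix z assume "z \<in> range (\<lambda>x. norm x ^ k *\<^sub>R (m x * \<phi> x))"
    then obtain x where z: "z = norm x ^ k *\<^sub>R (m x * \<phi> x)" by auto
    have "norm z = norm (m x) * (norm x ^ k * norm (\<phi> x))"
      unfolding z by (simp add: norm_mult)
    also have "\<dots> \<le> C * (1 + norm x ^ N) * (norm x ^ k * norm (\<phi> x))"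
      using bound[of x] by (rule mult_right_mono) simp
    also have "\<dots> = C * (norm x ^ k * norm (\<phi> x) + norm x ^ (N + k) * norm (\<phi> x))"
      by (simp add: algebra_simps power_add)
    also have "\<dots> \<le> C * (C0 + C1)"
      using C0(2)[of x] C1(2)[of x] C by (intro mult_left_mono add_mono) auto
    finally show "norm z \<le> C * (C0 + C1)" .
  qed
qed

definition partial :: "'a::euclidean_space \<Rightarrow> ('a \<Rightarrow> complex) \<Rightarrow> 'a \<Rightarrow> complex" where
  "partial b \<phi> = (\<lambda>x. frechet_derivative \<phi> (at x) b)"

text \<open>
  The recursion of \<open>iter_partial\<close> adds derivatives on the outside; this moves the
  innermost one into the function, which shows that the Schwartz space is closed under partial
  derivatives.
\<close>

lemma iter_partial_partial: "iter_partial bs (partial b \<phi>) = iter_partial (bs @ [b]) \<phi>"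
  by (induction bs) (simp_all add: partial_def)

lemma schwartz_partial:
  assumes "\<phi> \<in> schwartz" "b \<in> Basis"
  shows "partial b \<phi> \<in> schwartz"
  using assms unfolding schwartz_def by (auto simp: iter_partial_partial)

lemma schwartz_differentiable: "\<phi> \<in> schwartz \<Longrightarrow> \<phi> differentiable (at x)"
  unfolding schwartz_def using iter_partial.simps(1)[of \<phi>]
  by (metis (mono_tags, lifting) lists.Nil mem_Collect_eq)

lemma schwartz_continuous: "\<phi> \<in> schwartz \<Longrightarrow> continuous_on UNIV \<phi>"
  by (simp add: continuous_at_imp_continuous_on differentiable_imp_continuous_within schwartz_differentiable)

lemma schwartz_rapidly_decreasing:
  assumes "\<phi> \<in> schwartz"
  shows "rapidly_decreasing \<phi>"
proof -
  have "bounded (range (\<lambda>x. norm x ^ k *\<^sub>R iter_partial [] \<phi> x))" for k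
    using assms unfolding schwartz_def by blast
  then show ?thesis
    using schwartz_continuous[OF assms]
    by (auto simp: rapidly_decreasing_def intro!: borel_measurable_continuous_onI)
qed

lemma schwartz_has_vector_derivative:
  assumes "\<phi> \<in> schwartz"
  shows "((\<lambda>t. \<phi> (x + t *\<^sub>R b)) has_vector_derivative partial b \<phi> (x + t *\<^sub>R b)) (at t within S)"
proof -
  have D: "(\<phi> has_derivative frechet_derivative \<phi> (at (x + t *\<^sub>R b))) (at (x + t *\<^sub>R b))"
    using schwartz_differentiable[OF assms] frechet_derivative_works by blast
  have "((\<lambda>t. \<phi> (x + t *\<^sub>R b)) has_derivative (\<lambda>s. frechet_derivative \<phi> (at (x + t *\<^sub>R b)) (s *\<^sub>R b))) (at t within S)"
    by (rule has_derivative_compose[where f="\<lambda>t. x + t *\<^sub>R b", OF _ D]) (auto intro!: derivative_eq_intros)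
  then show ?thesis
    by (simp add: has_vector_derivative_def partial_def linear_cmul[OF has_derivative_linear[OF D]])
qed

lemma has_vector_derivative_imp_difference_quotient:
  fixes f :: "real \<Rightarrow> 'a::real_normed_vector"
  assumes "(f has_vector_derivative D) (at 0)"
  shows "((\<lambda>t. (f t - f 0) /\<^sub>R t) \<longlongrightarrow> D) (at 0)"
proof -
  have "((\<lambda>h. norm (f (0 + h) - f 0 - h *\<^sub>R D) / norm h) \<longlongrightarrow> 0) (at 0)"
    using assms unfolding has_vector_derivative_def has_derivative_at by blast
  moreover have "\<forall>\<^sub>F h in at 0. norm (f (0 + h) - f 0 - h *\<^sub>R D) / norm h = norm ((f h - f 0) /\<^sub>R h - D)"
  proof (rule eventually_at_filter[THEN iffD2, OF always_eventually], safe)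
    fix h :: real assume "h \<noteq> 0"
    then have "(f h - f 0) /\<^sub>R h - D = (f (0 + h) - f 0 - h *\<^sub>R D) /\<^sub>R h"
      by (simp add: scaleR_diff_right)
    then show "norm (f (0 + h) - f 0 - h *\<^sub>R D) / norm h = norm ((f h - f 0) /\<^sub>R h - D)"
      by (simp add: divide_inverse mult.commute)
  qed
  ultimately have "((\<lambda>h. norm ((f h - f 0) /\<^sub>R h - D)) \<longlongrightarrow> 0) (at 0)"
    by (rule Lim_transform_eventually)
  then have "((\<lambda>h. (f h - f 0) /\<^sub>R h - D) \<longlongrightarrow> 0) (at 0)"
    by (rule tendsto_norm_zero_cancel)
  then show ?thesis by (rule Lim_null[THEN iffD2])
qed

text \<open>
  The mean value theorem, with a bound that is uniform in the step and integrable in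
  \<open>x\<close> for large \<open>k\<close>: the weight \<open>1 + norm x ^ k\<close> changes
  at most by a factor within distance \<open>1\<close>.
\<close>

lemma difference_quotient_bound:
  assumes "\<phi> \<in> schwartz" "b \<in> Basis"
  obtains C where "0 \<le> C"
    "\<And>x h. 0 < h \<Longrightarrow> h \<le> 1 \<Longrightarrow> norm (\<phi> (x + h *\<^sub>R b) - \<phi> x) \<le> C / (1 + norm x ^ k) * h"
proof -
  obtain C where C: "0 \<le> C" "\<And>x. norm (partial b \<phi> x) \<le> C / (1 + norm x ^ k)"
    using rapidly_decreasing_bound[of "partial b \<phi>" k]
      schwartz_rapidly_decreasing[OF schwartz_partial[OF assms]] unfolding rapidly_decreasing_def by metis
  have nb: "norm b = 1" using assms by simp
  have "norm (\<phi> (x + h *\<^sub>R b) - \<phi> x) \<le> (2 ^ (k + 1) * C) / (1 + norm x ^ k) * h" if h: "0 < h" "h \<le> 1" for x h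
  proof -
    let ?B = "(2 ^ (k + 1) * C) / (1 + norm x ^ k)"
    have B: "norm (partial b \<phi> (x + t *\<^sub>R b)) \<le> ?B" if t: "t \<in> {0..h}" for t
    proof -
      let ?y = "x + t *\<^sub>R b"
      have "norm x \<le> 1 + norm ?y"
        using norm_triangle_ineq4[of ?y "t *\<^sub>R b"] t h nb by simp
      then have "norm x ^ k \<le> (1 + norm ?y) ^ k" by (rule power_mono) simp
      also have "\<dots> \<le> (2 * max 1 (norm ?y)) ^ k" by (rule power_mono) auto
      also have "\<dots> = 2 ^ k * max 1 (norm ?y) ^ k" by (simp add: power_mult_distrib)
      also have "\<dots> \<le> 2 ^ k * (1 + norm ?y ^ k)"
        by (intro mult_left_mono) (auto simp: max_def)
      finally have le: "norm x ^ k \<le> 2 ^ k * (1 + norm ?y ^ k)" .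
      have "1 \<le> 2 ^ k * (1 + norm ?y ^ k)"
        using mult_mono[of 1 "2 ^ k" 1 "1 + norm ?y ^ k"] by simp
      with le have le2: "1 + norm x ^ k \<le> 2 ^ (k + 1) * (1 + norm ?y ^ k)" by simp
      have pos: "0 < 1 + norm x ^ k" "0 < 1 + norm ?y ^ k" by (auto simp: add_pos_nonneg)
      have "C * (1 + norm x ^ k) \<le> C * (2 ^ (k + 1) * (1 + norm ?y ^ k))"
        using le2 C(1) by (rule mult_left_mono)
      then have "C / (1 + norm ?y ^ k) \<le> ?B"
        using pos by (simp add: divide_simps mult_ac)
      with C(2)[of ?y] show ?thesis by linarith
    qed
    have d: "((\<lambda>t. \<phi> (x + t *\<^sub>R b)) has_derivative (\<lambda>s. s *\<^sub>R partial b \<phi> (x + t *\<^sub>R b))) (at t within {0..h})" for t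
      using schwartz_has_vector_derivative[OF assms(1)] by (simp add: has_vector_derivative_def)
    have "norm (\<phi> (x + h *\<^sub>R b) - \<phi> (x + 0 *\<^sub>R b)) \<le> ?B * norm (h - 0)"
    proof (rule differentiable_bound[where S="{0..h}"])
      show "onorm (\<lambda>s. s *\<^sub>R partial b \<phi> (x + t *\<^sub>R b)) \<le> ?B" if "t \<in> {0..h}" for t
      proof (rule onorm_bound)
        show "norm (s *\<^sub>R partial b \<phi> (x + t *\<^sub>R b)) \<le> ?B * norm s" for s
          unfolding norm_scaleR real_norm_def mult.commute[of ?B] by (rule mult_left_mono[OF B[OF that]]) simp
      qed (use order_trans[OF norm_ge_zero B[OF that]] in simp)
    qed (use d h in auto)
    then show ?thesis using h by simp
  qed
  then show ?thesis using that[of "2 ^ (k + 1) * C"] C by auto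
qed

text \<open>
  In place of an integration by parts, the difference quotients of \<open>\<phi>\<close> in
  direction \<open>b\<close> are integrated against the character: by translation invariance
  their transforms are those of \<open>\<phi>\<close> times the difference quotients of
  \<open>cis\<close>, and dominated convergence gives both limits.
\<close>

lemma fourier_partial:
  fixes \<phi> :: "'a::euclidean_space \<Rightarrow> complex"
  assumes \<phi>: "\<phi> \<in> schwartz" and b: "b \<in> Basis"
  shows "fourier (partial b \<phi>) \<xi> = \<i> * of_real (\<xi> \<bullet> b) * fourier \<phi> \<xi>"
proof -
  obtain C where C: "0 \<le> C" "\<And>x h. 0 < h \<Longrightarrow> h \<le> 1 \<Longrightarrow>
      norm (\<phi> (x + h *\<^sub>R b) - \<phi> x) \<le> C / (1 + norm x ^ (DIM('a) + 1)) * h"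
    using difference_quotient_bound[OF \<phi> b, of "DIM('a) + 1"] by metis
  have int: "integrable lborel \<phi>" "integrable lborel (partial b \<phi>)"
    using \<phi> b schwartz_partial schwartz_rapidly_decreasing rapidly_decreasing_integrable by blast+
  have [measurable]: "\<phi> \<in> borel_measurable borel" "partial b \<phi> \<in> borel_measurable borel"
    using int by auto
  define h where "h k = inverse (real (Suc k))" for k
  have h: "0 < h k" "h k \<le> 1" for k by (auto simp: h_def inverse_le_1_iff)
  have h0: "h \<longlonglongrightarrow> 0" unfolding h_def by (rule LIMSEQ_inverse_real_of_nat)
  then have hat: "filterlim h (at 0) sequentially"
    using h by (auto simp: filterlim_at intro!: always_eventually) (metis less_irrefl)
  let ?e = "\<lambda>x. cis (- (x \<bullet> \<xi>))"
  define I where "I = (LINT x|lborel. ?e x * \<phi> x)"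
  define D where "D k x = ?e x * ((\<phi> (x + h k *\<^sub>R b) - \<phi> x) /\<^sub>R h k)" for k x
  have "(\<lambda>k. LINT x|lborel. D k x) \<longlonglongrightarrow> (LINT x|lborel. ?e x * partial b \<phi> x)"
  proof (rule integral_dominated_convergence)
    show "integrable lborel (\<lambda>x::'a. C * (1 / (1 + norm x ^ (DIM('a) + 1))))"
      by (intro integrable_mult_right integrable_inverse_power_norm)
    show "AE x in lborel. norm (D k x) \<le> C * (1 / (1 + norm x ^ (DIM('a) + 1)))" for k
    proof (rule AE_I2)
      fix x
      have "norm (D k x) = norm (\<phi> (x + h k *\<^sub>R b) - \<phi> x) / h k"
        using h(1)[of k] by (simp add: D_def norm_mult divide_inverse mult.commute)
      also have "\<dots> \<le> C / (1 + norm x ^ (DIM('a) + 1))"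
        using C(2)[OF h, of x k] h(1)[of k] by (simp only: pos_divide_le_eq)
      finally show "norm (D k x) \<le> C * (1 / (1 + norm x ^ (DIM('a) + 1)))" by simp
    qed
    show "AE x in lborel. (\<lambda>k. D k x) \<longlonglongrightarrow> ?e x * partial b \<phi> x"
    proof (rule AE_I2)
      fix x
      have "((\<lambda>t. \<phi> (x + t *\<^sub>R b)) has_vector_derivative partial b \<phi> x) (at 0)"
        using schwartz_has_vector_derivative[OF \<phi>, of x b 0 UNIV] by simp
      then have "((\<lambda>t. (\<phi> (x + t *\<^sub>R b) - \<phi> x) /\<^sub>R t) \<longlongrightarrow> partial b \<phi> x) (at 0)"
        by (auto dest: has_vector_derivative_imp_difference_quotient)
      then have "(\<lambda>k. (\<phi> (x + h k *\<^sub>R b) - \<phi> x) /\<^sub>R h k) \<longlonglongrightarrow> partial b \<phi> x"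
        by (rule filterlim_compose[OF _ hat])
      then show "(\<lambda>k. D k x) \<longlonglongrightarrow> ?e x * partial b \<phi> x"
        unfolding D_def by (intro tendsto_mult tendsto_const)
    qed
  qed (auto simp: D_def)
  moreover have "(LINT x|lborel. D k x) = (cis (h k * (b \<bullet> \<xi>)) - cis 0) /\<^sub>R h k * I" for k
  proof -
    have i1: "integrable lborel (\<lambda>x. ?e x * \<phi> x)" by (rule integrable_cis_mult) (auto intro: int)
    have "(LINT x|lborel. ?e (x + h k *\<^sub>R b) * \<phi> (x + h k *\<^sub>R b)) = I"
      unfolding I_def by (rule integral_translate) measurable
    moreover have "integrable lborel (\<lambda>x. ?e (x + h k *\<^sub>R b) * \<phi> (x + h k *\<^sub>R b))"
      by (rule integrable_translate[OF i1])
    moreover have "D k x = (cis (h k * (b \<bullet> \<xi>)) * (?e (x + h k *\<^sub>R b) * \<phi> (x + h k *\<^sub>R b)) - ?e x * \<phi> x) /\<^sub>R h k" for x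
      by (simp add: D_def inner_add_left right_diff_distrib mult.assoc[symmetric] cis_mult)
    ultimately show ?thesis
      using i1 by (simp add: I_def left_diff_distrib)
  qed
  moreover have "(\<lambda>k. (cis (h k * (b \<bullet> \<xi>)) - cis 0) /\<^sub>R h k * I) \<longlonglongrightarrow> \<i> * of_real (b \<bullet> \<xi>) * I"
  proof -
    have "((\<lambda>t. cis (t * (b \<bullet> \<xi>))) has_vector_derivative \<i> * of_real (b \<bullet> \<xi>)) (at 0)"
      unfolding cis_conv_exp
      by (auto intro!: derivative_eq_intros has_vector_derivative_real_field simp: o_def)
    then have "((\<lambda>t. (cis (t * (b \<bullet> \<xi>)) - cis 0) /\<^sub>R t) \<longlongrightarrow> \<i> * of_real (b \<bullet> \<xi>)) (at 0)"
      by (auto dest: has_vector_derivative_imp_difference_quotient)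
    from filterlim_compose[OF this hat] show ?thesis by (intro tendsto_mult tendsto_const)
  qed
  ultimately have "(LINT x|lborel. ?e x * partial b \<phi> x) = \<i> * of_real (b \<bullet> \<xi>) * I"
    using LIMSEQ_unique by fastforce
  then show ?thesis
    by (simp add: fourier_cis I_def inner_commute)
qed

section \<open>Fourier inversion\<close>

lemma fourier_coordinate_power_bound:
  fixes \<phi> :: "'a::euclidean_space \<Rightarrow> complex"
  assumes "\<phi> \<in> schwartz" and b: "b \<in> Basis"
  shows "\<exists>C\<ge>0. \<forall>\<xi>. \<bar>\<xi> \<bullet> b\<bar> ^ k * norm (fourier \<phi> \<xi>) \<le> C"
  using assms(1)
proof (induction k arbitrary: \<phi>)
  case 0
  show ?case
    by (rule exI[of _ "(2 * pi) powr (- real DIM('a) / 2) * (LINT x|lborel. norm (\<phi> x))"])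
       (use norm_fourier_le[of \<phi>] in auto)
next
  case (Suc k)
  obtain C where "0 \<le> C" and C: "\<And>\<xi>. \<bar>\<xi> \<bullet> b\<bar> ^ k * norm (fourier (partial b \<phi>) \<xi>) \<le> C"
    using Suc.IH[OF schwartz_partial[OF Suc.prems b]] by blast
  have "\<bar>\<xi> \<bullet> b\<bar> ^ Suc k * norm (fourier \<phi> \<xi>) \<le> C" for \<xi>
    using C[of \<xi>] by (simp add: fourier_partial[OF Suc.prems b] norm_mult mult_ac)
  with \<open>0 \<le> C\<close> show ?case by blast
qed

text \<open>
  At each \<open>\<xi>\<close> some coordinate is at least \<open>norm \<xi>\<close> divided by
  the dimension, so decay in every single coordinate suffices.
\<close>

lemma rapidly_decreasing_fourier:
  fixes \<phi> :: "'a::euclidean_space \<Rightarrow> complex"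
  assumes \<phi>: "\<phi> \<in> schwartz"
  shows "rapidly_decreasing (fourier \<phi>)"
  unfolding rapidly_decreasing_def
proof (intro conjI allI)
  have [measurable]: "\<phi> \<in> borel_measurable borel"
    using schwartz_rapidly_decreasing[OF \<phi>] by (simp add: rapidly_decreasing_def)
  show "fourier \<phi> \<in> borel_measurable borel" by measurable
  fix k
  let ?n = "real DIM('a)"
  have "\<forall>b\<in>Basis. \<exists>C\<ge>0. \<forall>\<xi>. \<bar>\<xi> \<bullet> b\<bar> ^ k * norm (fourier \<phi> \<xi>) \<le> C"
    using fourier_coordinate_power_bound[OF \<phi>] by blast
  then obtain C where C0: "\<And>b. b \<in> Basis \<Longrightarrow> 0 \<le> C b"
    and C: "\<And>b \<xi>. b \<in> Basis \<Longrightarrow> \<bar>\<xi> \<bullet> b\<bar> ^ k * norm (fourier \<phi> \<xi>) \<le> C b" by metis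
  have "norm \<xi> ^ k * norm (fourier \<phi> \<xi>) \<le> ?n ^ k * (\<Sum>b\<in>Basis. C b)" for \<xi>
  proof -
    obtain b where b: "b \<in> Basis" "norm \<xi> \<le> ?n * \<bar>\<xi> \<bullet> b\<bar>"
    proof -
      have "Max ((\<lambda>b. \<bar>\<xi> \<bullet> b\<bar>) ` Basis) \<in> (\<lambda>b. \<bar>\<xi> \<bullet> b\<bar>) ` Basis"
        by (rule Max_in) auto
      then obtain b where b: "b \<in> Basis" "Max ((\<lambda>b. \<bar>\<xi> \<bullet> b\<bar>) ` Basis) = \<bar>\<xi> \<bullet> b\<bar>" by blast
      have "norm \<xi> \<le> (\<Sum>b\<in>Basis. \<bar>\<xi> \<bullet> b\<bar>)" by (rule norm_le_l1)
      also have "\<dots> \<le> ?n * \<bar>\<xi> \<bullet> b\<bar>"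
        unfolding b(2)[symmetric] by (rule sum_bounded_above) simp
      finally show ?thesis using b(1) that by blast
    qed
    have "norm \<xi> ^ k * norm (fourier \<phi> \<xi>) \<le> (?n * \<bar>\<xi> \<bullet> b\<bar>) ^ k * norm (fourier \<phi> \<xi>)"
      using b(2) by (intro mult_right_mono power_mono) auto
    also have "\<dots> = ?n ^ k * (\<bar>\<xi> \<bullet> b\<bar> ^ k * norm (fourier \<phi> \<xi>))"
      by (simp add: power_mult_distrib)
    also have "\<dots> \<le> ?n ^ k * C b" using C[OF b(1)] by (rule mult_left_mono) simp
    also have "\<dots> \<le> ?n ^ k * (\<Sum>b\<in>Basis. C b)"
      using b(1) C0 by (intro mult_left_mono member_le_sum) auto
    finally show ?thesis .
  qed
  then show "bounded (range (\<lambda>\<xi>. norm \<xi> ^ k *\<^sub>R fourier \<phi> \<xi>))"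
    unfolding bounded_iff by auto
qed

lemma rapidly_decreasing_inv_fourier:
  assumes "\<phi> \<in> schwartz"
  shows "rapidly_decreasing (inv_fourier \<phi>)"
proof -
  have F: "rapidly_decreasing (fourier \<phi>)" by (rule rapidly_decreasing_fourier[OF assms])
  then have [measurable]: "fourier \<phi> \<in> borel_measurable borel" by (simp add: rapidly_decreasing_def)
  have "range (\<lambda>x. norm x ^ k *\<^sub>R inv_fourier \<phi> x) = range (\<lambda>x. norm x ^ k *\<^sub>R fourier \<phi> x)" for k
  proof -
    have "range (\<lambda>x. norm x ^ k *\<^sub>R inv_fourier \<phi> x) = (\<lambda>x. norm x ^ k *\<^sub>R fourier \<phi> x) ` range uminus"
      unfolding image_image by (simp add: inv_fourier_eq_fourier)
    then show ?thesis by (simp add: surj_uminus)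
  qed
  moreover have "inv_fourier \<phi> \<in> borel_measurable borel"
    unfolding inv_fourier_eq_fourier[abs_def] by measurable
  ultimately show ?thesis using F by (simp add: rapidly_decreasing_def)
qed

lemma gaussian_eq_heat:
  assumes "0 < \<epsilon>"
  shows "exp (- \<epsilon> * (norm (\<xi>::'a::euclidean_space))\<^sup>2) = (pi / \<epsilon>) powr (real DIM('a) / 2) * heat (1 / (4 * \<epsilon>)) \<xi>"
proof -
  have "(pi / \<epsilon>) powr (real DIM('a) / 2) * (pi / \<epsilon>) powr (- real DIM('a) / 2) = 1"
    using assms by (simp add: powr_add[symmetric])
  then show ?thesis using assms by (simp add: heat_def field_simps)
qed

lemma fourier_gaussian:
  fixes y :: "'a::euclidean_space"
  assumes "0 < \<epsilon>"
  shows "integrable lborel (\<lambda>\<xi>::'a. cis (\<xi> \<bullet> x) * of_real (exp (- \<epsilon> * (norm \<xi>)\<^sup>2)))" (is ?int)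
    and "fourier (\<lambda>\<xi>. cis (\<xi> \<bullet> x) * of_real (exp (- \<epsilon> * (norm \<xi>)\<^sup>2))) y
      = of_real ((2 * pi) powr (real DIM('a) / 2) * heat \<epsilon> (y - x))" (is ?eq)
proof -
  let ?n = "real DIM('a)"
  let ?t = "1 / (4 * \<epsilon>)"
  have t: "0 < ?t" using assms by simp
  have e: "complex_of_real (exp (- \<epsilon> * (norm \<xi>)\<^sup>2)) = of_real ((pi / \<epsilon>) powr (?n / 2)) * of_real (heat ?t \<xi>)" for \<xi> :: 'a
    by (simp only: gaussian_eq_heat[OF assms] of_real_mult)
  have "integrable lborel (\<lambda>\<xi>. of_real ((pi / \<epsilon>) powr (?n / 2)) * (cis (\<xi> \<bullet> x) * complex_of_real (heat ?t \<xi>)))"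
    by (intro integrable_mult_right integrable_cis_heat[OF t])
  then show ?int by (simp only: e mult_ac)
  have "(LINT \<xi>|lborel. cis (- (\<xi> \<bullet> y)) * (cis (\<xi> \<bullet> x) * of_real (exp (- \<epsilon> * (norm \<xi>)\<^sup>2))))
    = (LINT \<xi>|lborel. of_real ((pi / \<epsilon>) powr (?n / 2)) * (cis (\<xi> \<bullet> (x - y)) * complex_of_real (heat ?t \<xi>)))"
  proof (rule Bochner_Integration.integral_cong)
    fix \<xi> :: 'a
    have "cis (\<xi> \<bullet> (x - y)) = cis (- (\<xi> \<bullet> y)) * cis (\<xi> \<bullet> x)"
      by (simp add: cis_mult inner_diff_right)
    then show "cis (- (\<xi> \<bullet> y)) * (cis (\<xi> \<bullet> x) * of_real (exp (- \<epsilon> * (norm \<xi>)\<^sup>2)))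
      = of_real ((pi / \<epsilon>) powr (?n / 2)) * (cis (\<xi> \<bullet> (x - y)) * complex_of_real (heat ?t \<xi>))"
      unfolding e by (simp only: mult_ac)
  qed simp
  also have "\<dots> = of_real ((pi / \<epsilon>) powr (?n / 2) * exp (- ?t * (norm (x - y))\<^sup>2))"
    by (simp only: integral_mult_right_zero fourier_heat[OF t] of_real_mult)
  finally have "fourier (\<lambda>\<xi>. cis (\<xi> \<bullet> x) * of_real (exp (- \<epsilon> * (norm \<xi>)\<^sup>2))) y =
      of_real ((2 * pi) powr (- ?n / 2) * ((pi / \<epsilon>) powr (?n / 2) * exp (- ?t * (norm (x - y))\<^sup>2)))"
    by (simp only: fourier_cis scaleR_conv_of_real of_real_mult)
  also have "(2 * pi) powr (- ?n / 2) * ((pi / \<epsilon>) powr (?n / 2) * exp (- ?t * (norm (x - y))\<^sup>2))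
      = (2 * pi) powr (?n / 2) * heat \<epsilon> (y - x)"
  proof -
    have "(pi / \<epsilon>) = (2 * pi) * (2 * pi) * inverse (4 * pi * \<epsilon>)" using assms by (simp add: field_simps)
    then have "(pi / \<epsilon>) powr (?n / 2) = (2 * pi) powr (?n / 2) * (2 * pi) powr (?n / 2) * (4 * pi * \<epsilon>) powr (- ?n / 2)"
    proof -
      have "(A * A * inverse B) powr r = A powr r * A powr r * B powr (- r)" if "0 < A" "0 < B" for A B r :: real
        using that by (simp add: powr_mult powr_minus inverse_powr)
      from this[of "2 * pi" "4 * pi * \<epsilon>" "?n / 2"] \<open>pi / \<epsilon> = _\<close> show ?thesis
        using assms by simp
    qed
    moreover have "(2 * pi) powr (- ?n / 2) * (2 * pi) powr (?n / 2) = 1"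
      by (simp add: powr_add[symmetric])
    ultimately show ?thesis
      by (simp add: heat_def norm_minus_commute algebra_simps)
  qed
  finally show ?eq .
qed

text \<open>
  After rescaling by the square root of the time, the kernel is fixed and only the argument of
  \<open>\<phi>\<close> moves.
\<close>

lemma heat_approximate_identity:
  fixes \<phi> :: "'a::euclidean_space \<Rightarrow> complex"
  assumes cont: "continuous_on UNIV \<phi>" and bdd: "\<And>x. norm (\<phi> x) \<le> C"
    and \<epsilon>: "\<And>k. 0 < \<epsilon> k" "\<epsilon> \<longlonglongrightarrow> 0"
  shows "(\<lambda>k. LINT y|lborel. of_real (heat (\<epsilon> k) (y - x)) * \<phi> y) \<longlonglongrightarrow> \<phi> x"
proof -
  have [measurable]: "\<phi> \<in> borel_measurable borel" by (rule borel_measurable_continuous_onI[OF cont])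
  have scale: "(LINT y|lborel. of_real (heat (\<epsilon> k) (y - x)) * \<phi> y) =
      (LINT z|lborel. of_real (heat 1 z) * \<phi> (x + sqrt (\<epsilon> k) *\<^sub>R z))" for k
  proof -
    let ?s = "sqrt (\<epsilon> k)"
    have s: "0 < ?s" "?s ^ 2 = \<epsilon> k" using \<epsilon>(1)[of k] by auto
    have "?s ^ DIM('a) = (\<epsilon> k) powr (real DIM('a) / 2)"
      using s by (simp add: powr_half_sqrt[symmetric] powr_powr flip: powr_realpow)
    moreover have "(\<epsilon> k) powr (real DIM('a) / 2) * (\<epsilon> k) powr (- real DIM('a) / 2) = 1"
      using \<epsilon>(1)[of k] by (simp add: powr_add[symmetric])
    ultimately have h: "?s ^ DIM('a) * heat (\<epsilon> k) (?s *\<^sub>R z) = heat 1 z" for z :: 'a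
      using s \<epsilon>(1)[of k] by (simp add: heat_def power_mult_distrib powr_mult mult_ac)
    have "(LINT y|lborel. of_real (heat (\<epsilon> k) (y - x)) * \<phi> y)
        = \<bar>?s\<bar> ^ DIM('a) *\<^sub>R (LINT z|lborel. of_real (heat (\<epsilon> k) (x + ?s *\<^sub>R z - x)) * \<phi> (x + ?s *\<^sub>R z))"
      by (rule lborel_integral_affine) (use s in auto)
    also have "\<dots> = (LINT z|lborel. \<bar>?s\<bar> ^ DIM('a) *\<^sub>R (of_real (heat (\<epsilon> k) (x + ?s *\<^sub>R z - x)) * \<phi> (x + ?s *\<^sub>R z)))"
      by (rule integral_scaleR_right[symmetric])
    also have "\<dots> = (LINT z|lborel. of_real (heat 1 z) * \<phi> (x + ?s *\<^sub>R z))"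
      using s(1) unfolding h[symmetric] of_real_mult
      by (intro Bochner_Integration.integral_cong refl) (simp add: scaleR_conv_of_real)
    finally show ?thesis .
  qed
  have "(\<lambda>k. LINT z|lborel. of_real (heat 1 z) * \<phi> (x + sqrt (\<epsilon> k) *\<^sub>R z)) \<longlonglongrightarrow> (LINT z::'a|lborel. of_real (heat 1 z) * \<phi> x)"
  proof (rule integral_dominated_convergence)
    show "integrable lborel (\<lambda>z::'a. heat 1 z * C)" by (intro integrable_mult_left integrable_heat) simp
    show "AE z in lborel. norm (of_real (heat 1 z) * \<phi> (x + sqrt (\<epsilon> k) *\<^sub>R z)) \<le> heat 1 z * C" for k
      by (auto simp: norm_mult intro!: mult_left_mono bdd)
    have "(\<lambda>k. x + sqrt (\<epsilon> k) *\<^sub>R z) \<longlonglongrightarrow> x + sqrt 0 *\<^sub>R z" for z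
      by (intro tendsto_intros \<epsilon>)
    then have "(\<lambda>k. \<phi> (x + sqrt (\<epsilon> k) *\<^sub>R z)) \<longlonglongrightarrow> \<phi> x" for z
      using cont by (intro continuous_on_tendsto_compose[OF cont]) auto
    then show "AE z in lborel. (\<lambda>k. of_real (heat 1 z) * \<phi> (x + sqrt (\<epsilon> k) *\<^sub>R z)) \<longlonglongrightarrow> of_real (heat 1 z) * \<phi> x"
      by (intro always_eventually allI tendsto_mult tendsto_const)
  qed auto
  also have "(LINT z::'a|lborel. of_real (heat 1 z) * \<phi> x) = \<phi> x"
    by (simp add: integral_heat)
  finally show ?thesis by (simp only: scale)
qed

text \<open>
  A Gaussian factor \<open>exp (- \<epsilon> |\<xi>|\<^sup>2)\<close> in the inversion integral
  can be removed by dominated convergence; with the factor, the multiplication formula turns the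
  integral into the average of \<open>\<phi>\<close> against the heat kernel at time
  \<open>\<epsilon>\<close>, which tends to \<open>\<phi> x\<close>.
\<close>

lemma fourier_inversion:
  fixes \<phi> :: "'a::euclidean_space \<Rightarrow> complex"
  assumes \<phi>: "\<phi> \<in> schwartz"
  shows "inv_fourier (fourier \<phi>) x = \<phi> x"
proof -
  let ?c = "(2 * pi) powr (real DIM('a) / 2)"
  have \<phi>int: "integrable lborel \<phi>"
    by (rule rapidly_decreasing_integrable[OF schwartz_rapidly_decreasing[OF \<phi>]])
  have Fint: "integrable lborel (fourier \<phi>)"
    by (rule rapidly_decreasing_integrable[OF rapidly_decreasing_fourier[OF \<phi>]])
  have [measurable]: "\<phi> \<in> borel_measurable borel" "fourier \<phi> \<in> borel_measurable borel"
    using \<phi>int Fint by auto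
  obtain C where C: "\<And>x. norm (\<phi> x) \<le> C"
    using schwartz_rapidly_decreasing[OF \<phi>] bounded_range_weightedE[of 0 \<phi>]
    unfolding rapidly_decreasing_def by (metis mult_1 power_0)
  define \<epsilon> where "\<epsilon> k = inverse (real (Suc k))" for k
  have \<epsilon>: "0 < \<epsilon> k" "\<epsilon> \<longlonglongrightarrow> 0" for k
    unfolding \<epsilon>_def by (simp, rule LIMSEQ_inverse_real_of_nat)
  define g where "g k \<xi> = cis (\<xi> \<bullet> x) * of_real (exp (- \<epsilon> k * (norm \<xi>)\<^sup>2))" for k \<xi>
  have g: "integrable lborel (g k)" "fourier (g k) y = of_real (?c * heat (\<epsilon> k) (y - x))" for k y
    unfolding g_def using fourier_gaussian[OF \<epsilon>(1)[of k], of x] by auto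
  have "(\<lambda>k. LINT \<xi>|lborel. g k \<xi> * fourier \<phi> \<xi>) \<longlonglongrightarrow> (LINT \<xi>|lborel. cis (\<xi> \<bullet> x) * fourier \<phi> \<xi>)"
  proof (rule integral_dominated_convergence)
    show "integrable lborel (\<lambda>\<xi>. norm (fourier \<phi> \<xi>))" using Fint by (rule integrable_norm)
    have "norm (g k \<xi>) \<le> 1" for k \<xi>
      using \<epsilon>(1)[of k] by (simp add: g_def norm_mult)
    then show "AE \<xi> in lborel. norm (g k \<xi> * fourier \<phi> \<xi>) \<le> norm (fourier \<phi> \<xi>)" for k
      by (auto simp: norm_mult intro!: mult_left_le_one_le)
    have "(\<lambda>k. exp (- \<epsilon> k * (norm \<xi>)\<^sup>2)) \<longlonglongrightarrow> exp (- 0 * (norm \<xi>)\<^sup>2)" for \<xi> :: 'a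
      by (intro tendsto_intros \<epsilon>)
    then have "(\<lambda>k. g k \<xi> * fourier \<phi> \<xi>) \<longlonglongrightarrow> cis (\<xi> \<bullet> x) * of_real (exp (- 0 * (norm \<xi>)\<^sup>2)) * fourier \<phi> \<xi>" for \<xi>
      unfolding g_def by (intro tendsto_mult tendsto_const tendsto_of_real)
    then show "AE \<xi> in lborel. (\<lambda>k. g k \<xi> * fourier \<phi> \<xi>) \<longlonglongrightarrow> cis (\<xi> \<bullet> x) * fourier \<phi> \<xi>"
      by simp
  qed (auto simp: g_def)
  also have "(\<lambda>k. LINT \<xi>|lborel. g k \<xi> * fourier \<phi> \<xi>) = (\<lambda>k. of_real ?c * (LINT y|lborel. of_real (heat (\<epsilon> k) (y - x)) * \<phi> y))"
    unfolding integral_mult_fourier_swap[OF g(1) \<phi>int] g(2) of_real_mult mult.assoc integral_mult_right_zero ..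
  finally have "(\<lambda>k. of_real ?c * (LINT y|lborel. of_real (heat (\<epsilon> k) (y - x)) * \<phi> y)) \<longlonglongrightarrow> (LINT \<xi>|lborel. cis (\<xi> \<bullet> x) * fourier \<phi> \<xi>)" .
  moreover have "(\<lambda>k. of_real ?c * (LINT y|lborel. of_real (heat (\<epsilon> k) (y - x)) * \<phi> y)) \<longlonglongrightarrow> of_real ?c * \<phi> x"
    by (intro tendsto_mult tendsto_const heat_approximate_identity[OF schwartz_continuous[OF \<phi>] C \<epsilon>])
  ultimately have "(LINT \<xi>|lborel. cis (\<xi> \<bullet> x) * fourier \<phi> \<xi>) = of_real ?c * \<phi> x"
    by (rule LIMSEQ_unique)
  then have "inv_fourier (fourier \<phi>) x = of_real ((2 * pi) powr (- real DIM('a) / 2)) * (of_real ?c * \<phi> x)"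
    by (simp add: inv_fourier_eq_fourier fourier_cis scaleR_conv_of_real)
  also have "\<dots> = of_real ((2 * pi) powr (- real DIM('a) / 2) * ?c) * \<phi> x" by simp
  also have "(2 * pi) powr (- real DIM('a) / 2) * ?c = 1" by (simp add: powr_add[symmetric])
  finally show ?thesis by simp
qed

lemma fourier_inv_fourier:
  fixes \<phi> :: "'a::euclidean_space \<Rightarrow> complex"
  assumes \<phi>: "\<phi> \<in> schwartz"
  shows "fourier (inv_fourier \<phi>) x = \<phi> x"
proof -
  have [measurable]: "\<phi> \<in> borel_measurable borel"
    using schwartz_rapidly_decreasing[OF \<phi>] by (simp add: rapidly_decreasing_def)
  have "(LINT y|lborel. cis (- (y \<bullet> x)) * fourier \<phi> (- y)) = (LINT y|lborel. cis (y \<bullet> x) * fourier \<phi> y)"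
    using integral_reflect[of "\<lambda>y. cis (y \<bullet> x) * fourier \<phi> y" 0] by simp
  then have "fourier (inv_fourier \<phi>) x = inv_fourier (fourier \<phi>) x"
    by (simp add: inv_fourier_eq_fourier fourier_cis[of "inv_fourier \<phi>"] fourier_cis[of "fourier \<phi>"])
  then show ?thesis by (simp add: fourier_inversion[OF \<phi>])
qed

section \<open>Convolution with superpositions of heat kernels\<close>

definition convolve :: "('a::euclidean_space \<Rightarrow> real) \<Rightarrow> ('a \<Rightarrow> real) \<Rightarrow> 'a \<Rightarrow> real" where
  "convolve K g x = (LINT y|lborel. K y * g (x - y))"

text \<open>
  Integrable and bounded functions: a class stable under convolution with integrable kernels and
  contained in all the function spaces that occur in the definition of \<open>H_tilde\<close>.
\<close>

definition L1_Linf :: "('a::euclidean_space \<Rightarrow> real) set" where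
  "L1_Linf = {g. integrable lborel g \<and> (\<exists>B. \<forall>x. \<bar>g x\<bar> \<le> B)}"

lemma L1_LinfE:
  assumes "g \<in> L1_Linf"
  obtains B where "integrable lborel g" "g \<in> borel_measurable borel" "0 \<le> B" "\<And>x. \<bar>g x\<bar> \<le> B"
proof -
  from assms obtain B where B: "integrable lborel g" "\<And>x. \<bar>g x\<bar> \<le> B" by (auto simp: L1_Linf_def)
  moreover have "g \<in> borel_measurable borel" using B(1) by auto
  moreover have "0 \<le> B" using order_trans[OF abs_ge_zero B(2)] .
  ultimately show ?thesis using that by blast
qed

lemma integrable_pair_convolution:
  fixes K g :: "'a::euclidean_space \<Rightarrow> real"
  assumes K: "integrable lborel K" and g: "integrable lborel g"
  shows "integrable (lborel \<Otimes>\<^sub>M lborel) (\<lambda>(y, x). K y * g (x - y))"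
proof -
  have [measurable]: "K \<in> borel_measurable borel" "g \<in> borel_measurable borel" using K g by auto
  have shift: "(LINT x|lborel. \<bar>g (x - y)\<bar>) = (LINT x|lborel. \<bar>g x\<bar>)" for y
    using integral_translate[of "\<lambda>x. \<bar>g x\<bar>" "- y"] by simp
  have "integrable lborel (\<lambda>x. g (x - y))" for y
    using integrable_translate[OF g, of "- y"] by simp
  then show ?thesis
    by (intro lborel_pair.Fubini_integrable) (use K in \<open>auto simp: abs_mult shift\<close>)
qed

lemma convolution_integrable:
  assumes "integrable lborel K" "integrable lborel g"
  shows "integrable lborel (convolve K g)"
  using lborel_pair.integrable_snd[OF integrable_pair_convolution[OF assms]]
  by (simp add: convolve_def[abs_def])

lemma convolution_integrand_integrable:
  assumes K: "integrable lborel K" and g: "g \<in> L1_Linf"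
  shows "integrable lborel (\<lambda>y. K y * g (x - y))"
proof -
  obtain B where [measurable]: "g \<in> borel_measurable borel" and B: "\<And>x. \<bar>g x\<bar> \<le> B"
    using g by (elim L1_LinfE) blast
  have [measurable]: "K \<in> borel_measurable borel" using K by auto
  show ?thesis
  proof (rule Bochner_Integration.integrable_bound)
    show "integrable lborel (\<lambda>y. K y * B)" using K by simp
    show "AE y in lborel. norm (K y * g (x - y)) \<le> norm (K y * B)"
      using B order_trans[OF abs_ge_zero B] by (auto simp: abs_mult intro!: mult_left_mono)
  qed measurable
qed

lemma convolution_L1_Linf:
  assumes K: "integrable lborel K" and g: "g \<in> L1_Linf"
  shows "convolve K g \<in> L1_Linf"
proof -
  obtain B where gi: "integrable lborel g" and B: "0 \<le> B" "\<And>x. \<bar>g x\<bar> \<le> B"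
    using g by (elim L1_LinfE) blast
  have "\<bar>convolve K g x\<bar> \<le> (LINT y|lborel. \<bar>K y\<bar> * B)" for x
  proof -
    have "\<bar>convolve K g x\<bar> \<le> (LINT y|lborel. \<bar>K y * g (x - y)\<bar>)"
      unfolding convolve_def by (rule integral_abs_bound)
    also have "\<dots> \<le> (LINT y|lborel. \<bar>K y\<bar> * B)"
      using integrable_abs[OF convolution_integrand_integrable[OF K g, of x], unfolded abs_mult] K B
      by (intro integral_mono) (auto simp: abs_mult intro: mult_left_mono)
    finally show ?thesis .
  qed
  then show ?thesis using convolution_integrable[OF K gi] by (auto simp: L1_Linf_def)
qed

lemma fourier_convolution:
  fixes K g :: "'a::euclidean_space \<Rightarrow> real"
  assumes K: "integrable lborel K" and g: "integrable lborel g"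
  shows "fourier (\<lambda>x. of_real (convolve K g x)) \<xi> =
    (LINT y|lborel. cis (- (y \<bullet> \<xi>)) * of_real (K y)) * fourier (\<lambda>x. of_real (g x)) \<xi>"
proof -
  have [measurable]: "K \<in> borel_measurable borel" "g \<in> borel_measurable borel" using K g by auto
  let ?e = "\<lambda>x. cis (- (x \<bullet> \<xi>))"
  define F where "F y x = ?e x * complex_of_real (K y * g (x - y))" for y x
  have "integrable (lborel \<Otimes>\<^sub>M lborel) (\<lambda>z. cis (- (snd z \<bullet> \<xi>)) * of_real (case z of (y, x) \<Rightarrow> K y * g (x - y)))"
    by (rule integrable_cis_mult[OF integrable_of_real[OF integrable_pair_convolution[OF K g]]]) measurable
  then have int: "integrable (lborel \<Otimes>\<^sub>M lborel) (case_prod F)"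
    by (simp add: F_def case_prod_beta')
  have "(LINT x|lborel. ?e x * of_real (convolve K g x)) = (LINT x|lborel. LINT y|lborel. F y x)"
    by (simp only: F_def convolve_def integral_mult_right_zero integral_complex_of_real)
  also have "\<dots> = (LINT y|lborel. LINT x|lborel. F y x)"
    by (rule lborel_pair.Fubini_integral[OF int])
  also have "\<dots> = (LINT y|lborel. (?e y * of_real (K y)) * (LINT x|lborel. ?e x * of_real (g x)))"
  proof (rule Bochner_Integration.integral_cong)
    fix y
    have "(LINT x|lborel. F y x) = (LINT x|lborel. F y (x + y))"
      by (rule integral_translate[symmetric]) (simp add: F_def)
    also have "\<dots> = (LINT x|lborel. (?e y * of_real (K y)) * (?e x * of_real (g x)))"
    proof (rule Bochner_Integration.integral_cong)
      fix x
      have "?e (x + y) = ?e x * ?e y" by (simp add: inner_add_left cis_mult)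
      then show "F y (x + y) = (?e y * of_real (K y)) * (?e x * of_real (g x))"
        by (simp add: F_def)
    qed simp
    finally show "(LINT x|lborel. F y x) = (?e y * of_real (K y)) * (LINT x|lborel. ?e x * of_real (g x))"
      by (simp only: integral_mult_right_zero)
  qed simp
  finally show ?thesis
    by (simp add: fourier_cis)
qed

text \<open>
  The convolution kernel of the function of \<open>-\<Delta>\<close> given by the Laplace
  transform of \<open>q\<close>. The weight \<open>q\<close> is meant to vanish on the
  nonpositive reals.
\<close>

definition subordinated_kernel :: "(real \<Rightarrow> real) \<Rightarrow> 'a::euclidean_space \<Rightarrow> real" where
  "subordinated_kernel q x = (LINT t|lborel. q t * heat t x)"

lemma integrable_pair_subordinated:
  fixes q :: "real \<Rightarrow> real"
  assumes q: "integrable lborel q" "\<forall>t\<le>0. q t = 0"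
  shows "integrable (lborel \<Otimes>\<^sub>M lborel) (\<lambda>(t, x::'a::euclidean_space). q t * heat t x)"
proof -
  have [measurable]: "q \<in> borel_measurable borel" using q by auto
  have "(LINT x|lborel. \<bar>q t * heat t (x::'a)\<bar>) = \<bar>q t\<bar>" for t
    by (cases "0 < t") (auto simp: abs_mult integral_heat q)
  moreover have "integrable lborel (\<lambda>x::'a. q t * heat t x)" for t
    by (cases "0 < t") (auto simp: integrable_heat q)
  ultimately show ?thesis
    by (intro lborel_pair.Fubini_integrable) (use q in auto)
qed

lemma subordinated_kernel_integrable:
  assumes "integrable lborel q" "\<forall>t\<le>0. q t = 0"
  shows "integrable lborel (subordinated_kernel q :: 'a::euclidean_space \<Rightarrow> real)"
  using lborel_pair.integrable_snd[OF integrable_pair_subordinated[OF assms]]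
  by (simp add: subordinated_kernel_def[abs_def])

text \<open>
  By Fubini, since the heat kernel at time \<open>t\<close> has the multiplier \<open>exp (- t
  |\<xi>|\<^sup>2)\<close>.
\<close>

lemma fourier_subordinated_kernel:
  fixes \<xi> :: "'a::euclidean_space"
  assumes q: "integrable lborel q" "\<forall>t\<le>0. q t = 0"
  shows "(LINT x|lborel. cis (- (x \<bullet> \<xi>)) * of_real (subordinated_kernel q x))
    = of_real (LINT t|lborel. q t * exp (- t * (norm \<xi>)\<^sup>2))"
proof -
  have [measurable]: "q \<in> borel_measurable borel" using q by auto
  let ?e = "\<lambda>x. cis (- (x \<bullet> \<xi>))"
  define F where "F t x = ?e x * complex_of_real (q t * heat t x)" for t x
  have "integrable (lborel \<Otimes>\<^sub>M lborel) (\<lambda>z. cis (- (snd z \<bullet> \<xi>)) * of_real (case z of (t, x) \<Rightarrow> q t * heat t x))"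
    by (rule integrable_cis_mult[OF integrable_of_real[OF integrable_pair_subordinated[OF q]]]) auto
  then have int: "integrable (lborel \<Otimes>\<^sub>M lborel) (case_prod F)"
    by (simp add: F_def case_prod_beta')
  have "(LINT x|lborel. ?e x * of_real (subordinated_kernel q x)) = (LINT x|lborel. LINT t|lborel. F t x)"
    by (simp only: F_def subordinated_kernel_def integral_mult_right_zero integral_complex_of_real)
  also have "\<dots> = (LINT t|lborel. LINT x|lborel. F t x)"
    by (rule lborel_pair.Fubini_integral[OF int])
  also have "\<dots> = (LINT t|lborel. complex_of_real (q t * exp (- t * (norm \<xi>)\<^sup>2)))"
  proof (rule Bochner_Integration.integral_cong)
    fix t
    show "(LINT x|lborel. F t x) = complex_of_real (q t * exp (- t * (norm \<xi>)\<^sup>2))"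
    proof (cases "0 < t")
      case True
      have "(LINT x|lborel. F t x) = (LINT x|lborel. of_real (q t) * (cis (x \<bullet> (- \<xi>)) * complex_of_real (heat t x)))"
        by (intro Bochner_Integration.integral_cong refl) (simp add: F_def mult_ac)
      also have "\<dots> = complex_of_real (q t * exp (- t * (norm (- \<xi>))\<^sup>2))"
        by (simp only: integral_mult_right_zero fourier_heat[OF True] of_real_mult)
      finally show ?thesis by simp
    qed (auto simp: F_def q)
  qed simp
  finally show ?thesis by (simp only: integral_complex_of_real)
qed

lemma L1_Linf_Lp_space:
  assumes "g \<in> L1_Linf" "1 < p"
  shows "g \<in> Lp_space p"
proof -
  obtain B where gi: "integrable lborel g" and [measurable]: "g \<in> borel_measurable borel"
    and B: "0 \<le> B" "\<And>x. \<bar>g x\<bar> \<le> B"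
    using assms by (elim L1_LinfE) blast
  have "integrable lborel (\<lambda>x. \<bar>g x\<bar> powr p)"
  proof (rule Bochner_Integration.integrable_bound)
    show "integrable lborel (\<lambda>x. B powr (p - 1) * \<bar>g x\<bar>)" using gi by simp
    have "\<bar>g x\<bar> powr p = \<bar>g x\<bar> powr (p - 1) * \<bar>g x\<bar>" for x
      using powr_add[of "\<bar>g x\<bar>" "p - 1" 1] by (cases "g x = 0") auto
    moreover have "\<bar>g x\<bar> powr (p - 1) \<le> B powr (p - 1)" for x
      using B assms by (intro powr_mono2) auto
    ultimately show "AE x in lborel. norm (\<bar>g x\<bar> powr p) \<le> norm (B powr (p - 1) * \<bar>g x\<bar>)"
      by (auto intro!: mult_right_mono)
  qed measurable
  then show ?thesis by (simp add: Lp_space_def)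
qed

lemma L1_Linf_L_weighted:
  assumes "g \<in> L1_Linf"
  shows "g \<in> L_weighted s"
proof -
  have gi: "integrable lborel g" and [measurable]: "g \<in> borel_measurable borel"
    using assms by (auto simp: L1_Linf_def)
  have "set_integrable lborel K g" if "compact K" for K
    unfolding set_integrable_def using gi borel_compact[OF that] by (intro integrable_mult_indicator) auto
  moreover have "integrable lborel (\<lambda>x. \<bar>g x\<bar> / (1 + norm x powr (real DIM('a) + 2 * s)))"
  proof (rule Bochner_Integration.integrable_bound[OF gi])
    have "\<bar>g x\<bar> / (1 + norm x powr (real DIM('a) + 2 * s)) \<le> \<bar>g x\<bar> / 1" for x
      by (intro divide_left_mono) (auto intro: add_pos_nonneg)
    then show "AE x in lborel. norm (\<bar>g x\<bar> / (1 + norm x powr (real DIM('a) + 2 * s))) \<le> norm (g x)"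
      by (simp add: abs_of_nonneg add_nonneg_nonneg)
  qed measurable
  ultimately show ?thesis by (simp add: L_weighted_def L1_loc_def)
qed

section \<open>Bessel potentials\<close>

lemma has_bochner_integral_Gamma_scaled:
  fixes a c :: real
  assumes "0 < a" "0 < c"
  shows "has_bochner_integral lborel (\<lambda>t. indicator {0<..} t * (t powr (a - 1) * exp (- c * t))) (Gamma a / c powr a)"
proof -
  let ?h = "\<lambda>t. indicator {0<..} t * (t powr (a - 1) * exp (- c * t))"
  have "ennreal (Gamma a) = (\<integral>\<^sup>+t. ennreal (indicator {0..} t * t powr (a - 1) / exp t) \<partial>lborel)"
    by (rule Gamma_conv_nn_integral_real[OF assms(1)])
  also have "\<dots> = ennreal \<bar>c\<bar> * (\<integral>\<^sup>+t. ennreal (indicator {0..} (0 + c * t) * (0 + c * t) powr (a - 1) / exp (0 + c * t)) \<partial>lborel)"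
    by (rule nn_integral_real_affine) (use assms in auto)
  also have "\<dots> = (\<integral>\<^sup>+t. ennreal \<bar>c\<bar> * ennreal (indicator {0..} (0 + c * t) * (0 + c * t) powr (a - 1) / exp (0 + c * t)) \<partial>lborel)"
    by (rule nn_integral_cmult[symmetric]) measurable
  also have "\<dots> = (\<integral>\<^sup>+t. ennreal (c powr a * ?h t) \<partial>lborel)"
  proof (rule nn_integral_cong)
    fix t :: real
    show "ennreal \<bar>c\<bar> * ennreal (indicator {0..} (0 + c * t) * (0 + c * t) powr (a - 1) / exp (0 + c * t)) = ennreal (c powr a * ?h t)"
    proof (cases "0 < t")
      case True
      have "c powr a = c * c powr (a - 1)"
        using powr_add[of c 1 "a - 1"] assms by simp
      then show ?thesis
        using True assms by (simp add: ennreal_mult'[symmetric] powr_mult exp_minus divide_inverse mult_ac)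
    next
      case False
      then have "indicator {0..} (c * t) * (c * t) powr (a - 1) = (0 :: real)"
        using assms by (auto simp: indicator_def zero_le_mult_iff)
      then show ?thesis using False by simp
    qed
  qed
  finally have "has_bochner_integral lborel (\<lambda>t. c powr a * ?h t) (Gamma a)"
    using assms by (intro has_bochner_integral_nn_integral) (auto simp: Gamma_real_pos less_imp_le)
  from has_bochner_integral_mult_right[OF this, of "inverse (c powr a)"]
  have "has_bochner_integral lborel (\<lambda>t. inverse (c powr a) * (c powr a * ?h t)) (inverse (c powr a) * Gamma a)" .
  moreover have "(\<lambda>t. inverse (c powr a) * (c powr a * ?h t)) = ?h"
    using assms by (simp add: fun_eq_iff mult.assoc[symmetric])
  ultimately show ?thesis
    by (simp only: divide_inverse mult.commute)
qed

text \<open>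
  The weight whose Laplace transform is \<open>(\<tau> + \<lambda>)\<close> to the power
  \<open>- a\<close>.
\<close>

definition bessel_weight :: "real \<Rightarrow> real \<Rightarrow> real \<Rightarrow> real" where
  "bessel_weight \<tau> a t = indicator {0<..} t * (t powr (a - 1) * exp (- \<tau> * t)) / Gamma a"

lemma measurable_bessel_weight [measurable]: "bessel_weight \<tau> a \<in> borel_measurable borel"
  unfolding bessel_weight_def[abs_def] by measurable

lemma bessel_weight_nonneg: "0 < a \<Longrightarrow> 0 \<le> bessel_weight \<tau> a t"
  by (simp add: bessel_weight_def Gamma_real_pos less_imp_le)

lemma bessel_weight_zero: "\<forall>t\<le>0. bessel_weight \<tau> a t = 0"
  by (simp add: bessel_weight_def)

lemma has_bochner_integral_bessel_weight:
  assumes "0 < a" "0 < \<tau>" "0 \<le> c"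
  shows "has_bochner_integral lborel (\<lambda>t. bessel_weight \<tau> a t * exp (- t * c)) ((\<tau> + c) powr (- a))"
proof -
  have "has_bochner_integral lborel (\<lambda>t. inverse (Gamma a) * (indicator {0<..} t * (t powr (a - 1) * exp (- (\<tau> + c) * t))))
      (inverse (Gamma a) * (Gamma a / (\<tau> + c) powr a))"
    using assms by (intro has_bochner_integral_mult_right has_bochner_integral_Gamma_scaled) auto
  moreover have "inverse (Gamma a) * (indicator {0<..} t * (t powr (a - 1) * exp (- (\<tau> + c) * t)))
      = bessel_weight \<tau> a t * exp (- t * c)" for t
  proof -
    have "exp (- (\<tau> + c) * t) = exp (- \<tau> * t) * exp (- t * c)"
      unfolding exp_add[symmetric] by (simp add: algebra_simps)
    then show ?thesis unfolding bessel_weight_def by (simp only: divide_inverse mult_ac)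
  qed
  moreover have "inverse (Gamma a) * (Gamma a / (\<tau> + c) powr a) = (\<tau> + c) powr (- a)"
    using Gamma_real_pos[OF assms(1)] by (simp add: powr_minus divide_inverse)
  ultimately show ?thesis by simp
qed

lemma integrable_bessel_weight:
  assumes "0 < a" "0 < \<tau>"
  shows "integrable lborel (bessel_weight \<tau> a)"
  using has_bochner_integral_bessel_weight[OF assms, of 0] by (auto simp: has_bochner_integral_iff)

text \<open>
  The generalised binomial coefficients are of order \<open>k\<close> to the power \<open>- a -
  1\<close>.
\<close>

lemma summable_abs_gbinomial:
  fixes a :: real
  assumes "0 < a"
  shows "summable (\<lambda>k. \<bar>a gchoose k\<bar>)"
proof -
  have "(\<lambda>n. (a gchoose n) / ((-1) ^ n / exp ((a + 1) * of_real (ln (real n))))) \<longlonglongrightarrow> inverse (Gamma (- a))"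
    by (rule gbinomial_asymptotic)
  then have "Bseq (\<lambda>n. (a gchoose n) / ((-1) ^ n / exp ((a + 1) * of_real (ln (real n)))))"
    by (intro convergent_imp_Bseq convergentI)
  then obtain B where B: "0 < B" "\<And>n. norm ((a gchoose n) / ((-1) ^ n / exp ((a + 1) * of_real (ln (real n))))) \<le> B"
    by (auto simp: Bseq_def)
  have le: "\<bar>a gchoose n\<bar> \<le> B * real n powr (- (a + 1))" if "1 \<le> n" for n
  proof -
    have p: "exp ((a + 1) * ln (real n)) = real n powr (a + 1)" using that by (simp add: powr_def)
    have "\<bar>a gchoose n\<bar> * real n powr (a + 1) \<le> B"
      using B(2)[of n] p by (simp add: abs_mult power_abs)
    moreover have "0 < real n powr (a + 1)" using that by simp
    ultimately show ?thesis unfolding powr_minus divide_inverse[symmetric] by (simp only: pos_le_divide_eq)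
  qed
  show ?thesis
  proof (rule summable_comparison_test')
    show "summable (\<lambda>n. B * real n powr (- (a + 1)))"
      using assms by (intro summable_mult) (simp add: summable_real_powr_iff)
    show "norm \<bar>a gchoose n\<bar> \<le> B * real n powr (- (a + 1))" if "1 \<le> n" for n
      using le[OF that] by simp
  qed
qed

text \<open>
  With \<open>x = \<tau> / (\<tau> + \<lambda>)\<close>, the Laplace transform of this term at
  \<open>\<lambda>\<close> is the term of order \<open>k + 1\<close> in the binomial series of
  \<open>(1 - x)\<close> to the power \<open>a\<close>.
\<close>

definition laplacian_weight_term :: "real \<Rightarrow> real \<Rightarrow> nat \<Rightarrow> real \<Rightarrow> real" where
  "laplacian_weight_term \<tau> a k t =
     (a gchoose Suc k) * (- \<tau>) ^ Suc k * bessel_weight \<tau> (real (Suc k)) t"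

definition laplacian_weight :: "real \<Rightarrow> real \<Rightarrow> real \<Rightarrow> real" where
  "laplacian_weight \<tau> a t = (\<Sum>k. laplacian_weight_term \<tau> a k t)"

lemma summable_laplacian_weight_term:
  assumes "0 < a" "0 < \<tau>"
  shows "summable (\<lambda>k. norm (laplacian_weight_term \<tau> a k t))"
proof (cases "0 < t")
  case True
  have "Bseq (\<lambda>k. a gchoose k)"
    using summable_LIMSEQ_zero[OF summable_rabs_cancel[OF summable_abs_gbinomial[OF assms(1)]]]
    by (intro convergent_imp_Bseq convergentI)
  then obtain B where B: "0 < B" "\<And>k. \<bar>a gchoose k\<bar> \<le> B" by (auto simp: Bseq_def)
  show ?thesis
  proof (rule summable_comparison_test')
    show "summable (\<lambda>k. (B * \<tau>) * (inverse (fact k) * (\<tau> * t) ^ k))"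
      by (intro summable_mult summable_exp)
    fix k :: nat
    have w: "bessel_weight \<tau> (real (Suc k)) t = t ^ k * exp (- \<tau> * t) / fact k"
      using True Gamma_fact[of k, where 'a=real] by (simp add: bessel_weight_def powr_realpow add.commute)
    have "norm (laplacian_weight_term \<tau> a k t) = \<bar>a gchoose Suc k\<bar> * (\<tau> ^ Suc k * (t ^ k * exp (- \<tau> * t) / fact k))"
      using assms True unfolding laplacian_weight_term_def w by (simp add: abs_mult power_abs)
    also have "\<dots> \<le> B * (\<tau> ^ Suc k * (t ^ k * 1 / fact k))"
      using assms True B by (intro mult_mono divide_right_mono mult_left_mono) auto
    finally show "norm (norm (laplacian_weight_term \<tau> a k t)) \<le> (B * \<tau>) * (inverse (fact k) * (\<tau> * t) ^ k)"
      by (simp add: power_mult_distrib divide_inverse mult_ac)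
  qed
qed (simp add: laplacian_weight_term_def bessel_weight_zero)

lemma laplacian_weight_zero: "\<forall>t\<le>0. laplacian_weight \<tau> a t = 0"
  by (simp add: laplacian_weight_def laplacian_weight_term_def bessel_weight_zero)

lemma
  assumes "0 < a" "0 < \<tau>" "0 \<le> c"
  shows integrable_laplacian_weight_exp: "integrable lborel (\<lambda>t. laplacian_weight \<tau> a t * exp (- t * c))"
    and laplacian_weight_exp_sums: "(\<lambda>k. (a gchoose Suc k) * (- (\<tau> / (\<tau> + c))) ^ Suc k) sums
      (LINT t|lborel. laplacian_weight \<tau> a t * exp (- t * c))"
proof -
  define f where "f k t = laplacian_weight_term \<tau> a k t * exp (- t * c)" for k t
  have I: "has_bochner_integral lborel (f k) ((a gchoose Suc k) * (- (\<tau> / (\<tau> + c))) ^ Suc k)" for k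
  proof -
    have "has_bochner_integral lborel (\<lambda>t. ((a gchoose Suc k) * (- \<tau>) ^ Suc k) * (bessel_weight \<tau> (real (Suc k)) t * exp (- t * c)))
      (((a gchoose Suc k) * (- \<tau>) ^ Suc k) * (\<tau> + c) powr (- real (Suc k)))"
      using assms by (intro has_bochner_integral_mult_right has_bochner_integral_bessel_weight) auto
    moreover have "((a gchoose Suc k) * (- \<tau>) ^ Suc k) * (\<tau> + c) powr (- real (Suc k))
        = (a gchoose Suc k) * (- (\<tau> / (\<tau> + c))) ^ Suc k"
    proof -
      have "(\<tau> + c) powr (- real (Suc k)) = inverse ((\<tau> + c) ^ Suc k)"
        using assms by (subst powr_minus, subst powr_realpow) auto
      moreover have "- (\<tau> / (\<tau> + c)) = (- \<tau>) * inverse (\<tau> + c)" by (simp add: divide_inverse)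
      ultimately show ?thesis
        by (simp only: power_mult_distrib power_inverse mult.assoc)
    qed
    ultimately show ?thesis
      by (simp only: f_def[abs_def] laplacian_weight_term_def mult.assoc)
  qed
  have fi: "integrable lborel (f k)" for k using I by (auto simp: has_bochner_integral_iff)
  have S: "summable (\<lambda>k. norm (f k t))" for t
    unfolding f_def norm_mult by (intro summable_mult2 summable_laplacian_weight_term assms)
  \<comment> \<open>termwise integration is justified by the norms in \<open>L\<^sup>1\<close>, each at most
      \<open>|a gchoose Suc k|\<close>\<close>
  have N: "summable (\<lambda>k. LINT t|lborel. norm (f k t))"
  proof (rule summable_comparison_test')
    show "summable (\<lambda>k. \<bar>a gchoose Suc k\<bar>)"
      using summable_abs_gbinomial[OF assms(1)] by (subst summable_Suc_iff)
    fix k :: nat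
    have "has_bochner_integral lborel (\<lambda>t. (\<bar>a gchoose Suc k\<bar> * \<tau> ^ Suc k) * (bessel_weight \<tau> (real (Suc k)) t * exp (- t * c)))
      ((\<bar>a gchoose Suc k\<bar> * \<tau> ^ Suc k) * (\<tau> + c) powr (- real (Suc k)))"
      using assms by (intro has_bochner_integral_mult_right has_bochner_integral_bessel_weight) auto
    moreover have "(\<lambda>t. (\<bar>a gchoose Suc k\<bar> * \<tau> ^ Suc k) * (bessel_weight \<tau> (real (Suc k)) t * exp (- t * c))) = (\<lambda>t. norm (f k t))"
      using assms bessel_weight_nonneg[of "real (Suc k)" \<tau>]
      by (auto simp: f_def laplacian_weight_term_def abs_mult power_abs fun_eq_iff)
    ultimately have "has_bochner_integral lborel (\<lambda>t. norm (f k t)) ((\<bar>a gchoose Suc k\<bar> * \<tau> ^ Suc k) * (\<tau> + c) powr (- real (Suc k)))"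
      by (simp only:)
    then have "(LINT t|lborel. norm (f k t)) = (\<bar>a gchoose Suc k\<bar> * \<tau> ^ Suc k) * (\<tau> + c) powr (- real (Suc k))"
      by (rule has_bochner_integral_integral_eq)
    also have "(\<tau> + c) powr (- real (Suc k)) = inverse ((\<tau> + c) ^ Suc k)"
      using assms by (subst powr_minus, subst powr_realpow) auto
    also have "(\<bar>a gchoose Suc k\<bar> * \<tau> ^ Suc k) * inverse ((\<tau> + c) ^ Suc k) \<le> \<bar>a gchoose Suc k\<bar>"
    proof -
      have "\<tau> ^ Suc k \<le> (\<tau> + c) ^ Suc k" "0 < (\<tau> + c) ^ Suc k" using assms by (auto intro: power_mono simp del: power_Suc)
      then have "\<tau> ^ Suc k * inverse ((\<tau> + c) ^ Suc k) \<le> 1"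
        by (simp add: divide_inverse[symmetric] del: power_Suc)
      from mult_left_mono[OF this, of "\<bar>a gchoose Suc k\<bar>"] show ?thesis
        by (simp only: mult.assoc abs_ge_zero mult_1_right)
    qed
    finally show "norm (LINT t|lborel. norm (f k t)) \<le> \<bar>a gchoose Suc k\<bar>"
      by (simp add: integral_nonneg_AE)
  qed
  have eq: "(\<Sum>k. f k t) = laplacian_weight \<tau> a t * exp (- t * c)" for t
    unfolding f_def laplacian_weight_def
    by (intro suminf_mult2[symmetric] summable_norm_cancel[OF summable_laplacian_weight_term[OF assms(1,2)]])
  show "integrable lborel (\<lambda>t. laplacian_weight \<tau> a t * exp (- t * c))"
    using integrable_suminf[OF fi _ N] S by (simp add: eq)
  have "(\<lambda>k. integral\<^sup>L lborel (f k)) sums (LINT t|lborel. (\<Sum>k. f k t))"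
    by (rule sums_integral[OF fi _ N]) (use S in auto)
  then show "(\<lambda>k. (a gchoose Suc k) * (- (\<tau> / (\<tau> + c))) ^ Suc k) sums
      (LINT t|lborel. laplacian_weight \<tau> a t * exp (- t * c))"
    using I by (simp only: eq has_bochner_integral_iff)
qed

lemma integrable_laplacian_weight:
  assumes "0 < a" "0 < \<tau>"
  shows "integrable lborel (laplacian_weight \<tau> a)"
  using integrable_laplacian_weight_exp[OF assms, of 0] by simp

text \<open>
  The constant term \<open>1\<close> of the binomial series corresponds to a point mass at the
  origin and not to a kernel; it is subtracted here and becomes the summand \<open>g\<close> of
  \<open>bessel_laplacian\<close>.
\<close>

lemma integral_laplacian_weight_exp:
  assumes "0 < a" "0 < \<tau>" "0 < c"
  shows "(LINT t|lborel. laplacian_weight \<tau> a t * exp (- t * c)) = (c / (\<tau> + c)) powr a - 1"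
proof -
  let ?z = "- (\<tau> / (\<tau> + c))"
  have "(\<lambda>k. (a gchoose k) * ?z ^ k) sums (1 + ?z) powr a"
    by (rule gen_binomial_real) (use assms in auto)
  then have "(\<lambda>k. (a gchoose Suc k) * ?z ^ Suc k) sums ((1 + ?z) powr a - 1)"
    by (subst sums_Suc_iff) simp
  moreover have "1 + ?z = c / (\<tau> + c)" using assms by (simp add: field_simps)
  ultimately show ?thesis
    using laplacian_weight_exp_sums[OF assms(1,2), of c] assms(3) sums_unique2 by fastforce
qed

definition bessel_potential :: "real \<Rightarrow> real \<Rightarrow> ('a::euclidean_space \<Rightarrow> real) \<Rightarrow> 'a \<Rightarrow> real" where
  "bessel_potential \<tau> a g = convolve (subordinated_kernel (bessel_weight \<tau> a)) g"

lemma bessel_potential_L1_Linf: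
  assumes "0 < a" "0 < \<tau>" "g \<in> L1_Linf"
  shows "bessel_potential \<tau> a g \<in> L1_Linf"
  unfolding bessel_potential_def
  by (intro convolution_L1_Linf subordinated_kernel_integrable integrable_bessel_weight bessel_weight_zero assms)

lemma fourier_bessel_potential:
  assumes "0 < a" "0 < \<tau>" "g \<in> L1_Linf"
  shows "fourier (\<lambda>x. of_real (bessel_potential \<tau> a g x)) \<xi> =
    of_real ((\<tau> + (norm \<xi>)\<^sup>2) powr (- a)) * fourier (\<lambda>x. of_real (g x)) \<xi>"
proof -
  have g: "integrable lborel g" using assms by (simp add: L1_Linf_def)
  note q = integrable_bessel_weight[OF assms(1,2)] bessel_weight_zero
  have "fourier (\<lambda>x. of_real (bessel_potential \<tau> a g x)) \<xi> =
      (LINT y|lborel. cis (- (y \<bullet> \<xi>)) * of_real (subordinated_kernel (bessel_weight \<tau> a) y)) * fourier (\<lambda>x. of_real (g x)) \<xi>"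
    unfolding bessel_potential_def by (rule fourier_convolution[OF subordinated_kernel_integrable[OF q] g])
  also have "(LINT y|lborel. cis (- (y \<bullet> \<xi>)) * complex_of_real (subordinated_kernel (bessel_weight \<tau> a) y))
      = of_real ((\<tau> + (norm \<xi>)\<^sup>2) powr (- a))"
    unfolding fourier_subordinated_kernel[OF q]
    using has_bochner_integral_bessel_weight[OF assms(1,2), of "(norm \<xi>)\<^sup>2"]
    by (simp add: has_bochner_integral_iff)
  finally show ?thesis .
qed

text \<open>
  The function \<open>(-\<Delta>)\<^sup>a (\<tau> - \<Delta>)\<^sup>-\<^sup>a g\<close>.
\<close>

definition bessel_laplacian :: "real \<Rightarrow> real \<Rightarrow> ('a::euclidean_space \<Rightarrow> real) \<Rightarrow> 'a \<Rightarrow> real" where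
  "bessel_laplacian \<tau> a g x = g x + convolve (subordinated_kernel (laplacian_weight \<tau> a)) g x"

lemma bessel_laplacian_L1_Linf:
  assumes "0 < a" "0 < \<tau>" "g \<in> L1_Linf"
  shows "bessel_laplacian \<tau> a g \<in> L1_Linf"
proof -
  have c: "convolve (subordinated_kernel (laplacian_weight \<tau> a)) g \<in> L1_Linf"
    by (intro convolution_L1_Linf subordinated_kernel_integrable integrable_laplacian_weight laplacian_weight_zero assms)
  obtain B C where "\<And>x. \<bar>g x\<bar> \<le> B" "\<And>x. \<bar>convolve (subordinated_kernel (laplacian_weight \<tau> a)) g x\<bar> \<le> C"
    using c assms(3) by (auto simp: L1_Linf_def)
  then have "\<bar>bessel_laplacian \<tau> a g x\<bar> \<le> B + C" for x
    unfolding bessel_laplacian_def by (meson abs_triangle_ineq add_mono order_trans)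
  then show ?thesis
    using c assms(3) by (auto simp: L1_Linf_def bessel_laplacian_def[abs_def])
qed

text \<open>
  The origin is excluded because the binomial series is summed inside its disc of convergence,
  \<open>\<tau> / (\<tau> + |\<xi>|\<^sup>2) < 1\<close>.
\<close>

lemma fourier_bessel_laplacian:
  assumes "0 < a" "0 < \<tau>" "g \<in> L1_Linf" "\<xi> \<noteq> 0"
  shows "fourier (\<lambda>x. of_real (bessel_laplacian \<tau> a g x)) \<xi> =
    of_real (norm \<xi> powr (2 * a)) * fourier (\<lambda>x. of_real (bessel_potential \<tau> a g x)) \<xi>"
proof -
  have g: "integrable lborel g" using assms by (simp add: L1_Linf_def)
  note q = integrable_laplacian_weight[OF assms(1,2)] laplacian_weight_zero
  let ?c = "convolve (subordinated_kernel (laplacian_weight \<tau> a)) g"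
  have c: "integrable lborel ?c"
    by (rule convolution_integrable[OF subordinated_kernel_integrable[OF q] g])
  have "fourier (\<lambda>x. of_real (bessel_laplacian \<tau> a g x)) \<xi> = fourier (\<lambda>x. of_real (g x)) \<xi> + fourier (\<lambda>x. of_real (?c x)) \<xi>"
    unfolding fourier_cis bessel_laplacian_def of_real_add distrib_left
    by (subst Bochner_Integration.integral_add) (auto intro!: integrable_cis_mult integrable_of_real g c simp: scaleR_add_right)
  also have "fourier (\<lambda>x. of_real (?c x)) \<xi> = of_real (((norm \<xi>)\<^sup>2 / (\<tau> + (norm \<xi>)\<^sup>2)) powr a - 1) * fourier (\<lambda>x. of_real (g x)) \<xi>"
    unfolding fourier_convolution[OF subordinated_kernel_integrable[OF q] g] fourier_subordinated_kernel[OF q]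
    by (subst integral_laplacian_weight_exp) (use assms in auto)
  also have "((norm \<xi>)\<^sup>2 / (\<tau> + (norm \<xi>)\<^sup>2)) powr a = norm \<xi> powr (2 * a) * (\<tau> + (norm \<xi>)\<^sup>2) powr (- a)"
  proof -
    have "(norm \<xi>)\<^sup>2 = norm \<xi> powr 2" using assms by (simp add: powr_numeral)
    then have "((norm \<xi>)\<^sup>2) powr a = norm \<xi> powr (2 * a)" by (simp only: powr_powr)
    then show ?thesis using assms by (simp add: powr_divide powr_minus_divide)
  qed
  finally show ?thesis
    unfolding fourier_bessel_potential[OF assms(1-3)] by (simp add: algebra_simps)
qed

text \<open>
  For \<open>\<tau> = 0\<close> this also covers the symbol of the fractional Laplacian.
\<close>

lemma bessel_symbol_bound:
  assumes "0 < a" "0 \<le> \<tau>"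
  obtains C N where "\<And>\<xi>::'a::euclidean_space. (\<tau> + (norm \<xi>)\<^sup>2) powr a \<le> C * (1 + norm \<xi> ^ N)"
proof -
  let ?M = "nat \<lceil>a\<rceil>"
  have "(\<tau> + (norm \<xi>)\<^sup>2) powr a \<le> ((1 + \<tau>) ^ ?M * 2 ^ ?M) * (1 + norm \<xi> ^ (2 * ?M))" for \<xi> :: 'a
  proof -
    let ?r = "(norm \<xi>)\<^sup>2"
    have "(\<tau> + ?r) powr a \<le> (1 + \<tau> + ?r) powr a" using assms by (intro powr_mono2) auto
    also have "\<dots> \<le> (1 + \<tau> + ?r) powr real ?M" using assms by (intro powr_mono) auto
    also have "\<dots> = (1 + \<tau> + ?r) ^ ?M"
      using assms by (intro powr_realpow) (auto intro: add_pos_nonneg)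
    also have "\<dots> \<le> ((1 + \<tau>) * (2 * max 1 ?r)) ^ ?M"
    proof (rule power_mono)
      have "1 + ?r \<le> 2 * max 1 ?r" by auto
      then have "(1 + \<tau>) * (1 + ?r) \<le> (1 + \<tau>) * (2 * max 1 ?r)" using assms by (intro mult_left_mono) auto
      moreover have "1 + \<tau> + ?r \<le> (1 + \<tau>) * (1 + ?r)" using assms by (simp add: algebra_simps)
      ultimately show "1 + \<tau> + ?r \<le> (1 + \<tau>) * (2 * max 1 ?r)" by linarith
    qed (use assms in auto)
    also have "\<dots> = (1 + \<tau>) ^ ?M * 2 ^ ?M * (max 1 ?r) ^ ?M" by (simp add: power_mult_distrib)
    also have "\<dots> \<le> (1 + \<tau>) ^ ?M * 2 ^ ?M * (1 + norm \<xi> ^ (2 * ?M))"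
      using assms by (intro mult_left_mono) (auto simp: max_def power_mult)
    finally show ?thesis .
  qed
  then show ?thesis using that by blast
qed

text \<open>
  The multiplication formula moves the symbol onto the transform of the potential, where it
  cancels the factor \<open>(\<tau> + |\<xi>|\<^sup>2)\<close> to the power \<open>- a\<close>;
  moving the transform back and inverting it leaves \<open>g\<close>.
\<close>

lemma bessel_op_bessel_potential:
  fixes g :: "'a::euclidean_space \<Rightarrow> real"
  assumes "0 < a" "0 < \<tau>" "g \<in> L1_Linf"
  shows "represents g (bessel_op \<tau> a (regular_dist (bessel_potential \<tau> a g)))"
  unfolding represents_def
proof
  fix \<phi> :: "'a \<Rightarrow> complex" assume \<phi>: "\<phi> \<in> schwartz"
  let ?m = "\<lambda>\<xi>::'a. complex_of_real ((\<tau> + norm \<xi> ^ 2) powr a)"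
  let ?u = "\<lambda>x. complex_of_real (bessel_potential \<tau> a g x)"
  let ?g = "\<lambda>x. complex_of_real (g x)"
  have R: "rapidly_decreasing (inv_fourier \<phi>)" by (rule rapidly_decreasing_inv_fourier[OF \<phi>])
  obtain C N where CN: "\<And>\<xi>::'a. (\<tau> + (norm \<xi>)\<^sup>2) powr a \<le> C * (1 + norm \<xi> ^ N)"
    using bessel_symbol_bound assms(1,2) by (metis less_imp_le)
  have mi: "integrable lborel (\<lambda>\<xi>. ?m \<xi> * inv_fourier \<phi> \<xi>)"
    by (rule rapidly_decreasing_integrable, rule rapidly_decreasing_mult[OF R, of _ C N]) (use CN in auto)
  have ui: "integrable lborel ?u" and gi: "integrable lborel ?g"
    using bessel_potential_L1_Linf[OF assms] assms(3) by (auto simp: L1_Linf_def)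
  have "bessel_op \<tau> a (regular_dist (bessel_potential \<tau> a g)) \<phi> = (LINT x|lborel. ?u x * fourier (\<lambda>\<xi>. ?m \<xi> * inv_fourier \<phi> \<xi>) x)"
    by (simp add: bessel_op_def dist_inv_fourier_def dist_mult_def dist_fourier_def regular_dist_def)
  also have "\<dots> = (LINT \<xi>|lborel. fourier ?u \<xi> * (?m \<xi> * inv_fourier \<phi> \<xi>))"
    by (rule integral_mult_fourier_swap[OF ui mi])
  also have "\<dots> = (LINT \<xi>|lborel. fourier ?g \<xi> * inv_fourier \<phi> \<xi>)"
  proof (rule Bochner_Integration.integral_cong)
    fix \<xi> :: 'a
    have "0 < \<tau> + (norm \<xi>)\<^sup>2" using assms(2) by (simp add: add_pos_nonneg)
    then have "complex_of_real ((\<tau> + (norm \<xi>)\<^sup>2) powr (- a)) * ?m \<xi> = 1"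
      by (simp add: powr_add[symmetric] flip: of_real_mult)
    then show "fourier ?u \<xi> * (?m \<xi> * inv_fourier \<phi> \<xi>) = fourier ?g \<xi> * inv_fourier \<phi> \<xi>"
      unfolding fourier_bessel_potential[OF assms] by (metis mult.assoc mult.commute mult_1)
  qed simp
  also have "\<dots> = (LINT x|lborel. ?g x * fourier (inv_fourier \<phi>) x)"
    by (rule integral_mult_fourier_swap[OF gi rapidly_decreasing_integrable[OF R], symmetric])
  finally show "bessel_op \<tau> a (regular_dist (bessel_potential \<tau> a g)) \<phi> = regular_dist g \<phi>"
    by (simp add: regular_dist_def fourier_inv_fourier[OF \<phi>])
qed

lemma integral_mult_inv_fourier_swap:
  fixes f \<psi> :: "'a::euclidean_space \<Rightarrow> complex"
  assumes f: "integrable lborel f" and \<psi>: "integrable lborel \<psi>"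
  shows "(LINT x|lborel. f x * inv_fourier \<psi> x) = (LINT x|lborel. inv_fourier f x * \<psi> x)"
proof -
  have [measurable]: "f \<in> borel_measurable borel" "\<psi> \<in> borel_measurable borel" using f \<psi> by auto
  have refl: "inv_fourier \<psi> = fourier (\<lambda>x. \<psi> (- x))"
  proof
    fix x
    show "inv_fourier \<psi> x = fourier (\<lambda>x. \<psi> (- x)) x"
      using integral_reflect[of "\<lambda>y. cis (y \<bullet> x) * \<psi> y" 0]
      by (simp add: inv_fourier_eq_fourier fourier_cis)
  qed
  have "integrable lborel (\<lambda>x. \<psi> (- x))" using integrable_reflect[OF \<psi>, of 0] by simp
  then have "(LINT x|lborel. f x * inv_fourier \<psi> x) = (LINT x|lborel. fourier f x * \<psi> (- x))"
    unfolding refl by (rule integral_mult_fourier_swap[OF f])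
  also have "\<dots> = (LINT x|lborel. inv_fourier f x * \<psi> x)"
    using integral_reflect[of "\<lambda>y. inv_fourier f y * \<psi> y" 0]
    by (simp add: inv_fourier_eq_fourier)
  finally show ?thesis .
qed

text \<open>
  The same transfer of the symbol, with the transforms in the other order; the two transforms
  involved agree off the origin.
\<close>

lemma frac_laplacian_bessel_potential:
  fixes g :: "'a::euclidean_space \<Rightarrow> real"
  assumes "0 < a" "0 < \<tau>" "g \<in> L1_Linf"
  shows "represents (bessel_laplacian \<tau> a g) (frac_laplacian a (bessel_potential \<tau> a g))"
  unfolding represents_def
proof
  fix \<phi> :: "'a \<Rightarrow> complex" assume \<phi>: "\<phi> \<in> schwartz"
  let ?m = "\<lambda>\<xi>::'a. complex_of_real (norm \<xi> powr (2 * a))"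
  let ?u = "\<lambda>x. complex_of_real (bessel_potential \<tau> a g x)"
  let ?h = "\<lambda>x. complex_of_real (bessel_laplacian \<tau> a g x)"
  have R: "rapidly_decreasing (fourier \<phi>)" by (rule rapidly_decreasing_fourier[OF \<phi>])
  obtain C N where CN: "\<And>\<xi>::'a. (0 + (norm \<xi>)\<^sup>2) powr a \<le> C * (1 + norm \<xi> ^ N)"
    using bessel_symbol_bound[OF assms(1), of 0] by (metis order_refl)
  have "norm (?m \<xi>) \<le> C * (1 + norm \<xi> ^ N)" for \<xi>
  proof (cases "\<xi> = 0")
    case False
    then have "(norm \<xi>)\<^sup>2 = norm \<xi> powr 2" by (simp add: powr_numeral)
    then have "((norm \<xi>)\<^sup>2) powr a = norm \<xi> powr (2 * a)" by (simp only: powr_powr)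
    then show ?thesis using CN[of \<xi>] by simp
  qed (use CN[of 0] in simp)
  then have mi: "integrable lborel (\<lambda>\<xi>. ?m \<xi> * fourier \<phi> \<xi>)"
    by (intro rapidly_decreasing_integrable rapidly_decreasing_mult[OF R]) auto
  have ui: "integrable lborel ?u" and hi: "integrable lborel ?h"
    using bessel_potential_L1_Linf[OF assms] bessel_laplacian_L1_Linf[OF assms] by (auto simp: L1_Linf_def)
  have [measurable]: "?u \<in> borel_measurable borel" "?h \<in> borel_measurable borel" "fourier \<phi> \<in> borel_measurable borel"
    using ui hi R by (auto simp: rapidly_decreasing_def)
  have "frac_laplacian a (bessel_potential \<tau> a g) \<phi> = (LINT x|lborel. ?u x * inv_fourier (\<lambda>\<xi>. ?m \<xi> * fourier \<phi> \<xi>) x)"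
    by (simp add: frac_laplacian_def regular_dist_def frac_laplacian_schwartz_def)
  also have "\<dots> = (LINT \<xi>|lborel. inv_fourier ?u \<xi> * (?m \<xi> * fourier \<phi> \<xi>))"
    by (rule integral_mult_inv_fourier_swap[OF ui mi])
  also have "\<dots> = (LINT \<xi>|lborel. inv_fourier ?h \<xi> * fourier \<phi> \<xi>)"
  proof (rule integral_cong_AE)
    show "AE \<xi> in lborel. inv_fourier ?u \<xi> * (?m \<xi> * fourier \<phi> \<xi>) = inv_fourier ?h \<xi> * fourier \<phi> \<xi>"
      using AE_lborel_singleton[of "0::'a"]
    proof eventually_elim
      case (elim \<xi>)
      then show ?case
        using fourier_bessel_laplacian[OF assms, of "- \<xi>"] by (simp add: inv_fourier_eq_fourier)
    qed
  qed measurable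
  also have "\<dots> = (LINT x|lborel. ?h x * inv_fourier (fourier \<phi>) x)"
    by (rule integral_mult_inv_fourier_swap[OF hi rapidly_decreasing_integrable[OF R], symmetric])
  finally show "frac_laplacian a (bessel_potential \<tau> a g) \<phi> = regular_dist (bessel_laplacian \<tau> a g) \<phi>"
    by (simp add: regular_dist_def fourier_inversion[OF \<phi>])
qed

lemma bessel_potential_H_tilde:
  fixes g :: "'a::euclidean_space \<Rightarrow> real"
  assumes "0 < s" "0 < \<tau>" "1 < p" "g \<in> L1_Linf"
  shows "bessel_potential \<tau> (s / 2) g \<in> H_tilde s p"
proof -
  have "0 < s / 2" using assms by simp
  note * = this assms(2,4)
  show ?thesis
    using L1_Linf_Lp_space[OF bessel_potential_L1_Linf[OF *] assms(3)]
      L1_Linf_L_weighted[OF bessel_potential_L1_Linf[OF *]]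
      L1_Linf_Lp_space[OF bessel_laplacian_L1_Linf[OF *] assms(3)]
      frac_laplacian_bessel_potential[OF *]
    by (auto simp: H_tilde_def)
qed

lemma dist_Lp_norm_bessel_op_le:
  fixes g :: "'a::euclidean_space \<Rightarrow> real"
  assumes "0 < a" "0 < \<tau>" "1 < p" "g \<in> L1_Linf"
  shows "dist_Lp_norm p (bessel_op \<tau> a (regular_dist (bessel_potential \<tau> a g))) \<le> ennreal (Lp_norm p g)"
  unfolding dist_Lp_norm_def
  by (rule INF_lower) (use assms L1_Linf_Lp_space bessel_op_bessel_potential in auto)

section \<open>The Bessel kernel at the origin and the Adams functions\<close>

text \<open>
  The Gamma integral after the substitution \<open>t \<mapsto> 1 / t\<close>.
\<close>

lemma has_bochner_integral_inverse_Gamma: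
  fixes b c :: real
  assumes "0 < b" "0 < c"
  shows "has_bochner_integral lborel (\<lambda>t. indicator {0<..} t * (t powr (- b - 1) * exp (- c / t))) (Gamma b / c powr b)"
proof -
  let ?f = "\<lambda>t::real. t powr (b - 1) * exp (- c * t)"
  let ?h = "\<lambda>t::real. t powr (- b - 1) * exp (- c / t)"
  have int: "integrable lborel (\<lambda>t. indicator {0<..} t * ?f t)"
    and val: "(LINT t|lborel. indicator {0<..} t * ?f t) = Gamma b / c powr b"
    using has_bochner_integral_Gamma_scaled[OF assms] by (auto simp: has_bochner_integral_iff)
  have fs: "set_integrable lborel {0<..} ?f" using int by (simp add: set_integrable_def)
  have f: "?f absolutely_integrable_on {0<..}" "integral {0<..} ?f = Gamma b / c powr b"
  proof -
    have "integrable lebesgue (\<lambda>t. indicator {0<..} t *\<^sub>R ?f t)"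
      using int by (subst integrable_completion) auto
    then show "?f absolutely_integrable_on {0<..}" by (simp add: set_integrable_def)
    show "integral {0<..} ?f = Gamma b / c powr b"
      using set_borel_integral_eq_integral(2)[OF fs] val by (simp add: set_lebesgue_integral_def)
  qed
  have img: "(\<lambda>t::real. inverse t) ` {0<..} = {0<..}"
  proof -
    have "t \<in> inverse ` {0<..}" if "0 < t" for t :: real
      using that by (intro image_eqI[of _ _ "inverse t"]) auto
    then show ?thesis by auto
  qed
  let ?k = "\<lambda>t::real. \<bar>- (inverse t ^ Suc (Suc 0))\<bar> * ?f (inverse t)"
  have "?k absolutely_integrable_on {0<..} \<and> integral {0<..} ?k = Gamma b / c powr b \<longleftrightarrow>
      ?f absolutely_integrable_on inverse ` {0<..} \<and> integral (inverse ` {0<..}) ?f = Gamma b / c powr b"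
    by (rule has_absolute_integral_change_of_variables_1')
      (auto simp: inj_on_def intro!: DERIV_inverse[THEN DERIV_cong])
  then have k: "?k absolutely_integrable_on {0<..}" "integral {0<..} ?k = Gamma b / c powr b"
    unfolding img using f by blast+
  have kh: "?k t = ?h t" if "t \<in> {0<..}" for t
  proof -
    have "t powr (- b - 1) = t powr (- (b - 1)) * t powr (-2)"
    proof -
      have "- b - 1 = - (b - 1) + (- 2)" by simp
      then show ?thesis by (simp only: powr_add)
    qed
    moreover have "inverse t powr (b - 1) = t powr (- (b - 1))"
      using that by (simp only: powr_minus) (simp add: inverse_powr)
    ultimately show ?thesis
      using that by (simp add: powr_minus powr_numeral divide_inverse power2_eq_square mult_ac)
  qed
  have "?k absolutely_integrable_on {0<..} \<longleftrightarrow> ?h absolutely_integrable_on {0<..}"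
    by (rule set_integrable_cong) (simp_all only: kh)
  then have h1: "?h absolutely_integrable_on {0<..}"
    using k(1) by (rule iffD1)
  have "integral {0<..} ?k = integral {0<..} ?h"
    by (rule Henstock_Kurzweil_Integration.integral_cong) (simp only: kh)
  then have h2: "integral {0<..} ?h = Gamma b / c powr b"
    using k(2) by (simp only:)
  have "integrable lborel (\<lambda>t. indicator {0<..} t *\<^sub>R ?h t)"
    using h1 unfolding set_integrable_def by (subst (asm) integrable_completion) auto
  then have hs: "set_integrable lborel {0<..} ?h" by (simp add: set_integrable_def)
  then show ?thesis
    using set_borel_integral_eq_integral(2)[OF hs] h2
    by (simp add: has_bochner_integral_iff set_lebesgue_integral_def set_integrable_def)
qed

text \<open>
  The constant in the kernel \<open>riesz_const * norm x powr (2 * a - n)\<close> of the Riesz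
  potential \<open>(-\<Delta>)\<^sup>-\<^sup>a\<close>; its reciprocal at \<open>a = n / (2 *
  p)\<close> is the base of the power in \<open>alpha\<close>.
\<close>

definition riesz_const :: "'a::euclidean_space itself \<Rightarrow> real \<Rightarrow> real" where
  "riesz_const _ a = Gamma (real DIM('a) / 2 - a) / (Gamma a * 4 powr a * pi powr (real DIM('a) / 2))"

lemma riesz_const_pos: "0 < a \<Longrightarrow> 2 * a < real DIM('a) \<Longrightarrow> 0 < riesz_const TYPE('a::euclidean_space) a"
  by (simp add: riesz_const_def Gamma_real_pos)

lemma has_bochner_integral_riesz:
  fixes x :: "'a::euclidean_space"
  assumes a: "0 < a" "2 * a < real DIM('a)" and x: "x \<noteq> 0"
  shows "has_bochner_integral lborel (\<lambda>t. indicator {0<..} t * (t powr (a - 1) * heat t x))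
    (Gamma a * riesz_const TYPE('a) a * norm x powr (2 * a - real DIM('a)))"
proof -
  let ?n = "real DIM('a)"
  let ?b = "?n / 2 - a" and ?c = "(norm x)\<^sup>2 / 4"
  have "has_bochner_integral lborel (\<lambda>t. (4 * pi) powr (- ?n / 2) * (indicator {0<..} t * (t powr (- ?b - 1) * exp (- ?c / t))))
     ((4 * pi) powr (- ?n / 2) * (Gamma ?b / ?c powr ?b))"
    using a x by (intro has_bochner_integral_mult_right has_bochner_integral_inverse_Gamma) auto
  moreover have "(4 * pi) powr (- ?n / 2) * (indicator {0<..} t * (t powr (- ?b - 1) * exp (- ?c / t)))
     = indicator {0<..} t * (t powr (a - 1) * heat t x)" for t
  proof (cases "0 < t")
    case True
    have "t powr (- ?b - 1) = t powr (a - 1) * t powr (- ?n / 2)"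
      unfolding powr_add[symmetric] by (simp add: algebra_simps)
    moreover have "(4 * pi * t) powr (- ?n / 2) = (4 * pi) powr (- ?n / 2) * t powr (- ?n / 2)"
      using True by (intro powr_mult) 
    moreover have "- ?c / t = - (norm x)\<^sup>2 / (4 * t)" by simp
    ultimately show ?thesis unfolding heat_def by (simp only: mult_ac)
  qed simp
  moreover have "(4 * pi) powr (- ?n / 2) * (Gamma ?b / ?c powr ?b) = Gamma a * riesz_const TYPE('a) a * norm x powr (2 * a - ?n)"
  proof -
    have N: "((norm x)\<^sup>2) powr ?b = norm x powr (2 * ?b)"
    proof -
      have "(norm x)\<^sup>2 = norm x powr 2" using x by (simp add: powr_numeral)
      then show ?thesis by (simp only: powr_powr)
    qed
    have "?c powr ?b = norm x powr (2 * ?b) / 4 powr ?b"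
      by (simp add: powr_divide N)
    moreover have "norm x powr (2 * a - ?n) = inverse (norm x powr (2 * ?b))"
      unfolding powr_minus[symmetric] by (simp add: algebra_simps)
    moreover have "4 powr ?b = 4 powr (?n / 2) / (4::real) powr a" by (rule powr_diff)
    moreover have "(4 * pi) powr (- ?n / 2) = inverse (4 powr (?n / 2) * pi powr (?n / 2))"
      by (simp add: powr_minus powr_mult)
    moreover have "inverse (F * P) * (g / (N / (F / A))) = h * (g / (h * A * P)) * inverse N"
      if "F \<noteq> 0" "P \<noteq> 0" "N \<noteq> 0" "A \<noteq> 0" "h \<noteq> 0" for F P N A g h :: real
      using that by (simp add: field_simps)
    moreover have "Gamma a \<noteq> 0" using Gamma_real_pos[OF a(1)] by simp
    ultimately show ?thesis using x
      unfolding riesz_const_def by simp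
  qed
  ultimately show ?thesis by (simp only:)
qed

lemma exp_minus_ge_one_minus_powr:
  fixes y e :: real
  assumes "0 \<le> y" "0 < e" "e \<le> 1"
  shows "1 - y powr e \<le> exp (- y)"
proof (cases "y \<le> 1")
  case True
  have "y \<le> y powr e"
  proof (cases "y = 0")
    case False
    then show ?thesis using powr_mono'[of e 1 y] assms True by simp
  qed simp
  then show ?thesis using exp_ge_add_one_self[of "- y"] by linarith
next
  case False
  then have "1 \<le> y powr e" using assms by (intro ge_one_powr_ge_zero) auto
  then show ?thesis using exp_gt_zero[of "- y"] by linarith
qed

text \<open>
  The Bessel kernel is the Riesz kernel with an additional factor \<open>exp (- \<tau>
  t)\<close> in the time integral. Replacing this factor by \<open>1 - (\<tau> t)\<close> to the
  power \<open>e\<close> leaves two Riesz kernels, of orders \<open>a\<close> and \<open>a +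
  e\<close>. The linear bound \<open>1 - \<tau> t\<close> would not do in general: the integral
  of order \<open>a + 1\<close> diverges when \<open>2 (a + 1)\<close> is at least the
  dimension, hence the exponent \<open>e\<close>.
\<close>

lemma bessel_kernel_lower_bound:
  fixes x :: "'a::euclidean_space"
  assumes a: "0 < a" and \<tau>: "0 < \<tau>" and e: "0 < e" "e \<le> 1" "2 * (a + e) < real DIM('a)" and x: "x \<noteq> 0"
  shows "riesz_const TYPE('a) a * norm x powr (2 * a - real DIM('a))
      - \<tau> powr e * Gamma (a + e) / Gamma a * riesz_const TYPE('a) (a + e) * norm x powr (2 * (a + e) - real DIM('a))
    \<le> subordinated_kernel (bessel_weight \<tau> a) x"
proof -
  let ?R = "\<lambda>b t. indicator {0<..} t * (t powr (b - 1) * heat t x)"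
  have G: "0 < Gamma a" using a by (simp add: Gamma_real_pos)
  have 1: "has_bochner_integral lborel (?R a) (Gamma a * riesz_const TYPE('a) a * norm x powr (2 * a - real DIM('a)))"
    using a e x by (intro has_bochner_integral_riesz) auto
  have 2: "has_bochner_integral lborel (?R (a + e)) (Gamma (a + e) * riesz_const TYPE('a) (a + e) * norm x powr (2 * (a + e) - real DIM('a)))"
    using a e x by (intro has_bochner_integral_riesz) auto
  have B: "integrable lborel (\<lambda>t. bessel_weight \<tau> a t * heat t x)"
  proof (rule Bochner_Integration.integrable_bound)
    show "integrable lborel (\<lambda>t. inverse (Gamma a) * ?R a t)"
      using 1 by (intro integrable_mult_right) (simp add: has_bochner_integral_iff)
    have "\<bar>bessel_weight \<tau> a t * heat t x\<bar> \<le> inverse (Gamma a) * ?R a t" for t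
    proof (cases "0 < t")
      case True
      have "\<bar>bessel_weight \<tau> a t * heat t x\<bar> = bessel_weight \<tau> a t * heat t x"
        using bessel_weight_nonneg[OF a] by simp
      also have "\<dots> = inverse (Gamma a) * (t powr (a - 1) * exp (- \<tau> * t) * heat t x)"
        using True by (simp add: bessel_weight_def divide_inverse)
      also have "\<dots> \<le> inverse (Gamma a) * (t powr (a - 1) * 1 * heat t x)"
        using True \<tau> G by (intro mult_left_mono mult_right_mono) auto
      finally show ?thesis using True by simp
    qed (simp add: bessel_weight_def)
    then show "AE t in lborel. norm (bessel_weight \<tau> a t * heat t x) \<le> norm (inverse (Gamma a) * ?R a t)"
      unfolding real_norm_def by (intro always_eventually allI order_trans[OF _ abs_ge_self])
  qed measurable
  have "(LINT t|lborel. inverse (Gamma a) * (?R a t - \<tau> powr e * ?R (a + e) t)) \<le> (LINT t|lborel. bessel_weight \<tau> a t * heat t x)"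
  proof (rule integral_mono[OF _ B])
    show "integrable lborel (\<lambda>t. inverse (Gamma a) * (?R a t - \<tau> powr e * ?R (a + e) t))"
      using 1 2 by (intro integrable_mult_right Bochner_Integration.integrable_diff) (simp_all add: has_bochner_integral_iff)
    fix t
    show "inverse (Gamma a) * (?R a t - \<tau> powr e * ?R (a + e) t) \<le> bessel_weight \<tau> a t * heat t x"
    proof (cases "0 < t")
      case True
      have "t powr (a + e - 1) = t powr (a - 1) * t powr e"
        unfolding powr_add[symmetric] by (simp add: algebra_simps)
      moreover have "(\<tau> * t) powr e = \<tau> powr e * t powr e" using True \<tau> by (intro powr_mult)
      ultimately have "?R a t - \<tau> powr e * ?R (a + e) t = t powr (a - 1) * (1 - (\<tau> * t) powr e) * heat t x"
        using True by (simp add: algebra_simps)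
      also have "\<dots> \<le> t powr (a - 1) * exp (- (\<tau> * t)) * heat t x"
        using True \<tau> e by (intro mult_right_mono mult_left_mono exp_minus_ge_one_minus_powr) auto
      finally have "inverse (Gamma a) * (?R a t - \<tau> powr e * ?R (a + e) t)
          \<le> inverse (Gamma a) * (t powr (a - 1) * exp (- (\<tau> * t)) * heat t x)"
        using G by (intro mult_left_mono) auto
      also have "\<dots> = bessel_weight \<tau> a t * heat t x"
        using True by (simp add: bessel_weight_def divide_inverse)
      finally show ?thesis .
    qed (simp add: bessel_weight_def)
  qed
  moreover have "(LINT t|lborel. inverse (Gamma a) * (?R a t - \<tau> powr e * ?R (a + e) t))
      = inverse (Gamma a) * (Gamma a * riesz_const TYPE('a) a * norm x powr (2 * a - real DIM('a))
        - \<tau> powr e * (Gamma (a + e) * riesz_const TYPE('a) (a + e) * norm x powr (2 * (a + e) - real DIM('a))))"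
    using has_bochner_integral_integral_eq[OF has_bochner_integral_mult_right[OF
      has_bochner_integral_diff[OF 1 has_bochner_integral_mult_right[OF 2]]]]
    by blast
  moreover have "\<dots> = riesz_const TYPE('a) a * norm x powr (2 * a - real DIM('a))
      - \<tau> powr e * Gamma (a + e) / Gamma a * riesz_const TYPE('a) (a + e) * norm x powr (2 * (a + e) - real DIM('a))"
    using G by (simp add: field_simps)
  ultimately show ?thesis by (simp only: subordinated_kernel_def)
qed

lemma one_plus_powr_minus_ge:
  fixes t m :: real
  assumes "0 \<le> t" "0 \<le> m"
  shows "1 - m * t \<le> (1 + t) powr (- m)"
proof -
  have "m * ln (1 + t) \<le> m * t" using assms ln_add_one_self_le_self[of t] by (intro mult_left_mono) auto
  then have "1 - m * t \<le> 1 + (- m * ln (1 + t))" by simp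
  also have "\<dots> \<le> exp (- m * ln (1 + t))" by (rule exp_ge_add_one_self)
  also have "\<dots> = (1 + t) powr (- m)" using assms by (simp add: powr_def)
  finally show ?thesis .
qed

text \<open>
  The exponent \<open>- n / p\<close> makes the \<open>p\<close>-th power homogeneous of degree
  \<open>- n\<close>, so its integral over the annulus is the logarithm by which the function is
  normalised.
\<close>

definition adams :: "real \<Rightarrow> real \<Rightarrow> 'a::euclidean_space \<Rightarrow> 'a \<Rightarrow> real" where
  "adams p \<epsilon> x\<^sub>0 x = (sphere_area TYPE('a) * ln (1 / \<epsilon>)) powr (- 1 / p) *
     (norm (x - x\<^sub>0) powr (- real DIM('a) / p) * indicator {\<epsilon><..<1} (norm (x - x\<^sub>0)))"

lemma has_bochner_integral_annulus_powr:
  assumes "0 < \<epsilon>" "\<epsilon> < 1" "q \<noteq> 0"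
  shows "has_bochner_integral lborel
     (\<lambda>x::'a::euclidean_space. norm x powr (q - real DIM('a)) * indicator {\<epsilon><..<1} (norm x))
     (sphere_area TYPE('a) * (1 / q - \<epsilon> powr q / q))"
proof -
  have "((\<lambda>r. r powr q / q) has_real_derivative r powr (q - 1)) (at r)" if "0 < r" for r
    using DERIV_cdivide[OF has_real_derivative_powr[OF that], of q q] assms by simp
  from has_bochner_integral_annulus[OF assms(1) less_imp_le[OF assms(2)] this]
  show ?thesis by simp
qed

lemma has_bochner_integral_annulus_log:
  assumes "0 < \<epsilon>" "\<epsilon> < 1"
  shows "has_bochner_integral lborel
     (\<lambda>x::'a::euclidean_space. norm x powr (- real DIM('a)) * indicator {\<epsilon><..<1} (norm x))
     (sphere_area TYPE('a) * ln (1 / \<epsilon>))"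
proof -
  have "(ln has_real_derivative r powr (0 - 1)) (at r)" if "0 < r" for r :: real
    using DERIV_ln[OF that] that by (simp add: powr_minus)
  from has_bochner_integral_annulus[OF assms(1) less_imp_le[OF assms(2)] this, where 'a='a]
  show ?thesis using assms by (simp add: ln_div)
qed

lemma adams_L1_Linf:
  fixes x\<^sub>0 :: "'a::euclidean_space"
  assumes "0 < \<epsilon>" "\<epsilon> < 1" "1 < p"
  shows "adams p \<epsilon> x\<^sub>0 \<in> L1_Linf"
proof -
  let ?n = "real DIM('a)"
  let ?c = "(sphere_area TYPE('a) * ln (1 / \<epsilon>)) powr (- 1 / p)"
  have "?n - ?n / p \<noteq> 0" using assms by (simp add: field_simps)
  from has_bochner_integral_annulus_powr[OF assms(1,2) this, where 'a='a]
  have "integrable lborel (\<lambda>x::'a. norm x powr (- ?n / p) * indicator {\<epsilon><..<1} (norm x))"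
    by (simp add: has_bochner_integral_iff)
  from integrable_mult_right[OF integrable_translate[OF this, of "- x\<^sub>0"], of ?c]
  have "integrable lborel (adams p \<epsilon> x\<^sub>0)" by (simp add: adams_def[abs_def])
  moreover have "\<bar>adams p \<epsilon> x\<^sub>0 x\<bar> \<le> ?c * \<epsilon> powr (- ?n / p)" for x
  proof -
    have "norm (x - x\<^sub>0) powr (- ?n / p) * indicator {\<epsilon><..<1} (norm (x - x\<^sub>0)) \<le> \<epsilon> powr (- ?n / p)"
      using assms by (auto simp: indicator_def intro!: powr_mono2')
    then show ?thesis unfolding adams_def by (simp add: abs_mult mult_left_mono)
  qed
  ultimately show ?thesis by (auto simp: L1_Linf_def)
qed

lemma Lp_norm_adams:
  fixes x\<^sub>0 :: "'a::euclidean_space"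
  assumes "0 < \<epsilon>" "\<epsilon> < 1" "1 < p"
  shows "Lp_norm p (adams p \<epsilon> x\<^sub>0) = 1"
proof -
  let ?n = "real DIM('a)"
  let ?X = "sphere_area TYPE('a) * ln (1 / \<epsilon>)"
  have X: "0 < ?X" using assms sphere_area_pos[where 'a='a] by simp
  let ?h = "\<lambda>x::'a. ?X powr (- 1) * (norm x powr (- ?n) * indicator {\<epsilon><..<1} (norm x))"
  have "\<bar>adams p \<epsilon> x\<^sub>0 x\<bar> powr p = ?h (x + (- x\<^sub>0))" for x
    using assms by (auto simp: adams_def indicator_def powr_mult powr_powr abs_mult)
  then have "(LINT x|lborel. \<bar>adams p \<epsilon> x\<^sub>0 x\<bar> powr p) = (LINT x|lborel. ?h (x + (- x\<^sub>0)))" by (simp only:)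
  also have "\<dots> = (LINT x|lborel. ?h x)" by (rule integral_translate) measurable
  also have "\<dots> = ?X powr (- 1) * ?X"
    using has_bochner_integral_annulus_log[OF assms(1,2), where 'a='a]
    by (simp only: integral_mult_right_zero has_bochner_integral_iff)
  also have "\<dots> = 1"
    using X powr_minus[of ?X 1] by (simp only: powr_one less_imp_le left_inverse)
  finally show ?thesis by (simp add: Lp_norm_def)
qed

section \<open>Concentration and blow-up\<close>

lemma bessel_potential_adams_eq:
  fixes x\<^sub>0 z :: "'a::euclidean_space"
  assumes "0 < \<epsilon>" "\<epsilon> < 1" "1 < p" "0 < a" "0 < \<tau>"
  defines "F \<equiv> \<lambda>w::'a. subordinated_kernel (bessel_weight \<tau> a) (z - w) * adams p \<epsilon> 0 w"
  shows "integrable lborel F" and "bessel_potential \<tau> a (adams p \<epsilon> x\<^sub>0) (x\<^sub>0 + z) = (LINT w|lborel. F w)"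
proof -
  let ?G = "subordinated_kernel (bessel_weight \<tau> a) :: 'a \<Rightarrow> real"
  define f where "f y = ?G y * adams p \<epsilon> x\<^sub>0 (x\<^sub>0 + z - y)" for y
  have G: "integrable lborel ?G"
    by (intro subordinated_kernel_integrable integrable_bessel_weight bessel_weight_zero assms)
  have f: "integrable lborel f"
    unfolding f_def by (rule convolution_integrand_integrable[OF G adams_L1_Linf]) (use assms in auto)
  have F: "F = (\<lambda>w. f (z - w))"
    by (simp add: F_def f_def adams_def fun_eq_iff)
  show "integrable lborel F" unfolding F by (rule integrable_reflect[OF f])
  have "bessel_potential \<tau> a (adams p \<epsilon> x\<^sub>0) (x\<^sub>0 + z) = (LINT y|lborel. f y)"
    by (simp add: bessel_potential_def convolve_def f_def)
  also have "\<dots> = (LINT w|lborel. F w)"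
    unfolding F by (rule integral_reflect[symmetric]) (use f in auto)
  finally show "bessel_potential \<tau> a (adams p \<epsilon> x\<^sub>0) (x\<^sub>0 + z) = (LINT w|lborel. F w)" .
qed

text \<open>
  At \<open>z\<close> with \<open>|z| \<le> \<epsilon> / 2\<close> and for \<open>|w| >
  \<epsilon>\<close> one has \<open>|z - w| \<le> |w| + \<epsilon>\<close> and \<open>|z - w|
  \<ge> |w| / 2\<close>. The first bound makes the leading part of the kernel at \<open>z -
  w\<close> at least \<open>1 - (n - s) \<epsilon> / |w|\<close> times its value at
  \<open>w\<close>, where \<open>s = n / p\<close>; against the Adams function the correction
  integrates to a bounded quantity because \<open>\<epsilon> |w|\<close> to the power \<open>- n
  - 1\<close> does over \<open>|w| > \<epsilon>\<close>. The second bound controls the error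
  part of the kernel by a multiple of its value at \<open>w\<close>, and its contribution
  converges at the origin.
\<close>

lemma bessel_potential_adams_lower_bound:
  fixes p \<tau> :: real
  assumes p: "1 < p" and \<tau>: "0 < \<tau>"
  defines "a \<equiv> real DIM('a::euclidean_space) / (2 * p)"
  obtains D where "0 \<le> D" and "\<And>\<epsilon> (x\<^sub>0::'a) z. 0 < \<epsilon> \<Longrightarrow> \<epsilon> < 1 \<Longrightarrow> norm z \<le> \<epsilon> / 2 \<Longrightarrow>
     riesz_const TYPE('a) a * (sphere_area TYPE('a) * ln (1 / \<epsilon>)) powr (- 1 / p)
       * (sphere_area TYPE('a) * ln (1 / \<epsilon>) - D)
     \<le> bessel_potential \<tau> a (adams p \<epsilon> x\<^sub>0) (x\<^sub>0 + z)"
proof -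
  let ?n = "real DIM('a)"
  let ?\<omega> = "sphere_area TYPE('a)"
  let ?\<gamma> = "riesz_const TYPE('a) a"
  define s where "s = 2 * a"
  have \<omega>: "0 < ?\<omega>" by (rule sphere_area_pos)
  have a: "0 < a" "2 * a < ?n" using p by (auto simp: a_def field_simps)
  have s: "s = ?n / p" "s < ?n" using a by (auto simp: s_def a_def)
  have \<gamma>: "0 < ?\<gamma>" using a by (rule riesz_const_pos)
  \<comment> \<open>any positive \<open>e \<le> 1\<close> with \<open>2 (a + e) < n\<close> would do\<close>
  define e where "e = min 1 ((?n - 2 * a) / 4)"
  have e: "0 < e" "e \<le> 1" "2 * (a + e) < ?n" using a by (auto simp: e_def min_def field_simps)
  define \<delta> where "\<delta> = 2 * e"
  have \<delta>: "0 < \<delta>" "s + \<delta> < ?n" using e by (auto simp: \<delta>_def s_def)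
  define C where "C = \<tau> powr e * Gamma (a + e) / Gamma a * riesz_const TYPE('a) (a + e)"
  have C: "0 \<le> C"
    using a e riesz_const_pos[of "a + e", where 'a='a] Gamma_real_pos[of a] Gamma_real_pos[of "a + e"]
    by (auto simp: C_def)
  \<comment> \<open>the power of \<open>1 / 2\<close> comes from \<open>|z - w| \<ge> |w| / 2\<close>\<close>
  define C' where "C' = C * (1 / 2) powr (s + \<delta> - ?n)"
  have C': "0 \<le> C'" using C by (simp add: C'_def)
  define D where "D = (?n - s) * ?\<omega> + C' * ?\<omega> / (\<delta> * ?\<gamma>)"
  have "0 \<le> D" using s C' \<omega> \<gamma> \<delta> by (auto simp: D_def intro!: add_nonneg_nonneg)
  moreover have "?\<gamma> * (?\<omega> * ln (1 / \<epsilon>)) powr (- 1 / p) * (?\<omega> * ln (1 / \<epsilon>) - D)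
     \<le> bessel_potential \<tau> a (adams p \<epsilon> x\<^sub>0) (x\<^sub>0 + z)"
    if \<epsilon>: "0 < \<epsilon>" "\<epsilon> < 1" and z: "norm z \<le> \<epsilon> / 2" for \<epsilon> and x\<^sub>0 z :: 'a
  proof -
    let ?I = "\<lambda>w::'a. indicator {\<epsilon><..<1} (norm w) :: real"
    let ?G = "subordinated_kernel (bessel_weight \<tau> a) :: 'a \<Rightarrow> real"
    let ?c = "(?\<omega> * ln (1 / \<epsilon>)) powr (- 1 / p)"
    define L where "L = ?\<omega> * ln (1 / \<epsilon>)"
    \<comment> \<open>a radial minorant of the integrand, before multiplication by the normalising constant\<close>
    define H where "H w = ?\<gamma> * (norm w powr (- ?n) * ?I w) - ?\<gamma> * (?n - s) * \<epsilon> * (norm w powr (- 1 - ?n) * ?I w)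
       - C' * (norm w powr (\<delta> - ?n) * ?I w)" for w :: 'a
    have H: "has_bochner_integral lborel H
      (?\<gamma> * L - ?\<gamma> * (?n - s) * \<epsilon> * (?\<omega> * (1 / (- 1) - \<epsilon> powr (- 1) / (- 1))) - C' * (?\<omega> * (1 / \<delta> - \<epsilon> powr \<delta> / \<delta>)))"
      unfolding H_def[abs_def] L_def using \<epsilon> \<delta>
      by (intro has_bochner_integral_diff has_bochner_integral_mult_right has_bochner_integral_annulus_log
          has_bochner_integral_annulus_powr) auto
    \<comment> \<open>off the annulus both sides vanish; on it, \<open>H\<close> is the minorant of the
        kernel times \<open>r powr (- s)\<close>\<close>
    have pointwise: "?c * H w \<le> ?G (z - w) * adams p \<epsilon> 0 w" for w
    proof (cases "norm w \<in> {\<epsilon><..<1}")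
      case True
      define r where "r = norm w"
      have r: "\<epsilon> < r" "r < 1" "0 < r" using True \<epsilon> by (auto simp: r_def)
      have zw1: "norm (z - w) \<le> r + \<epsilon>" using norm_triangle_ineq4[of z w] z \<epsilon> by (simp add: r_def)
      have zw2: "r / 2 \<le> norm (z - w)" using norm_triangle_ineq2[of w z] z r by (simp add: r_def norm_minus_commute)
      then have zw0: "0 < norm (z - w)" "z - w \<noteq> 0" using r by auto
      have "?\<gamma> * (r powr (s - ?n) * (1 - (?n - s) * (\<epsilon> / r))) \<le> ?\<gamma> * norm (z - w) powr (s - ?n)"
      proof (rule mult_left_mono)
        have "r powr (s - ?n) * (1 - (?n - s) * (\<epsilon> / r)) \<le> r powr (s - ?n) * (1 + \<epsilon> / r) powr (- (?n - s))"
          using r \<epsilon> s by (intro mult_left_mono one_plus_powr_minus_ge) auto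
        also have "\<dots> = (r * (1 + \<epsilon> / r)) powr (s - ?n)"
          using r \<epsilon> by (simp add: powr_mult)
        also have "r * (1 + \<epsilon> / r) = r + \<epsilon>" using r by (simp add: field_simps)
        also have "(r + \<epsilon>) powr (s - ?n) \<le> norm (z - w) powr (s - ?n)"
          using zw0 zw1 s by (intro powr_mono2') auto
        finally show "r powr (s - ?n) * (1 - (?n - s) * (\<epsilon> / r)) \<le> norm (z - w) powr (s - ?n)" .
      qed (use \<gamma> in auto)
      moreover have "C * norm (z - w) powr (s + \<delta> - ?n) \<le> C' * r powr (s + \<delta> - ?n)"
      proof -
        have "norm (z - w) powr (s + \<delta> - ?n) \<le> (1 / 2 * r) powr (s + \<delta> - ?n)"
          using zw2 r \<delta> by (intro powr_mono2') auto
        also have "\<dots> = (1 / 2) powr (s + \<delta> - ?n) * r powr (s + \<delta> - ?n)"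
          by (rule powr_mult)
        finally show ?thesis unfolding C'_def using C by (simp add: mult.assoc mult_left_mono)
      qed
      moreover have "?\<gamma> * norm (z - w) powr (s - ?n) - C * norm (z - w) powr (s + \<delta> - ?n) \<le> ?G (z - w)"
        using bessel_kernel_lower_bound[OF a(1) \<tau> e zw0(2)]
        by (simp add: C_def s_def \<delta>_def)
      ultimately have "?\<gamma> * (r powr (s - ?n) * (1 - (?n - s) * (\<epsilon> / r))) - C' * r powr (s + \<delta> - ?n) \<le> ?G (z - w)"
        by linarith
      then have "(?\<gamma> * (r powr (s - ?n) * (1 - (?n - s) * (\<epsilon> / r))) - C' * r powr (s + \<delta> - ?n)) * r powr (- s) \<le> ?G (z - w) * r powr (- s)"
        by (rule mult_right_mono) simp
      also have "(?\<gamma> * (r powr (s - ?n) * (1 - (?n - s) * (\<epsilon> / r))) - C' * r powr (s + \<delta> - ?n)) * r powr (- s) = H w"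
      proof -
        have "r powr (- ?n) = r powr (s - ?n) * r powr (- s)" by (simp add: powr_add[symmetric])
        moreover have "r powr (\<delta> - ?n) = r powr (s + \<delta> - ?n) * r powr (- s)" by (simp add: powr_add[symmetric])
        moreover have "r powr (- 1 - ?n) = r powr (- ?n) / r"
        proof -
          have "- 1 - ?n = - ?n - 1" by simp
          then show ?thesis using r by (simp only: powr_diff) simp
        qed
        ultimately show ?thesis
          using True by (simp add: H_def r_def[symmetric] algebra_simps)
      qed
      finally have "?c * H w \<le> ?c * (?G (z - w) * r powr (- s))"
        by (rule mult_left_mono) simp
      then show ?thesis
        using True by (simp add: adams_def r_def s(1) mult_ac)
    qed (simp add: H_def adams_def)
    have "?c * (?\<gamma> * (L - D)) \<le> ?c * (LINT w|lborel. H w)"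
    proof (rule mult_left_mono)
      have "?\<gamma> * (?n - s) * \<epsilon> * (?\<omega> * (1 / (- 1) - \<epsilon> powr (- 1) / (- 1))) = ?\<gamma> * (?n - s) * ?\<omega> * (1 - \<epsilon>)"
        using \<epsilon> by (simp add: powr_minus field_simps)
      also have "\<dots> \<le> ?\<gamma> * (?n - s) * ?\<omega> * 1"
        using \<epsilon> \<gamma> \<omega> s by (intro mult_left_mono) auto
      finally have 1: "?\<gamma> * (?n - s) * \<epsilon> * (?\<omega> * (1 / (- 1) - \<epsilon> powr (- 1) / (- 1))) \<le> ?\<gamma> * (?n - s) * ?\<omega>" by simp
      have 2: "C' * (?\<omega> * (1 / \<delta> - \<epsilon> powr \<delta> / \<delta>)) \<le> C' * (?\<omega> * (1 / \<delta>))"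
        using C' \<omega> \<delta> by (intro mult_left_mono) auto
      have "?\<gamma> * D = ?\<gamma> * (?n - s) * ?\<omega> + C' * (?\<omega> * (1 / \<delta>))"
        using \<gamma> by (simp add: D_def field_simps)
      with 1 2 have "?\<gamma> * (L - D) \<le> ?\<gamma> * L - ?\<gamma> * (?n - s) * \<epsilon> * (?\<omega> * (1 / (- 1) - \<epsilon> powr (- 1) / (- 1)))
          - C' * (?\<omega> * (1 / \<delta> - \<epsilon> powr \<delta> / \<delta>))"
        unfolding right_diff_distrib by linarith
      then show "?\<gamma> * (L - D) \<le> (LINT w|lborel. H w)"
        using has_bochner_integral_integral_eq[OF H] by simp
    qed simp
    also have "\<dots> = (LINT w|lborel. ?c * H w)" by simp
    also have "\<dots> \<le> (LINT w|lborel. ?G (z - w) * adams p \<epsilon> 0 w)"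
      using H bessel_potential_adams_eq(1)[OF \<epsilon> p a(1) \<tau>] pointwise
      by (intro integral_mono) (auto simp: has_bochner_integral_iff)
    also have "\<dots> = bessel_potential \<tau> a (adams p \<epsilon> x\<^sub>0) (x\<^sub>0 + z)"
      by (rule bessel_potential_adams_eq(2)[OF \<epsilon> p a(1) \<tau>, symmetric])
    finally show ?thesis by (simp add: L_def mult_ac)
  qed
  ultimately show ?thesis using that by blast
qed

text \<open>
  Bernoulli's inequality for real exponents, from Young's inequality with one factor equal to
  \<open>1\<close>.
\<close>

lemma one_minus_powr_ge:
  fixes t q :: real
  assumes "t \<le> 1" "1 < q"
  shows "1 - q * t \<le> (1 - t) powr q"
proof -
  have "(1 - t) * 1 \<le> (1 - t) powr q / q + 1 powr (conj_exp q) / conj_exp q"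
    by (rule Youngs_inequality) (use assms in \<open>auto simp: conj_exp_def field_simps\<close>)
  then have "q * 1 \<le> q * (q * t + (1 - t) powr q)"
    using assms by (simp add: conj_exp_def field_simps)
  then have "1 \<le> q * t + (1 - t) powr q"
    using assms by (subst (asm) mult_le_cancel_left_pos) auto
  then show ?thesis by simp
qed

text \<open>
  With \<open>q = conj_exp p\<close>, the powers of \<open>X\<close> combine to \<open>X\<close>
  since \<open>q - q / p = 1\<close>, and the definition of \<open>alpha\<close> cancels the
  power of the Riesz constant.
\<close>

lemma adams_exponent_bound:
  fixes p X D :: real
  assumes p: "1 < p" and X: "0 < X" "D \<le> X" "0 \<le> D"
    and u: "riesz_const TYPE('a::euclidean_space) (real DIM('a) / (2 * p)) * X powr (- 1 / p) * (X - D) \<le> u"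
  shows "real DIM('a) / sphere_area TYPE('a) * (X - conj_exp p * D) \<le> alpha TYPE('a) p * u powr conj_exp p"
proof -
  let ?n = "real DIM('a)" and ?\<omega> = "sphere_area TYPE('a)"
  let ?q = "conj_exp p"
  define \<gamma> where "\<gamma> = riesz_const TYPE('a) (?n / (2 * p))"
  have \<gamma>: "0 < \<gamma>" unfolding \<gamma>_def using p by (intro riesz_const_pos) (auto simp: field_simps)
  have q: "1 < ?q" using p by (simp add: conj_exp_def field_simps)
  have \<omega>: "0 < ?\<omega>" by (rule sphere_area_pos)
  have \<alpha>: "alpha TYPE('a) p = ?n / ?\<omega> * \<gamma> powr (- ?q)"
  proof -
    have "(?n * p - ?n) / (2 * p) = ?n / 2 - ?n / (2 * p)" using p by (simp add: field_simps)
    moreover have "(2::real) powr (?n / p) = 4 powr (?n / (2 * p))"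
    proof -
      have "(2 powr 2) powr (?n / (2 * p)) = (2::real) powr (2 * (?n / (2 * p)))" by (rule powr_powr)
      then show ?thesis using p by simp
    qed
    ultimately have "Gamma (?n / (2 * p)) * 2 powr (?n / p) * pi powr (?n / 2) / Gamma ((?n * p - ?n) / (2 * p)) = inverse \<gamma>"
      by (simp add: \<gamma>_def riesz_const_def)
    then show ?thesis
      using \<gamma> by (simp add: alpha_def Let_def powr_minus inverse_powr)
  qed
  let ?U = "\<gamma> * X powr (- 1 / p) * (X - D)"
  have "X - ?q * D = X * (1 - ?q * (D / X))" using X by (simp add: field_simps)
  also have "\<dots> \<le> X * (1 - D / X) powr ?q"
    using X q by (intro mult_left_mono one_minus_powr_ge) auto
  also have "\<dots> = \<gamma> powr (- ?q) * ?U powr ?q"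
  proof -
    have "?U powr ?q = \<gamma> powr ?q * (X powr (- 1 / p)) powr ?q * (X - D) powr ?q"
      by (simp add: powr_mult)
    moreover have "(X - D) powr ?q = X powr ?q * (1 - D / X) powr ?q"
    proof -
      have "X - D = X * (1 - D / X)" using X by (simp add: field_simps)
      then show ?thesis by (metis powr_mult)
    qed
    moreover have "(X powr (- 1 / p)) powr ?q * X powr ?q = X"
    proof -
      have "- 1 / p * ?q = - 1 / (p - 1)" using p by (simp add: conj_exp_def)
      then have "- 1 / p * ?q + ?q = - 1 / (p - 1) + p / (p - 1)" by (simp only: conj_exp_def)
      also have "\<dots> = (p - 1) / (p - 1)" unfolding diff_divide_distrib by simp
      finally have "- 1 / p * ?q + ?q = 1" using p by simp
      then show ?thesis using X by (simp add: powr_powr powr_add[symmetric])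
    qed
    moreover have "\<gamma> powr (- ?q) * \<gamma> powr ?q = 1" using \<gamma> by (simp add: powr_add[symmetric])
    ultimately show ?thesis by (metis (no_types, lifting) mult.assoc mult.commute mult_1)
  qed
  also have "\<dots> \<le> \<gamma> powr (- ?q) * u powr ?q"
    using u \<gamma> X q by (intro mult_left_mono powr_mono2) (auto simp: \<gamma>_def)
  finally have "?n / ?\<omega> * (X - ?q * D) \<le> ?n / ?\<omega> * (\<gamma> powr (- ?q) * u powr ?q)"
    using \<omega> by (intro mult_left_mono) auto
  then show ?thesis by (simp add: \<alpha> mult.assoc)
qed

lemma filterlim_powr_at_top:
  fixes r :: real
  assumes "0 < r"
  shows "filterlim (\<lambda>x. x powr r) at_top at_top"
proof -
  have "filterlim (\<lambda>x. exp (r * ln x)) at_top at_top"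
    by (intro filterlim_compose[OF exp_at_top] filterlim_tendsto_pos_mult_at_top[OF tendsto_const assms] ln_at_top)
  moreover have "\<forall>\<^sub>F x in at_top. exp (r * ln x) = x powr r"
    using eventually_gt_at_top[of 0] by eventually_elim (simp add: powr_def)
  ultimately show ?thesis by (simp only: filterlim_cong[OF refl refl])
qed

lemma adams_height_at_top:
  fixes p \<gamma> D :: real
  assumes "1 < p" "0 < \<gamma>" "0 \<le> D"
  shows "filterlim (\<lambda>X. \<gamma> * X powr (- 1 / p) * (X - D)) at_top at_top"
proof (rule filterlim_at_top_mono)
  show "filterlim (\<lambda>X. (\<gamma> / 2) * X powr (1 - 1 / p)) at_top at_top"
    using assms by (intro filterlim_tendsto_pos_mult_at_top[OF tendsto_const] filterlim_powr_at_top) auto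
  show "\<forall>\<^sub>F X in at_top. (\<gamma> / 2) * X powr (1 - 1 / p) \<le> \<gamma> * X powr (- 1 / p) * (X - D)"
    using eventually_ge_at_top[of "2 * D + 1"]
  proof eventually_elim
    case (elim X)
    have "X powr (1 - 1 / p) = X powr (- 1 / p) * X"
      using elim assms powr_add[of X "- 1 / p" 1] by simp
    moreover have "X powr (- 1 / p) * (X / 2) \<le> X powr (- 1 / p) * (X - D)"
      using elim assms by (intro mult_left_mono) auto
    ultimately show ?case using assms by (simp add: mult.assoc)
  qed
qed

text \<open>
  On the ball the exponential is at least \<open>\<epsilon>\<^sup>-\<^sup>n\<close> times a
  constant and the volume is \<open>\<epsilon>\<^sup>n\<close> times a constant; the point is
  that the resulting \<open>k\<close> depends neither on the height \<open>T\<close> nor on the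
  centre.
\<close>

lemma concentrating_functions:
  fixes p \<tau> :: real
  assumes p: "1 < p" and \<tau>: "0 < \<tau>"
  obtains k where "0 < k" and "\<And>T \<delta> (x\<^sub>0::'a::euclidean_space). 0 < \<delta> \<Longrightarrow>
     \<exists>u \<epsilon>. 0 < \<epsilon> \<and> \<epsilon> < \<delta> \<and> u \<in> H_tilde (real DIM('a) / p) p \<and>
       dist_Lp_norm p (bessel_op \<tau> (real DIM('a) / (2 * p)) (regular_dist u)) \<le> 1 \<and>
       (\<forall>x\<in>ball x\<^sub>0 \<epsilon>. T \<le> u x \<and> k \<le> exp (alpha TYPE('a) p * u x powr conj_exp p) * measure lborel (ball x\<^sub>0 \<epsilon>))"
proof -
  let ?n = "real DIM('a)" and ?\<omega> = "sphere_area TYPE('a)"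
  let ?a = "?n / (2 * p)"
  let ?\<gamma> = "riesz_const TYPE('a) ?a"
  have \<omega>: "0 < ?\<omega>" by (rule sphere_area_pos)
  have a: "0 < ?a" "2 * ?a < ?n" using p by (auto simp: field_simps)
  have \<gamma>: "0 < ?\<gamma>" using a by (rule riesz_const_pos)
  obtain D where D: "0 \<le> D" "\<And>\<epsilon> (x\<^sub>0::'a) z. 0 < \<epsilon> \<Longrightarrow> \<epsilon> < 1 \<Longrightarrow> norm z \<le> \<epsilon> / 2 \<Longrightarrow>
     ?\<gamma> * (?\<omega> * ln (1 / \<epsilon>)) powr (- 1 / p) * (?\<omega> * ln (1 / \<epsilon>) - D)
     \<le> bessel_potential \<tau> ?a (adams p \<epsilon> x\<^sub>0) (x\<^sub>0 + z)"
    using bessel_potential_adams_lower_bound[OF p \<tau>, where 'a='a] by blast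
  define k where "k = exp (- (?n / ?\<omega> * (conj_exp p * D))) * (unit_ball_vol ?n * (1 / 2) ^ DIM('a))"
  have "0 < k" by (simp add: k_def)
  moreover have "\<exists>u \<epsilon>. 0 < \<epsilon> \<and> \<epsilon> < \<delta> \<and> u \<in> H_tilde (?n / p) p \<and>
       dist_Lp_norm p (bessel_op \<tau> ?a (regular_dist u)) \<le> 1 \<and>
       (\<forall>x\<in>ball x\<^sub>0 \<epsilon>. T \<le> u x \<and> k \<le> exp (alpha TYPE('a) p * u x powr conj_exp p) * measure lborel (ball x\<^sub>0 \<epsilon>))"
    if "0 < \<delta>" for T \<delta> and x\<^sub>0 :: 'a
  proof -
    have "\<forall>\<^sub>F X in at_top. T \<le> ?\<gamma> * X powr (- 1 / p) * (X - D) \<and> D < X \<and> 0 < X \<and> ?\<omega> * ln (1 / \<delta>) < X"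
      using adams_height_at_top[OF p \<gamma> D(1)] unfolding filterlim_at_top
      by (intro eventually_conj eventually_gt_at_top) auto
    then obtain X where X: "T \<le> ?\<gamma> * X powr (- 1 / p) * (X - D)" "D < X" "0 < X" "?\<omega> * ln (1 / \<delta>) < X"
      using eventually_happens[of _ "at_top :: real filter"] by auto
    \<comment> \<open>so that \<open>X = \<omega> ln (1/\<epsilon>)\<close>\<close>
    define \<epsilon> where "\<epsilon> = exp (- X / ?\<omega>)"
    have \<epsilon>: "0 < \<epsilon>" "\<epsilon> < 1" using X \<omega> by (auto simp: \<epsilon>_def)
    have \<epsilon>X: "?\<omega> * ln (1 / \<epsilon>) = X" using \<omega> by (simp add: \<epsilon>_def ln_div)
    have "\<epsilon> < \<delta>"
    proof -
      have "- ln \<delta> < X / ?\<omega>" using X(4) \<omega> that by (simp add: ln_div field_simps)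
      then have "- X / ?\<omega> < ln \<delta>" by simp
      then have "\<epsilon> < exp (ln \<delta>)" unfolding \<epsilon>_def by (simp only: exp_less_cancel_iff)
      then show ?thesis using that by simp
    qed
    let ?u = "bessel_potential \<tau> ?a (adams p \<epsilon> x\<^sub>0)"
    have g: "adams p \<epsilon> x\<^sub>0 \<in> L1_Linf" by (rule adams_L1_Linf[OF \<epsilon> p])
    have "bessel_potential \<tau> (?n / p / 2) (adams p \<epsilon> x\<^sub>0) \<in> H_tilde (?n / p) p"
      using p \<tau> g by (intro bessel_potential_H_tilde) auto
    then have u1: "?u \<in> H_tilde (?n / p) p" by (simp add: mult.commute)
    have u2: "dist_Lp_norm p (bessel_op \<tau> ?a (regular_dist ?u)) \<le> 1"
      using dist_Lp_norm_bessel_op_le[OF a(1) \<tau> p g] by (simp add: Lp_norm_adams[OF \<epsilon> p])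
    have u3: "T \<le> ?u x \<and> k \<le> exp (alpha TYPE('a) p * ?u x powr conj_exp p) * measure lborel (ball x\<^sub>0 (\<epsilon> / 2))"
      if "x \<in> ball x\<^sub>0 (\<epsilon> / 2)" for x
    proof -
      have "norm (x - x\<^sub>0) \<le> \<epsilon> / 2" using that by (simp add: dist_norm norm_minus_commute)
      from D(2)[OF \<epsilon> this, of x\<^sub>0] have lb: "?\<gamma> * X powr (- 1 / p) * (X - D) \<le> ?u x" by (simp add: \<epsilon>X)
      have "?n / ?\<omega> * (X - conj_exp p * D) \<le> alpha TYPE('a) p * ?u x powr conj_exp p"
        using X by (intro adams_exponent_bound[OF p _ _ D(1) lb]) auto
      then have "exp (?n / ?\<omega> * (X - conj_exp p * D)) \<le> exp (alpha TYPE('a) p * ?u x powr conj_exp p)" by simp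
      moreover have "exp (?n / ?\<omega> * (X - conj_exp p * D)) * \<epsilon> ^ DIM('a) = exp (- (?n / ?\<omega> * (conj_exp p * D)))"
        using \<omega> by (simp add: \<epsilon>_def exp_of_nat_mult[symmetric] exp_add[symmetric] field_simps)
      moreover have "measure lborel (ball x\<^sub>0 (\<epsilon> / 2)) = \<epsilon> ^ DIM('a) * (unit_ball_vol ?n * (1 / 2) ^ DIM('a))"
        using \<epsilon> by (simp add: content_ball power_divide)
      moreover have "exp (?n / ?\<omega> * (X - conj_exp p * D)) * measure lborel (ball x\<^sub>0 (\<epsilon> / 2))
          \<le> exp (alpha TYPE('a) p * ?u x powr conj_exp p) * measure lborel (ball x\<^sub>0 (\<epsilon> / 2))"
        by (rule mult_right_mono) (use calculation(1) in auto)
      ultimately have "k \<le> exp (alpha TYPE('a) p * ?u x powr conj_exp p) * measure lborel (ball x\<^sub>0 (\<epsilon> / 2))"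
        unfolding k_def by (simp only: mult.assoc[symmetric])
      then show ?thesis using lb X(1) by linarith
    qed
    show ?thesis
      by (rule exI[of _ ?u], rule exI[of _ "\<epsilon> / 2"]) (use \<epsilon> \<open>\<epsilon> < \<delta>\<close> u1 u2 u3 in auto)
  qed
  ultimately show ?thesis using that by blast
qed

lemma eventually_trunc_exp_ge:
  "\<forall>\<^sub>F t in at_top. exp t / 2 \<le> trunc_exp p t"
proof -
  let ?S = "{0..(LEAST j::nat. p \<le> real j) - 2}"
  have "((\<lambda>t::real. \<Sum>j\<in>?S. (t ^ j / exp t) * inverse (fact j)) \<longlongrightarrow> (\<Sum>j\<in>?S. 0 * inverse (fact j))) at_top"
    by (intro tendsto_sum tendsto_mult tendsto_const tendsto_power_div_exp_0)
  then have "((\<lambda>t::real. (\<Sum>j\<in>?S. (t ^ j / exp t) * inverse (fact j))) \<longlongrightarrow> 0) at_top" by simp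
  then have "\<forall>\<^sub>F t::real in at_top. (\<Sum>j\<in>?S. (t ^ j / exp t) * inverse (fact j)) < 1 / 2"
    by (rule order_tendstoD) simp
  then show ?thesis
  proof eventually_elim
    case (elim t)
    have "(\<Sum>j\<in>?S. t ^ j / fact j) = exp t * (\<Sum>j\<in>?S. (t ^ j / exp t) * inverse (fact j))"
      unfolding sum_distrib_left by (intro sum.cong refl) (simp add: field_simps)
    also have "\<dots> \<le> exp t * (1 / 2)" using elim by (intro mult_left_mono) auto
    finally show ?case by (simp add: trunc_exp_def)
  qed
qed

lemma alpha_pos:
  assumes "1 < p"
  shows "0 < alpha TYPE('a::euclidean_space) p"
proof -
  have "0 < (real DIM('a) * p - real DIM('a)) / (2 * p)" using assms by simp
  moreover have "0 < real DIM('a) / (2 * p)" using assms by simp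
  ultimately have "0 < Gamma ((real DIM('a) * p - real DIM('a)) / (2 * p))" "0 < Gamma (real DIM('a) / (2 * p))"
    by (auto intro: Gamma_real_pos)
  then show ?thesis
    using sphere_area_pos[where 'a='a] unfolding alpha_def Let_def
    by (intro mult_pos_pos divide_pos_pos powr_gt_zero[THEN iffD2]) auto
qed

lemma SUP_eq_infinity:
  fixes F :: "'b \<Rightarrow> ennreal" and k :: real
  assumes "0 < k" and "\<And>M. 0 \<le> M \<Longrightarrow> \<exists>u\<in>A. ennreal (M * k) \<le> F u"
  shows "(SUP u\<in>A. F u) = \<infinity>"
  unfolding infinity_ennreal_def
proof (rule ennreal_SUP_eq_top)
  fix N :: nat
  obtain u where "u \<in> A" "ennreal (real N / k * k) \<le> F u"
    using assms(2)[of "real N / k"] assms(1) by auto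
  then show "\<exists>u\<in>A. of_nat N \<le> F u"
    using assms(1) by (auto simp: ennreal_of_nat_eq_real_of_nat)
qed

theorem theorem1p2:
  fixes \<Omega> :: "(real ^ 'n) set" and f :: "real \<Rightarrow> real" and \<tau> p :: real
  assumes "open \<Omega>" and "connected \<Omega>" and "\<Omega> \<noteq> {}"
    and "emeasure lborel \<Omega> < \<infinity>"
    and "f \<in> borel_measurable (restrict_space borel {0..})"
    and "\<And>t. 0 \<le> t \<Longrightarrow> 0 \<le> f t"
    and "filterlim f at_top at_top"
    and "0 < \<tau>" and "1 < p"
  shows "(SUP u :: real ^ 'n \<Rightarrow> real \<in> {u \<in> H_tilde (real CARD('n) / p) p.
             dist_Lp_norm p (bessel_op \<tau> (real CARD('n) / (2 * p)) (regular_dist u)) \<le> 1}.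
           \<integral>\<^sup>+ x \<in> \<Omega>. ennreal (f \<bar>u x\<bar> *
             exp (alpha TYPE(real ^ 'n) p * \<bar>u x\<bar> powr conj_exp p)) \<partial>lborel) = \<infinity>
       \<and> (SUP u :: real ^ 'n \<Rightarrow> real \<in> {u \<in> H_tilde (real CARD('n) / p) p.
             dist_Lp_norm p (bessel_op \<tau> (real CARD('n) / (2 * p)) (regular_dist u)) \<le> 1}.
           \<integral>\<^sup>+ x. ennreal (f \<bar>u x\<bar> *
             trunc_exp p (alpha TYPE(real ^ 'n) p * \<bar>u x\<bar> powr conj_exp p)) \<partial>lborel) = \<infinity>"
proof -
  let ?A = "{u \<in> H_tilde (real CARD('n) / p) p.
     dist_Lp_norm p (bessel_op \<tau> (real CARD('n) / (2 * p)) (regular_dist (u :: real ^ 'n \<Rightarrow> real))) \<le> 1}"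
  let ?e = "\<lambda>t. alpha TYPE(real ^ 'n) p * t powr conj_exp p"
  obtain k where k: "0 < k" and conc: "\<And>T \<delta> (x\<^sub>0::real ^ 'n). 0 < \<delta> \<Longrightarrow>
     \<exists>u \<epsilon>. 0 < \<epsilon> \<and> \<epsilon> < \<delta> \<and> u \<in> ?A \<and>
       (\<forall>x\<in>ball x\<^sub>0 \<epsilon>. T \<le> u x \<and> k \<le> exp (?e (u x)) * measure lborel (ball x\<^sub>0 \<epsilon>))"
    using concentrating_functions[OF \<open>1 < p\<close> \<open>0 < \<tau>\<close>, where 'a="real ^ 'n"] by (simp add: conj_assoc) blast
  obtain x\<^sub>0 \<delta> where \<delta>: "0 < \<delta>" "ball x\<^sub>0 \<delta> \<subseteq> \<Omega>"
    using \<open>open \<Omega>\<close> \<open>\<Omega> \<noteq> {}\<close> by (metis ex_in_conv open_contains_ball)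
  \<comment> \<open>both nonlinearities dominate half the exponential near infinity; the integrands on
      \<open>\<Omega>\<close> are then treated alike\<close>
  have main: "\<exists>u\<in>?A. ennreal (M * k) \<le> (\<integral>\<^sup>+ x \<in> \<Omega>. ennreal (f \<bar>u x\<bar> * \<Psi> (?e \<bar>u x\<bar>)) \<partial>lborel)"
    if \<Psi>: "\<forall>\<^sub>F t in at_top. exp t / 2 \<le> \<Psi> t" and M: "0 \<le> M" for M \<Psi>
  proof -
    have "filterlim ?e at_top at_top"
      using alpha_pos[OF \<open>1 < p\<close>, where 'a="real ^ 'n"] \<open>1 < p\<close>
      by (intro filterlim_tendsto_pos_mult_at_top[OF tendsto_const] filterlim_powr_at_top) (auto simp: conj_exp_def)
    then have "\<forall>\<^sub>F t in at_top. exp (?e t) / 2 \<le> \<Psi> (?e t)"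
      using \<Psi> by (rule filterlim_iff[THEN iffD1, rule_format])
    \<comment> \<open>the factor \<open>2\<close> makes up for the half lost from the exponential\<close>
    moreover have "\<forall>\<^sub>F t in at_top. 2 * M \<le> f t"
      using \<open>filterlim f at_top at_top\<close> by (simp add: filterlim_at_top)
    ultimately have "\<forall>\<^sub>F t in at_top. exp (?e t) / 2 \<le> \<Psi> (?e t) \<and> 2 * M \<le> f t" by (rule eventually_conj)
    then obtain T where T: "\<And>t. T \<le> t \<Longrightarrow> exp (?e t) / 2 \<le> \<Psi> (?e t) \<and> 2 * M \<le> f t"
      unfolding eventually_at_top_linorder by blast
    obtain u \<epsilon> where u: "0 < \<epsilon>" "\<epsilon> < \<delta>" "u \<in> ?A"
      and ub: "\<And>x. x \<in> ball x\<^sub>0 \<epsilon> \<Longrightarrow> max T 0 \<le> u x \<and> k \<le> exp (?e (u x)) * measure lborel (ball x\<^sub>0 \<epsilon>)"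
      using conc[OF \<delta>(1), where T="max T 0" and x\<^sub>0=x\<^sub>0] by blast
    let ?V = "measure lborel (ball x\<^sub>0 \<epsilon>)"
    have V: "0 < ?V" using u(1) by (simp add: content_ball)
    have E: "emeasure lborel (ball x\<^sub>0 \<epsilon>) = ennreal ?V" using u(1) by (simp add: emeasure_ball content_ball)
    have "ennreal (M * k) = (\<integral>\<^sup>+ x. ennreal (M * k / ?V) * indicator (ball x\<^sub>0 \<epsilon>) x \<partial>lborel)"
      using V M k by (simp add: nn_integral_cmult_indicator E ennreal_mult'[symmetric])
    also have "\<dots> \<le> (\<integral>\<^sup>+ x \<in> \<Omega>. ennreal (f \<bar>u x\<bar> * \<Psi> (?e \<bar>u x\<bar>)) \<partial>lborel)"
    proof (rule nn_integral_mono)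
      fix x
      show "ennreal (M * k / ?V) * indicator (ball x\<^sub>0 \<epsilon>) x \<le> ennreal (f \<bar>u x\<bar> * \<Psi> (?e \<bar>u x\<bar>)) * indicator \<Omega> x"
      proof (cases "x \<in> ball x\<^sub>0 \<epsilon>")
        case True
        then have "x \<in> \<Omega>" using \<delta> u by auto
        have ux: "T \<le> u x" "0 \<le> u x" "k / ?V \<le> exp (?e (u x))"
          using ub[OF True] V by (auto simp: pos_divide_le_eq)
        have "M * k / ?V = (2 * M) * ((k / ?V) / 2)" by simp
        also have "\<dots> \<le> f (u x) * \<Psi> (?e (u x))"
          using T[OF ux(1)] ux M k V by (intro mult_mono) (auto intro: order_trans[OF divide_right_mono])
        finally show ?thesis using True \<open>x \<in> \<Omega>\<close> ux by (simp add: ennreal_leI)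
      qed simp
    qed
    finally show ?thesis using u(3) by blast
  qed
  have "\<forall>\<^sub>F t in at_top. exp t / 2 \<le> exp (t :: real)" by simp
  then have "(SUP u\<in>?A. \<integral>\<^sup>+ x \<in> \<Omega>. ennreal (f \<bar>u x\<bar> * exp (?e \<bar>u x\<bar>)) \<partial>lborel) = \<infinity>"
    by (intro SUP_eq_infinity[OF k] main)
  moreover have "(SUP u\<in>?A. \<integral>\<^sup>+ x. ennreal (f \<bar>u x\<bar> * trunc_exp p (?e \<bar>u x\<bar>)) \<partial>lborel) = \<infinity>"
  proof (rule SUP_eq_infinity[OF k])
    fix M :: real assume "0 \<le> M"
    from main[OF eventually_trunc_exp_ge this] obtain u where u: "u \<in> ?A"
      "ennreal (M * k) \<le> (\<integral>\<^sup>+ x \<in> \<Omega>. ennreal (f \<bar>u x\<bar> * trunc_exp p (?e \<bar>u x\<bar>)) \<partial>lborel)" by blast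
    note u(2)
    also have "(\<integral>\<^sup>+ x \<in> \<Omega>. ennreal (f \<bar>u x\<bar> * trunc_exp p (?e \<bar>u x\<bar>)) \<partial>lborel)
        \<le> (\<integral>\<^sup>+ x. ennreal (f \<bar>u x\<bar> * trunc_exp p (?e \<bar>u x\<bar>)) \<partial>lborel)"
      by (intro nn_integral_mono) (auto simp: indicator_def)
    finally show "\<exists>u\<in>?A. ennreal (M * k) \<le> (\<integral>\<^sup>+ x. ennreal (f \<bar>u x\<bar> * trunc_exp p (?e \<bar>u x\<bar>)) \<partial>lborel)"
      using u(1) by blast
  qed
  ultimately show ?thesis by blast
qed

end
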